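(* Let $N,n\geq 1$ be integers and let $r_1,\ldots,r_N\in(0,\infty)$. Let $\phi:\mathcal{K}^n\to[0,\infty)$ be a function that is quasi-concave with respect to Minkowski addition, monotone, and rotation-invariant. Let $f_1,\ldots,f_N$ be probability densities on $\mathbb{R}^n$. Let $X_1,\ldots,X_N$ be independent random vectors with $X_i$ distributed according to $f_i$, and let $X_1^*,\ldots,X_N^*$ be independent random vectors with $X_i^*$ distributed according to the symmetric decreasing rearrangement $f_i^*$ of $f_i$, for $i=1,\ldots,N$. Then for any $s\geq 0$, $$\mathbb{P}\left(\phi\Big(\bigcap_{i=1}^N B(X_i,r_i)\Big)>s\right)\leq \mathbb{P}\left(\phi\Big(\bigcap_{i=1}^N B(X_i^*,r_i)\Big)>s\right).$$ Furthermore, assume each $f_i$ is bounded, and let $Z_1,\ldots,Z_N$ be independent random vectors with $Z_i$ distributed according to the density $a_i\mathbf{1}_{b_iB}$, where $a_i=\|f_i\|_\infty$ and $b_i>0$ satisfies $\int_{\mathbb{R}^n}a_i\mathbf{1}_{b_iB}(x)\,dx=1$, for $i=1,\ldots,N$. Then for any $s\geq 0$, $$\mathbb{P}\left(\phi\Big(\bigcap_{i=1}^N B(X_i,r_i)\Big)>s\right)\leq \mathbb{P}\left(\phi\Big(\bigcap_{i=1}^N B(Z_i,r_i)\Big)>s\right).$$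
   Context: $\mathcal{K}^n$ is the set of convex bodies in $\mathbb{R}^n$ (compact convex sets with non-empty interior). $B(x,r)$ is the closed Euclidean ball with center $x$ and radius $r$; $B=B(0,1)$. For $\phi:\mathcal{K}^n\to[0,\infty)$: (a) $\phi$ is quasi-concave with respect to Minkowski addition if $\phi((1-\lambda)K+\lambda L)\geq\min(\phi(K),\phi(L))$ for all $K,L\in\mathcal{K}^n$ and $\lambda\in(0,1)$; (b) $\phi$ is monotone if $\phi(K)\leq\phi(L)$ whenever $K,L\in\mathcal{K}^n$ and $K\subseteq L$; (c) $\phi$ is rotation-invariant if $\phi(UK)=\phi(K)$ for all orthogonal transformations $U$ of $\mathbb{R}^n$ and all $K\in\mathcal{K}^n$. Convention: when an intersection of balls has empty interior (so it is empty or a single point), the value of $\phi$ on it is taken to be $0$. A probability density on $\mathbb{R}^n$ is a (measurable) non-negative function with Lebesgue integral one. For a Borel set $A\subseteq\mathbb{R}^n$ of finite measure, $A^*$ is the open Euclidean ball centered at the origin with the same Lebesgue measure as $A$; for an integrable $f:\mathbb{R}^n\to[0,\infty)$, the symmetric decreasing rearrangement is $f^*(x)=\int_0^\infty \mathbf{1}_{\{f>s\}^*}(x)\,ds$. $\|\cdot\|_\infty$ is the $L_\infty(\mathbb{R}^n)$-norm. *)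

theory Defs
  imports "HOL-Probability.Probability"
begin

definition convex_body :: "(real ^ 'n) set \<Rightarrow> bool" where
  "convex_body K \<longleftrightarrow> compact K \<and> convex K \<and> interior K \<noteq> {}"

text \<open>Functionals on convex bodies are total functions on sets; only their values on
  convex bodies are constrained. The sum of sets below is the Minkowski sum.\<close>

definition minkowski_quasi_concave :: "((real ^ 'n) set \<Rightarrow> real) \<Rightarrow> bool" where
  "minkowski_quasi_concave \<phi> \<longleftrightarrow>
    (\<forall>K L. \<forall>t::real. convex_body K \<longrightarrow> convex_body L \<longrightarrow> 0 < t \<longrightarrow> t < 1 \<longrightarrow>
      min (\<phi> K) (\<phi> L) \<le> \<phi> ((\<lambda>x. (1 - t) *\<^sub>R x) ` K + (\<lambda>x. t *\<^sub>R x) ` L))"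

definition monotone_on_bodies :: "((real ^ 'n) set \<Rightarrow> real) \<Rightarrow> bool" where
  "monotone_on_bodies \<phi> \<longleftrightarrow>
    (\<forall>K L. convex_body K \<longrightarrow> convex_body L \<longrightarrow> K \<subseteq> L \<longrightarrow> \<phi> K \<le> \<phi> L)"

definition rotation_invariant :: "((real ^ 'n) set \<Rightarrow> real) \<Rightarrow> bool" where
  "rotation_invariant \<phi> \<longleftrightarrow>
    (\<forall>U K. orthogonal_transformation U \<longrightarrow> convex_body K \<longrightarrow> \<phi> (U ` K) = \<phi> K)"

text \<open>The convention that an intersection of balls with empty interior gets value 0.\<close>

definition body_value :: "((real ^ 'n) set \<Rightarrow> real) \<Rightarrow> (real ^ 'n) set \<Rightarrow> real" where
  "body_value \<phi> K = (if interior K = {} then 0 else \<phi> K)"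

definition prob_density :: "(real ^ 'n \<Rightarrow> real) \<Rightarrow> bool" where
  "prob_density f \<longleftrightarrow>
    f \<in> borel_measurable borel \<and> (\<forall>x. 0 \<le> f x) \<and> (\<integral>\<^sup>+ x. ennreal (f x) \<partial>lborel) = 1"

text \<open>The description determines the ball uniquely for Borel sets of finite measure; for null
  sets it is the empty ball.\<close>

definition rearranged_set :: "(real ^ 'n) set \<Rightarrow> (real ^ 'n) set" where
  "rearranged_set A =
    (THE S. (\<exists>r. S = ball 0 r) \<and> emeasure lborel S = emeasure lborel A)"

text \<open>The value is an extended real because the rearrangement of an unbounded density can be
  infinite at the origin (and only there). The level 0, where the superlevel set may have
  infinite measure, is left out of the integral.\<close>

definition sym_decr_rearrangement :: "(real ^ 'n \<Rightarrow> real) \<Rightarrow> real ^ 'n \<Rightarrow> ennreal" where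
  "sym_decr_rearrangement f x =
    (\<integral>\<^sup>+ s\<in>{0<..}. indicator (rearranged_set {y. s < f y}) x \<partial>(lborel :: real measure))"

definition Linf_norm :: "(real ^ 'n \<Rightarrow> real) \<Rightarrow> ennreal" where
  "Linf_norm f = esssup lborel (\<lambda>x. ennreal \<bar>f x\<bar>)"

definition indep_with_densities ::
  "'w measure \<Rightarrow> nat set \<Rightarrow> (nat \<Rightarrow> 'w \<Rightarrow> real ^ 'n) \<Rightarrow> (nat \<Rightarrow> real ^ 'n \<Rightarrow> ennreal) \<Rightarrow> bool" where
  "indep_with_densities M I X g \<longleftrightarrow>
    prob_space M \<and> prob_space.indep_vars M (\<lambda>_. borel) X I \<and>
    (\<forall>i\<in>I. distributed M lborel (X i) (g i))"

text \<open>The random variable below need not be measurable on \<open>M\<close>: the set of centres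
  whose balls intersect in a body of value greater than \<open>s\<close> is convex, hence Lebesgue
  measurable, but not necessarily Borel. As the joint law of the centres has a density, the event
  is measurable in the completion of \<open>M\<close>, in which the probability is therefore taken.\<close>

definition prob_exceeds ::
  "'w measure \<Rightarrow> ((real ^ 'n) set \<Rightarrow> real) \<Rightarrow> nat \<Rightarrow> (nat \<Rightarrow> real) \<Rightarrow>
    (nat \<Rightarrow> 'w \<Rightarrow> real ^ 'n) \<Rightarrow> real \<Rightarrow> real" where
  "prob_exceeds M \<phi> N r X s =
    \<P>(\<omega> in completion M. body_value \<phi> (\<Inter>i\<in>{1..N}. cball (X i \<omega>) (r i)) > s)"

end

theory Submission
  imports Defs
begin

text \<open>Fix a level \<open>s \<ge> 0\<close> and let \<open>C\<close> be the set of tuples of centres \<open>(x\<^sub>1, \<dots>, x\<^sub>N)\<close> for which \<open>\<phi>\<close> of the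
intersection of the balls exceeds \<open>s\<close>. A Minkowski combination of two such intersections lies in
the intersection belonging to the combined centres, so quasi-concavity and monotonicity of \<open>\<phi>\<close>
make \<open>C\<close> convex, and rotation invariance makes it invariant under applying one orthogonal map to
all centres simultaneously. For such a set \<open>C\<close>, what has to be proved is that the
integral of \<open>\<Prod>\<^sub>i f\<^sub>i(x\<^sub>i)\<close> over \<open>C\<close> does not decrease when every \<open>f\<^sub>i\<close> is replaced by its
symmetric decreasing rearrangement (\<open>rearrangement_functions\<close>). Writing each \<open>f\<^sub>i\<close>
as a superposition of indicators of superlevel sets reduces this to sets: the volume of
\<open>C \<inter> (A\<^sub>1 \<times> \<dots> \<times> A\<^sub>N)\<close> does not decrease when every \<open>A\<^sub>i\<close> is replaced by the centred ball of the same
volume (\<open>rearrangement_sets\<close>).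

For sets, integrate first along the lines parallel to a unit vector \<open>e\<close>, one line for each factor.
On a product of such lines \<open>C\<close> becomes a convex subset of \<open>\<real>\<^sup>N\<close>, and invariance under the reflection
that reverses \<open>e\<close> makes it symmetric about the origin. There the claim is about sets
\<open>A\<^sub>i \<subseteq> \<real>\<close> and centred intervals (\<open>rearrangement_real\<close>). For finite unions of intervals, move all
midpoints \<open>c\<close> to \<open>\<tau> c\<close> with \<open>\<tau>\<close> decreasing from \<open>1\<close>. For each product of single intervals the volume
of the part inside \<open>C\<close> cannot decrease, since as a function of \<open>\<tau>\<close> it is even and, by the
Prekopa-Leindler inequality, log-concave (\<open>anderson_box\<close>). When two intervals touch, they are merged
and the process restarts, until one centred interval is left in each coordinate. Integrated over
all lines this says that simultaneous Steiner symmetrization of the \<open>A\<^sub>i\<close> is favourable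
(\<open>steiner_increases\<close>).

Steiner symmetrization never decreases the overlap of a set with the centred ball of its volume, and
averaging over directions produces a direction in which the overlap grows by a definite amount as
long as it is not nearly full (\<open>steiner_uniform_gain\<close>). Hence, among all tuples that repeated
symmetrization can reach, the supremum of the total overlap is the full one, and the inequality for
balls follows by approximation (\<open>rearrangement_bounded_sets\<close>).

For the comparison with uniform densities \<open>a\<^sub>i 1\<close> on balls, the integral is linear in each \<open>f\<^sub>i\<close>
separately. By the bathtub principle each \<open>f\<^sub>i\<close> bounded by \<open>a\<^sub>i\<close> may be replaced, one after the other,
by \<open>a\<^sub>i\<close> times an indicator function without decreasing the integral, and then the inequality for sets
applies (\<open>rearrangement_bounded_functions\<close>).

The set \<open>C\<close> need not be Borel. Being convex and symmetric, it either lies in a hyperplane or contains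
a neighbourhood of the origin; in both cases it differs by a null set from an open set with the same
symmetries (\<open>open_kernel_almost_all\<close>), to which all of the above is applied.\<close>

section \<open>The Prekopa-Leindler inequality\<close>

lemma emeasure_lborel_eq_SUP_compact:
  fixes A :: "'a::euclidean_space set"
  assumes [measurable]: "A \<in> sets borel"
  shows "emeasure lborel A = (SUP K\<in>{K. compact K \<and> K \<subseteq> A}. emeasure lborel K)"
proof (rule antisym)
  let ?S = "SUP K\<in>{K. compact K \<and> K \<subseteq> A}. emeasure lborel K"
  have bounded_le: "emeasure lborel (A \<inter> cball 0 (real n)) \<le> ?S" for n :: nat
  proof (rule ennreal_le_epsilon)
    fix e :: real assume "0 < e"
    have "A \<inter> cball 0 (real n) \<in> sets lebesgue"
      by simp
    then obtain T where T: "closed T" "T \<subseteq> A \<inter> cball 0 (real n)"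
        "emeasure lebesgue ((A \<inter> cball 0 (real n)) - T) < ennreal e"
      using sets_lebesgue_inner_closed[OF _ \<open>0 < e\<close>] by metis
    have "compact T"
      using T by (meson bounded_cball bounded_subset compact_eq_bounded_closed le_infE)
    have [measurable]: "T \<in> sets borel"
      using T by auto
    have "emeasure lborel (A \<inter> cball 0 (real n))
        = emeasure lborel T + emeasure lborel ((A \<inter> cball 0 (real n)) - T)"
      using T(2) by (subst plus_emeasure) (auto simp: Un_absorb1 Un_Diff_cancel)
    also have "\<dots> \<le> ?S + e"
    proof (rule add_mono)
      show "emeasure lborel T \<le> ?S"
        using T(2) \<open>compact T\<close> by (intro SUP_upper) auto
      show "emeasure lborel ((A \<inter> cball 0 (real n)) - T) \<le> e"
        using T(3) by (subst (asm) emeasure_completion) auto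
    qed
    finally show "emeasure lborel (A \<inter> cball 0 (real n)) \<le> ?S + e" .
  qed
  have "emeasure lborel A = emeasure lborel (\<Union>n. A \<inter> cball 0 (real n))"
  proof -
    have "x \<in> (\<Union>n. cball 0 (real n))" for x :: 'a
      using real_arch_simple[of "norm x"] by auto
    then show ?thesis by (intro arg_cong[where f = "emeasure lborel"]) auto
  qed
  also have "\<dots> = (SUP n. emeasure lborel (A \<inter> cball 0 (real n)))"
    by (rule SUP_emeasure_incseq[symmetric]) (auto simp: incseq_def)
  also have "\<dots> \<le> ?S"
    using bounded_le by (intro SUP_least) auto
  finally show "emeasure lborel A \<le> ?S" .
  show "?S \<le> emeasure lborel A"
    by (intro SUP_least emeasure_mono) auto
qed

lemma emeasure_lborel_affine_image:
  fixes A :: "real set"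
  assumes "compact A" "0 < l"
  shows "emeasure lborel ((\<lambda>x. c + l * x) ` A) = ennreal l * emeasure lborel A"
proof -
  have c': "compact ((\<lambda>x. c + l * x) ` A)"
    by (intro compact_continuous_image continuous_intros assms)
  have m: "(\<lambda>x. c + l * x) ` A \<in> sets borel"
    using c' by (simp add: borel_compact)
  have "(\<lambda>x. c + l * x) -` ((\<lambda>x. c + l * x) ` A) = A"
    using \<open>0 < l\<close> by (auto simp: image_iff)
  moreover have "emeasure lborel ((\<lambda>x. c + l * x) ` A)
      = ennreal \<bar>l\<bar> * emeasure lborel ((\<lambda>x. c + l * x) -` ((\<lambda>x. c + l * x) ` A))"
    using \<open>0 < l\<close> m
    by (subst lborel_real_affine[of l c])
       (auto simp: emeasure_density nn_integral_cmult_indicator emeasure_distr)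
  ultimately show ?thesis using \<open>0 < l\<close> by simp
qed

text \<open>For compact sets, \<open>l A\<close> and \<open>m B\<close> can be translated so that the largest point of the first is the
smallest point of the second. Both translates lie in \<open>l A + m B\<close> and they overlap in one point, so
their lengths add up. Inner regularity gives the general case, in which \<open>l A + m B\<close> itself may fail to
be measurable; this is why a measurable superset \<open>W\<close> appears.\<close>

lemma brunn_minkowski_real:
  fixes A B W :: "real set"
  assumes A: "A \<in> sets borel" "A \<noteq> {}" and B: "B \<in> sets borel" "B \<noteq> {}"
    and W: "W \<in> sets borel" and l: "0 < l" and m: "0 < m"
    and sub: "\<And>a b. a \<in> A \<Longrightarrow> b \<in> B \<Longrightarrow> l * a + m * b \<in> W"
  shows "ennreal l * emeasure lborel A + ennreal m * emeasure lborel B \<le> emeasure lborel W"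
proof -
  define CA where "CA = {K. compact K \<and> K \<subseteq> A \<and> K \<noteq> {}}"
  define CB where "CB = {K. compact K \<and> K \<subseteq> B \<and> K \<noteq> {}}"
  have cpt: "ennreal l * emeasure lborel K + ennreal m * emeasure lborel L \<le> emeasure lborel W"
    if "K \<in> CA" "L \<in> CB" for K L
  proof -
    from that have K: "compact K" "K \<subseteq> A" "K \<noteq> {}" and L: "compact L" "L \<subseteq> B" "L \<noteq> {}"
      by (auto simp: CA_def CB_def)
    obtain p where p: "p \<in> K" "\<And>x. x \<in> K \<Longrightarrow> x \<le> p"
      using compact_attains_sup[OF K(1,3)] by auto
    obtain q where q: "q \<in> L" "\<And>x. x \<in> L \<Longrightarrow> q \<le> x"
      using compact_attains_inf[OF L(1,3)] by auto
    define S1 where "S1 = (\<lambda>x. m * q + l * x) ` K"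
    define S2 where "S2 = (\<lambda>x. l * p + m * x) ` L"
    have c: "compact S1" "compact S2"
      unfolding S1_def S2_def by (intro compact_continuous_image continuous_intros K L)+
    have meas [measurable]: "S1 \<in> sets borel" "S2 \<in> sets borel"
      using c by (auto simp: borel_compact)
    (* S1 lies to the left of the point m q + l p and S2 to the right of it. *)
    have "S1 \<inter> S2 \<subseteq> {m * q + l * p}"
    proof
      fix z assume "z \<in> S1 \<inter> S2"
      then have "z \<in> (\<lambda>x. m * q + l * x) ` K" "z \<in> (\<lambda>x. l * p + m * x) ` L"
        by (auto simp: S1_def S2_def)
      then obtain x y where x: "x \<in> K" "z = m * q + l * x" and y: "y \<in> L" "z = l * p + m * y"
        by (elim imageE)
      have "l * x \<le> l * p" "m * q \<le> m * y"
        using p(2)[OF x(1)] q(2)[OF y(1)] l m by auto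
      then have "z = m * q + l * p" using x(2) y(2) by linarith
      then show "z \<in> {m * q + l * p}" by simp
    qed
    then have null: "emeasure lborel (S1 \<inter> S2) = 0"
      by (metis emeasure_lborel_countable countable_finite finite.emptyI finite.insertI finite_subset)
    have "emeasure lborel S1 + emeasure lborel S2 = emeasure lborel (S1 \<union> S2)"
    proof -
      have "emeasure lborel (S1 \<union> S2) = emeasure lborel S1 + emeasure lborel (S2 - S1)"
        by (subst plus_emeasure) auto
      moreover have "emeasure lborel (S2 - S1) = emeasure lborel S2"
      proof -
        have "emeasure lborel S2 = emeasure lborel (S2 - S1) + emeasure lborel (S1 \<inter> S2)"
          by (subst plus_emeasure) (auto intro!: arg_cong[where f = "emeasure lborel"])
        then show ?thesis using null by simp
      qed
      ultimately show ?thesis by simp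
    qed
    moreover have "S1 \<union> S2 \<subseteq> W"
    proof -
      have "m * q + l * x \<in> W" if "x \<in> K" for x
        using sub[of x q] that K L q by (auto simp: add.commute)
      moreover have "l * p + m * x \<in> W" if "x \<in> L" for x
        using sub[of p x] that K L p by auto
      ultimately show ?thesis by (auto simp: S1_def S2_def)
    qed
    then have "emeasure lborel (S1 \<union> S2) \<le> emeasure lborel W"
      using W by (intro emeasure_mono) auto
    ultimately show ?thesis
      unfolding S1_def S2_def using emeasure_lborel_affine_image[OF K(1) l] emeasure_lborel_affine_image[OF L(1) m]
      by simp
  qed
  have SUP_nonempty: "emeasure lborel D = (SUP K\<in>{K. compact K \<and> K \<subseteq> D \<and> K \<noteq> {}}. emeasure lborel K)"
    if D: "D \<in> sets borel" "D \<noteq> {}" for D :: "real set"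
  proof -
    obtain d where d: "d \<in> D" using D by auto
    have "emeasure lborel D \<le> (SUP K\<in>{K. compact K \<and> K \<subseteq> D \<and> K \<noteq> {}}. emeasure lborel K)"
      unfolding emeasure_lborel_eq_SUP_compact[OF D(1)]
    proof (rule SUP_mono)
      fix K assume "K \<in> {K. compact K \<and> K \<subseteq> D}"
      then have K: "compact (insert d K)" "insert d K \<subseteq> D"
        using d by auto
      then have "emeasure lborel K \<le> emeasure lborel (insert d K)"
        by (intro emeasure_mono) (auto intro: borel_compact simp del: sets.insert_in_sets)
      then show "\<exists>M\<in>{K. compact K \<and> K \<subseteq> D \<and> K \<noteq> {}}. emeasure lborel K \<le> emeasure lborel M"
        using K by (intro bexI[of _ "insert d K"]) auto
    qed
    moreover have "(SUP K\<in>{K. compact K \<and> K \<subseteq> D \<and> K \<noteq> {}}. emeasure lborel K) \<le> emeasure lborel D"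
      using D by (intro SUP_least emeasure_mono) auto
    ultimately show ?thesis by (rule antisym)
  qed
  have ne: "CA \<noteq> {}" "CB \<noteq> {}"
  proof -
    obtain a b where "a \<in> A" "b \<in> B" using A B by auto
    then have "{a} \<in> CA" "{b} \<in> CB" by (auto simp: CA_def CB_def)
    then show "CA \<noteq> {}" "CB \<noteq> {}" by auto
  qed
  have "ennreal l * emeasure lborel A + ennreal m * emeasure lborel B
      = (SUP K\<in>CA. ennreal l * emeasure lborel K) + (SUP L\<in>CB. ennreal m * emeasure lborel L)"
    using SUP_nonempty[OF A] SUP_nonempty[OF B] unfolding CA_def CB_def
    by (simp add: SUP_mult_left_ennreal)
  also have "\<dots> = (SUP L\<in>CB. SUP K\<in>CA. ennreal l * emeasure lborel K + ennreal m * emeasure lborel L)"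
    by (simp add: ennreal_SUP_add_left[OF ne(1), symmetric] ennreal_SUP_add_right[OF ne(2)])
  also have "\<dots> \<le> emeasure lborel W"
    by (intro SUP_least cpt)
  finally show ?thesis .
qed

lemma ennreal_mult_divide_cancel:
  assumes "0 < p"
  shows "ennreal p * X / ennreal p = X" "ennreal p * (X / ennreal p) = X"
proof -
  have "X * ennreal p / ennreal p = X"
    using assms by (intro ennreal_mult_divide_eq) auto
  then show "ennreal p * X / ennreal p = X" by (simp only: mult.commute[of X])
  then show "ennreal p * (X / ennreal p) = X" by (simp only: ennreal_times_divide)
qed

text \<open>The layer-cake formula for \<open>u / p\<close>, whose levels \<open>\<theta>\<close> range over the unit interval.\<close>

lemma levels_integral_of_bounded:
  fixes u :: "'a \<Rightarrow> ennreal"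
  assumes M: "sigma_finite_measure M" and [measurable]: "u \<in> borel_measurable M"
    and p: "0 < p" and bound: "\<And>x. x \<in> space M \<Longrightarrow> u x \<le> ennreal p"
  shows "ennreal p * (\<integral>\<^sup>+\<theta>. indicator {0<..<1} \<theta> * emeasure M {x\<in>space M. ennreal (\<theta> * p) < u x} \<partial>lborel)
    = (\<integral>\<^sup>+x. u x \<partial>M)"
proof -
  interpret M: sigma_finite_measure M by fact
  interpret pair_sigma_finite lborel M
    by (intro pair_sigma_finite.intro sigma_finite_lborel M)
  have pt: "(\<integral>\<^sup>+\<theta>. indicator {0<..<1} \<theta> * indicator {\<theta>. ennreal (\<theta> * p) < u x} \<theta> \<partial>lborel)
      = u x / ennreal p" if x: "x \<in> space M" for x
  proof -
    obtain h where h: "u x = ennreal h" "0 \<le> h"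
      using bound[OF x] by (cases "u x") (auto simp: top_unique)
    have hp: "h \<le> p" using bound[OF x] h p by (simp add: ennreal_le_iff)
    have "(\<integral>\<^sup>+\<theta>. indicator {0<..<1} \<theta> * indicator {\<theta>. ennreal (\<theta> * p) < u x} \<theta> \<partial>lborel)
       = (\<integral>\<^sup>+\<theta>. indicator {0<..<h/p} \<theta> \<partial>(lborel::real measure))"
    proof (intro nn_integral_cong)
      fix \<theta> :: real
      have "\<theta> < 1" if "\<theta> * p < h"
        using that hp p mult_less_cancel_right_pos[of p \<theta> 1] by linarith
      then have "\<theta> \<in> {0<..<1} \<and> ennreal (\<theta> * p) < u x \<longleftrightarrow> \<theta> \<in> {0<..<h/p}"
        using h p hp by (auto simp: ennreal_less_iff field_simps intro: less_le_trans)
      then show "indicator {0<..<1} \<theta> * indicator {\<theta>. ennreal (\<theta> * p) < u x} \<theta>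
          = (indicator {0<..<h/p} \<theta> :: ennreal)"
        by (auto simp: indicator_def)
    qed
    also have "\<dots> = u x / ennreal p"
      using h p by (simp add: divide_ennreal)
    finally show ?thesis .
  qed
  have "(\<integral>\<^sup>+\<theta>. indicator {0<..<1} \<theta> * emeasure M {x\<in>space M. ennreal (\<theta> * p) < u x} \<partial>lborel)
     = (\<integral>\<^sup>+\<theta>. (\<integral>\<^sup>+x. indicator {0<..<1} \<theta> * indicator {\<theta>. ennreal (\<theta> * p) < u x} \<theta> \<partial>M) \<partial>lborel)"
    by (intro nn_integral_cong, subst nn_integral_cmult)
       (auto simp: indicator_def[abs_def] simp flip: nn_integral_indicator intro!: arg_cong2[where f = "(*)"] nn_integral_cong)
  also have "\<dots> = (\<integral>\<^sup>+x. (\<integral>\<^sup>+\<theta>. indicator {0<..<1} \<theta> * indicator {\<theta>. ennreal (\<theta> * p) < u x} \<theta> \<partial>lborel) \<partial>M)"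
    by (rule Fubini'[symmetric]) measurable
  also have "\<dots> = (\<integral>\<^sup>+x. u x / ennreal p \<partial>M)"
    by (intro nn_integral_cong pt)
  also have "\<dots> = (\<integral>\<^sup>+x. u x \<partial>M) / ennreal p"
    by (simp add: nn_integral_divide)
  finally show ?thesis
    using p by (simp add: ennreal_mult_divide_cancel)
qed

lemma levels_integral_le_integral:
  fixes u :: "'a \<Rightarrow> ennreal"
  assumes M: "sigma_finite_measure M" and [measurable]: "u \<in> borel_measurable M"
    and p: "0 < p"
  shows "ennreal p * (\<integral>\<^sup>+\<theta>. indicator {0<..<1} \<theta> * emeasure M {x\<in>space M. ennreal (\<theta> * p) \<le> u x} \<partial>lborel)
    \<le> (\<integral>\<^sup>+x. u x \<partial>M)"
proof -
  interpret M: sigma_finite_measure M by fact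
  interpret pair_sigma_finite lborel M
    by (intro pair_sigma_finite.intro sigma_finite_lborel M)
  have pt: "(\<integral>\<^sup>+\<theta>. indicator {0<..<1} \<theta> * indicator {\<theta>. ennreal (\<theta> * p) \<le> u x} \<theta> \<partial>lborel)
      \<le> u x / ennreal p" for x
  proof (cases "u x")
    case (real h)
    have "(\<integral>\<^sup>+\<theta>. indicator {0<..<1} \<theta> * indicator {\<theta>. ennreal (\<theta> * p) \<le> u x} \<theta> \<partial>lborel)
       \<le> (\<integral>\<^sup>+\<theta>. indicator {0..h/p} \<theta> \<partial>(lborel::real measure))"
    proof (intro nn_integral_mono)
      fix \<theta> :: real
      show "indicator {0<..<1} \<theta> * indicator {\<theta>. ennreal (\<theta> * p) \<le> u x} \<theta>
          \<le> (indicator {0..h/p} \<theta> :: ennreal)"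
        using real p by (auto simp: indicator_def ennreal_le_iff field_simps)
    qed
    also have "\<dots> = u x / ennreal p"
      using real p by (simp add: divide_ennreal)
    finally show ?thesis .
  next
    case top
    then show ?thesis using p by (simp add: ennreal_top_divide)
  qed
  have "(\<integral>\<^sup>+\<theta>. indicator {0<..<1} \<theta> * emeasure M {x\<in>space M. ennreal (\<theta> * p) \<le> u x} \<partial>lborel)
     = (\<integral>\<^sup>+\<theta>. (\<integral>\<^sup>+x. indicator {0<..<1} \<theta> * indicator {\<theta>. ennreal (\<theta> * p) \<le> u x} \<theta> \<partial>M) \<partial>lborel)"
    by (intro nn_integral_cong, subst nn_integral_cmult)
       (auto simp: indicator_def[abs_def] simp flip: nn_integral_indicator intro!: arg_cong2[where f = "(*)"] nn_integral_cong)
  also have "\<dots> = (\<integral>\<^sup>+x. (\<integral>\<^sup>+\<theta>. indicator {0<..<1} \<theta> * indicator {\<theta>. ennreal (\<theta> * p) \<le> u x} \<theta> \<partial>lborel) \<partial>M)"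
    by (rule Fubini'[symmetric]) measurable
  also have "\<dots> \<le> (\<integral>\<^sup>+x. u x / ennreal p \<partial>M)"
    by (intro nn_integral_mono pt)
  also have "\<dots> = (\<integral>\<^sup>+x. u x \<partial>M) / ennreal p"
    by (simp add: nn_integral_divide)
  finally have "ennreal p * (\<integral>\<^sup>+\<theta>. indicator {0<..<1} \<theta> * emeasure M {x\<in>space M. ennreal (\<theta> * p) \<le> u x} \<partial>lborel)
    \<le> ennreal p * ((\<integral>\<^sup>+x. u x \<partial>M) / ennreal p)"
    by (rule mult_left_mono) simp
  also have "\<dots> = (\<integral>\<^sup>+x. u x \<partial>M)"
    using p by (simp add: ennreal_mult_divide_cancel)
  finally show ?thesis .
qed

text \<open>After division by their suprema \<open>p\<close> and \<open>q\<close>, both functions have nonempty superlevel sets at exactly the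
same levels \<open>\<theta> < 1\<close>. The Brunn-Minkowski inequality for these sets, integrated over \<open>\<theta>\<close>, bounds
the integral of \<open>w\<close> from below by an arithmetic mean, and the weighted arithmetic-geometric mean
inequality turns this into the claim.

The inequality \<open>w (l x + m y) \<ge> u x powr l * v y powr m\<close> is expressed by lower bounds \<open>a < u x\<close> and
\<open>b < v y\<close> with real \<open>a\<close> and \<open>b\<close>. Powers of infinite values are thereby avoided, and hypothesis and
conclusion have the same form, which is what an induction over the dimension needs.\<close>

lemma prekopa_leindler_real_bounded:
  fixes u v w :: "real \<Rightarrow> ennreal"
  assumes [measurable]: "u \<in> borel_measurable borel" "v \<in> borel_measurable borel" "w \<in> borel_measurable borel"
    and lm: "0 < l" "0 < m" "l + m = 1"
    and H: "\<And>x y a b. 0 < a \<Longrightarrow> 0 < b \<Longrightarrow> ennreal a < u x \<Longrightarrow> ennreal b < v y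
              \<Longrightarrow> ennreal (a powr l * b powr m) \<le> w (l * x + m * y)"
    and k: "\<And>x. u x \<le> ennreal k" "\<And>x. v x \<le> ennreal k"
    and ab: "0 < a" "0 < b" "ennreal a < (\<integral>\<^sup>+x. u x \<partial>lborel)" "ennreal b < (\<integral>\<^sup>+x. v x \<partial>lborel)"
  shows "ennreal (a powr l * b powr m) \<le> (\<integral>\<^sup>+x. w x \<partial>lborel)"
proof -
  have sup: "\<exists>p>0. (\<forall>x. g x \<le> ennreal p) \<and> (\<forall>t<p. \<exists>x. ennreal t < g x)"
    if g: "\<And>x. g x \<le> ennreal k" "0 < (\<integral>\<^sup>+x. g x \<partial>lborel)" for g :: "real \<Rightarrow> ennreal"
  proof -
    have "(SUP x. g x) \<le> ennreal k" using g by (intro SUP_least)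
    then obtain p where p: "(SUP x. g x) = ennreal p" "0 \<le> p"
      by (cases "SUP x. g x") (auto simp: top_unique)
    have le: "g x \<le> ennreal p" for x
      unfolding p(1)[symmetric] by (rule SUP_upper) simp
    have "p \<noteq> 0"
    proof
      assume "p = 0"
      then have "g x = 0" for x using le[of x] by simp
      then show False using g(2) by simp
    qed
    moreover have "\<exists>x. ennreal t < g x" if "t < p" for t
    proof -
      have "ennreal t < (SUP x. g x)"
        using that p \<open>p \<noteq> 0\<close> by (simp add: ennreal_lessI)
      then show ?thesis by (simp add: less_SUP_iff)
    qed
    ultimately show ?thesis using p le by (intro exI[of _ p]) auto
  qed
  obtain p where p: "0 < p" "\<And>x. u x \<le> ennreal p" "\<And>t. t < p \<Longrightarrow> \<exists>x. ennreal t < u x"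
    using sup[of u] k ab by (metis le_less_trans zero_le)
  obtain q where q: "0 < q" "\<And>x. v x \<le> ennreal q" "\<And>t. t < q \<Longrightarrow> \<exists>x. ennreal t < v x"
    using sup[of v] k ab by (metis le_less_trans zero_le)
  define c where "c = p powr l * q powr m"
  have c: "0 < c" using p q by (simp add: c_def)
  define U where "U \<theta> = {x. ennreal (\<theta> * p) < u x}" for \<theta>
  define V where "V \<theta> = {x. ennreal (\<theta> * q) < v x}" for \<theta>
  define W where "W \<theta> = {x. ennreal (\<theta> * c) \<le> w x}" for \<theta>
  have bm: "ennreal l * emeasure lborel (U \<theta>) + ennreal m * emeasure lborel (V \<theta>) \<le> emeasure lborel (W \<theta>)"
    if th: "\<theta> \<in> {0<..<1}" for \<theta>
  proof (rule brunn_minkowski_real)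
    show "U \<theta> \<in> sets borel" "V \<theta> \<in> sets borel" "W \<theta> \<in> sets borel"
      unfolding U_def V_def W_def by measurable
    show "U \<theta> \<noteq> {}" "V \<theta> \<noteq> {}"
      using p(3)[of "\<theta> * p"] q(3)[of "\<theta> * q"] p(1) q(1) th by (auto simp: U_def V_def)
    fix x y assume "x \<in> U \<theta>" "y \<in> V \<theta>"
    then have "ennreal ((\<theta> * p) powr l * (\<theta> * q) powr m) \<le> w (l * x + m * y)"
      using th p q by (intro H) (auto simp: U_def V_def)
    moreover have "(\<theta> * p) powr l * (\<theta> * q) powr m = (\<theta> powr l * \<theta> powr m) * c"
      using th p q by (simp add: powr_mult c_def)
    moreover have "\<theta> powr l * \<theta> powr m = \<theta>"
      using th lm by (simp flip: powr_add)
    ultimately show "l * x + m * y \<in> W \<theta>" by (simp add: W_def)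
  qed (use lm in auto)
  let ?iU = "\<integral>\<^sup>+\<theta>. indicator {0<..<1} \<theta> * emeasure lborel (U \<theta>) \<partial>lborel"
  let ?iV = "\<integral>\<^sup>+\<theta>. indicator {0<..<1} \<theta> * emeasure lborel (V \<theta>) \<partial>lborel"
  let ?iW = "\<integral>\<^sup>+\<theta>. indicator {0<..<1} \<theta> * emeasure lborel (W \<theta>) \<partial>lborel"
  have eqU: "ennreal p * ?iU = (\<integral>\<^sup>+x. u x \<partial>lborel)"
    using levels_integral_of_bounded[OF sigma_finite_lborel, of u p] p by (simp add: U_def)
  have eqV: "ennreal q * ?iV = (\<integral>\<^sup>+x. v x \<partial>lborel)"
    using levels_integral_of_bounded[OF sigma_finite_lborel, of v q] q by (simp add: V_def)
  have leW: "ennreal c * ?iW \<le> (\<integral>\<^sup>+x. w x \<partial>lborel)"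
    using levels_integral_le_integral[OF sigma_finite_lborel, of w c] c by (simp add: W_def)
  have levels_measurable: "(\<lambda>\<theta>. emeasure lborel {x. ennreal (\<theta> * t) < g x}) \<in> borel_measurable borel"
    if [measurable]: "g \<in> borel_measurable borel" for g :: "real \<Rightarrow> ennreal" and t
  proof -
    have "(\<lambda>\<theta>. \<integral>\<^sup>+x. indicator {\<theta>. ennreal (\<theta> * t) < g x} \<theta> \<partial>lborel) \<in> borel_measurable borel"
      by measurable
    moreover have "(\<integral>\<^sup>+x. indicator {\<theta>. ennreal (\<theta> * t) < g x} \<theta> \<partial>lborel)
        = emeasure lborel {x. ennreal (\<theta> * t) < g x}" for \<theta>
    proof -
      have "(\<integral>\<^sup>+x. indicator {\<theta>. ennreal (\<theta> * t) < g x} \<theta> \<partial>lborel)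
          = (\<integral>\<^sup>+x. indicator {x. ennreal (\<theta> * t) < g x} x \<partial>lborel)"
        by (intro nn_integral_cong) (simp add: indicator_def)
      also have "\<dots> = emeasure lborel {x. ennreal (\<theta> * t) < g x}"
        by (rule nn_integral_indicator) measurable
      finally show ?thesis .
    qed
    ultimately show ?thesis by simp
  qed
  have [measurable]: "(\<lambda>\<theta>. emeasure lborel (U \<theta>)) \<in> borel_measurable borel"
    "(\<lambda>\<theta>. emeasure lborel (V \<theta>)) \<in> borel_measurable borel"
    unfolding U_def V_def by (intro levels_measurable; measurable)+
  have "ennreal l * ?iU + ennreal m * ?iV
      = (\<integral>\<^sup>+\<theta>. indicator {0<..<1} \<theta> * (ennreal l * emeasure lborel (U \<theta>) + ennreal m * emeasure lborel (V \<theta>)) \<partial>lborel)"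
    by (simp add: distrib_left mult.left_commute[of "indicator _ _"] nn_integral_add nn_integral_cmult)
  also have "\<dots> \<le> ?iW"
    using bm by (intro nn_integral_mono) (auto simp: indicator_def)
  finally have sum_le: "ennreal l * ?iU + ennreal m * ?iV \<le> ?iW" .
  have iU: "ennreal (a / p) \<le> ?iU"
  proof -
    have "ennreal (a / p) = ennreal a / ennreal p"
      using ab p by (simp add: divide_ennreal)
    also have "\<dots> \<le> (ennreal p * ?iU) / ennreal p"
      using ab(3) eqU by (intro divide_right_mono_ennreal) simp
    finally show ?thesis using p by (simp add: ennreal_mult_divide_cancel)
  qed
  have iV: "ennreal (b / q) \<le> ?iV"
  proof -
    have "ennreal (b / q) = ennreal b / ennreal q"
      using ab q by (simp add: divide_ennreal)
    also have "\<dots> \<le> (ennreal q * ?iV) / ennreal q"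
      using ab(4) eqV by (intro divide_right_mono_ennreal) simp
    finally show ?thesis using q by (simp add: ennreal_mult_divide_cancel)
  qed
  have "a powr l * b powr m = c * ((a / p) powr l * (b / q) powr m)"
    using ab p q by (simp add: c_def powr_divide)
  also have "\<dots> \<le> c * (l * (a / p) + m * (b / q))"
    using Youngs_inequality_0[of l m "a / p" "b / q"] lm ab p q c by (intro mult_left_mono) auto
  finally have "ennreal (a powr l * b powr m) \<le> ennreal (c * (l * (a / p) + m * (b / q)))"
    by (rule ennreal_leI)
  also have "\<dots> = ennreal c * (ennreal l * ennreal (a / p) + ennreal m * ennreal (b / q))"
    using c lm ab p q by (simp add: ennreal_mult' del: times_divide_eq_right)
  also have "\<dots> \<le> ennreal c * (ennreal l * ?iU + ennreal m * ?iV)"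
    by (intro mult_left_mono add_mono iU iV) auto
  also have "\<dots> \<le> ennreal c * ?iW"
    by (intro mult_left_mono sum_le) auto
  also note leW
  finally show ?thesis .
qed

lemma prekopa_leindler_real:
  fixes u v w :: "real \<Rightarrow> ennreal"
  assumes [measurable]: "u \<in> borel_measurable borel" "v \<in> borel_measurable borel" "w \<in> borel_measurable borel"
    and lm: "0 < l" "0 < m" "l + m = 1"
    and H: "\<And>x y a b. 0 < a \<Longrightarrow> 0 < b \<Longrightarrow> ennreal a < u x \<Longrightarrow> ennreal b < v y
              \<Longrightarrow> ennreal (a powr l * b powr m) \<le> w (l * x + m * y)"
    and ab: "0 < a" "0 < b" "ennreal a < (\<integral>\<^sup>+x. u x \<partial>lborel)" "ennreal b < (\<integral>\<^sup>+x. v x \<partial>lborel)"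
  shows "ennreal (a powr l * b powr m) \<le> (\<integral>\<^sup>+x. w x \<partial>lborel)"
proof -
  have trunc: "\<exists>k0. \<forall>k\<ge>k0. ennreal t < (\<integral>\<^sup>+x. min (g x) (ennreal (real k)) \<partial>lborel)"
    if [measurable]: "g \<in> borel_measurable borel" and t: "ennreal t < (\<integral>\<^sup>+x. g x \<partial>lborel)"
    for g :: "real \<Rightarrow> ennreal" and t
  proof -
    have sup: "(SUP k. min h (ennreal (real k))) = h" for h :: ennreal
    proof (rule antisym)
      show "(SUP k. min h (ennreal (real k))) \<le> h" by (intro SUP_least) auto
      show "h \<le> (SUP k. min h (ennreal (real k)))"
      proof (cases h)
        case (real r)
        obtain k where "r \<le> real k" using real_arch_simple by blast
        then have "h \<le> min h (ennreal (real k))" using real by (auto simp: ennreal_leI)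
        then show ?thesis by (meson SUP_upper2 UNIV_I)
      next
        case top
        then show ?thesis
          by (simp add: ennreal_of_nat_eq_real_of_nat[symmetric] ennreal_SUP_of_nat_eq_top)
      qed
    qed
    have inc: "incseq (\<lambda>k x. min (g x) (ennreal (real k)))"
      unfolding incseq_def le_fun_def by (intro allI impI min.mono order_refl ennreal_leI) simp
    have "(\<integral>\<^sup>+x. g x \<partial>lborel) = (\<integral>\<^sup>+x. (SUP k. min (g x) (ennreal (real k))) \<partial>lborel)"
      by (simp add: sup)
    also have "\<dots> = (SUP k. \<integral>\<^sup>+x. min (g x) (ennreal (real k)) \<partial>lborel)"
      by (rule nn_integral_monotone_convergence_SUP[OF inc]) measurable
    finally obtain k0 where k0: "ennreal t < (\<integral>\<^sup>+x. min (g x) (ennreal (real k0)) \<partial>lborel)"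
      using t by (auto simp: less_SUP_iff)
    show ?thesis
    proof (intro exI allI impI)
      fix k assume "k0 \<le> k"
      then have "(\<integral>\<^sup>+x. min (g x) (ennreal (real k0)) \<partial>lborel) \<le> (\<integral>\<^sup>+x. min (g x) (ennreal (real k)) \<partial>lborel)"
        by (intro nn_integral_mono min.mono ennreal_leI) auto
      with k0 show "ennreal t < (\<integral>\<^sup>+x. min (g x) (ennreal (real k)) \<partial>lborel)" by (rule less_le_trans)
    qed
  qed
  obtain k1 where k1: "\<And>k. k \<ge> k1 \<Longrightarrow> ennreal a < (\<integral>\<^sup>+x. min (u x) (ennreal (real k)) \<partial>lborel)"
    using trunc[of u a] ab by auto
  obtain k2 where k2: "\<And>k. k \<ge> k2 \<Longrightarrow> ennreal b < (\<integral>\<^sup>+x. min (v x) (ennreal (real k)) \<partial>lborel)"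
    using trunc[of v b] ab by auto
  let ?k = "max k1 k2"
  show ?thesis
    by (rule prekopa_leindler_real_bounded[of "\<lambda>x. min (u x) (ennreal (real ?k))" "\<lambda>x. min (v x) (ennreal (real ?k))"
          w l m "real ?k"])
       (use lm H ab k1[of ?k] k2[of ?k] in auto)
qed

lemma product_sigma_finite_lborel: "product_sigma_finite (\<lambda>_. lborel)"
  by (intro product_sigma_finite.intro sigma_finite_lborel)

text \<open>Induction over the coordinates: for fixed values of the other coordinates the one-dimensional
inequality says that the partial integrals again satisfy the hypothesis.\<close>

lemma prekopa_leindler_PiM:
  fixes u v w :: "('i \<Rightarrow> real) \<Rightarrow> ennreal"
  assumes "finite I"
    and "u \<in> borel_measurable (PiM I (\<lambda>_. lborel))" "v \<in> borel_measurable (PiM I (\<lambda>_. lborel))"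
      "w \<in> borel_measurable (PiM I (\<lambda>_. lborel))"
    and lm: "0 < l" "0 < m" "l + m = 1"
    and "\<And>x y a b. x \<in> PiE I (\<lambda>_. UNIV) \<Longrightarrow> y \<in> PiE I (\<lambda>_. UNIV) \<Longrightarrow> 0 < a \<Longrightarrow> 0 < b
              \<Longrightarrow> ennreal a < u x \<Longrightarrow> ennreal b < v y
              \<Longrightarrow> ennreal (a powr l * b powr m) \<le> w (\<lambda>i\<in>I. l * x i + m * y i)"
    and "0 < a" "0 < b" "ennreal a < (\<integral>\<^sup>+x. u x \<partial>PiM I (\<lambda>_. lborel))"
      "ennreal b < (\<integral>\<^sup>+x. v x \<partial>PiM I (\<lambda>_. lborel))"
  shows "ennreal (a powr l * b powr m) \<le> (\<integral>\<^sup>+x. w x \<partial>PiM I (\<lambda>_. lborel))"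
  using assms(1,2,3,4,8-)
proof (induction I arbitrary: u v w a b rule: finite_induct)
  case empty
  interpret product_sigma_finite "\<lambda>_. lborel" by (rule product_sigma_finite_lborel)
  show ?case
    using empty.prems(4)[of "\<lambda>_. undefined" "\<lambda>_. undefined" a b] empty.prems(5-)
    by (simp add: nn_integral_empty restrict_def)
next
  case (insert i I)
  interpret product_sigma_finite "\<lambda>_. lborel" by (rule product_sigma_finite_lborel)
  note [measurable] = insert.prems(1-3)
  have upd [measurable]: "(\<lambda>y. x(i := y)) \<in> borel \<rightarrow>\<^sub>M PiM (insert i I) (\<lambda>_. lborel)"
    if "x \<in> space (PiM I (\<lambda>_. lborel))" for x :: "'i \<Rightarrow> real"
    using measurable_compose[OF measurable_Pair1'[OF that] measurable_add_dim[of i I]] by simp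
  show ?case
    unfolding product_nn_integral_insert[OF insert.hyps insert.prems(3)]
  proof (rule insert.IH)
    show "(\<lambda>x. \<integral>\<^sup>+ y. u (x(i := y)) \<partial>lborel) \<in> borel_measurable (PiM I (\<lambda>_. lborel))"
      "(\<lambda>x. \<integral>\<^sup>+ y. v (x(i := y)) \<partial>lborel) \<in> borel_measurable (PiM I (\<lambda>_. lborel))"
      "(\<lambda>x. \<integral>\<^sup>+ y. w (x(i := y)) \<partial>lborel) \<in> borel_measurable (PiM I (\<lambda>_. lborel))"
      by measurable
    show "0 < a" "0 < b" by fact+
    show "ennreal a < (\<integral>\<^sup>+ x. \<integral>\<^sup>+ y. u (x(i := y)) \<partial>lborel \<partial>PiM I (\<lambda>_. lborel))"
      "ennreal b < (\<integral>\<^sup>+ x. \<integral>\<^sup>+ y. v (x(i := y)) \<partial>lborel \<partial>PiM I (\<lambda>_. lborel))"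
      using insert.prems(7,8)
      unfolding product_nn_integral_insert[OF insert.hyps insert.prems(1)]
        product_nn_integral_insert[OF insert.hyps insert.prems(2)] .
    fix x y :: "'i \<Rightarrow> real" and a' b' :: real
    assume x: "x \<in> PiE I (\<lambda>_. UNIV)" and y: "y \<in> PiE I (\<lambda>_. UNIV)" and ab': "0 < a'" "0 < b'"
      and au: "ennreal a' < (\<integral>\<^sup>+ z. u (x(i := z)) \<partial>lborel)" and bv: "ennreal b' < (\<integral>\<^sup>+ z. v (y(i := z)) \<partial>lborel)"
    have sp: "x \<in> space (PiM I (\<lambda>_. lborel))" "y \<in> space (PiM I (\<lambda>_. lborel))"
      "(\<lambda>j\<in>I. l * x j + m * y j) \<in> space (PiM I (\<lambda>_. lborel))"
      using x y by (auto simp: space_PiM)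
    note [measurable] = upd[OF sp(1)] upd[OF sp(2)] upd[OF sp(3)]
    show "ennreal (a' powr l * b' powr m) \<le> (\<integral>\<^sup>+ z. w ((\<lambda>j\<in>I. l * x j + m * y j)(i := z)) \<partial>lborel)"
    proof (rule prekopa_leindler_real[OF _ _ _ lm _ ab' au bv])
      fix s t c d :: real
      assume cd: "0 < c" "0 < d" "ennreal c < u (x(i := s))" "ennreal d < v (y(i := t))"
      have "ennreal (c powr l * d powr m) \<le> w (\<lambda>j\<in>insert i I. l * (x(i := s)) j + m * (y(i := t)) j)"
      proof (rule insert.prems(4)[OF _ _ cd])
        show "x(i := s) \<in> PiE (insert i I) (\<lambda>_. UNIV)" "y(i := t) \<in> PiE (insert i I) (\<lambda>_. UNIV)"
          using x y by (auto simp: PiE_def extensional_def)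
      qed
      also have "(\<lambda>j\<in>insert i I. l * (x(i := s)) j + m * (y(i := t)) j) = (\<lambda>j\<in>I. l * x j + m * y j)(i := l * s + m * t)"
        using insert.hyps by (auto simp: fun_eq_iff restrict_def)
      finally show "ennreal (c powr l * d powr m) \<le> w ((\<lambda>j\<in>I. l * x j + m * y j)(i := l * s + m * t))" .
    qed measurable
  qed
qed

section \<open>Affine maps and integration along parallel lines\<close>

lemma nn_integral_lborel_affine:
  fixes d :: "'a::euclidean_space"
  assumes c: "c \<noteq> 0" and [measurable]: "f \<in> borel_measurable borel"
  shows "(\<integral>\<^sup>+x. f x \<partial>lborel) = ennreal (\<bar>c\<bar> ^ DIM('a)) * (\<integral>\<^sup>+x. f (d + c *\<^sub>R x) \<partial>lborel)"
  by (subst lborel_affine[OF c, of d]) (simp add: nn_integral_density nn_integral_distr nn_integral_cmult)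

text \<open>Both measures agree on boxes, coordinate by coordinate.\<close>

lemma nn_integral_PiM_affine:
  fixes d :: "'i \<Rightarrow> 'a::euclidean_space"
  assumes I: "finite I" and c: "c \<noteq> 0"
    and f [measurable]: "f \<in> borel_measurable (PiM I (\<lambda>_. lborel))"
  shows "(\<integral>\<^sup>+x. f x \<partial>PiM I (\<lambda>_. lborel))
    = ennreal (\<bar>c\<bar> ^ DIM('a)) ^ card I * (\<integral>\<^sup>+x. f (\<lambda>i\<in>I. d i + c *\<^sub>R x i) \<partial>PiM I (\<lambda>_. lborel))"
proof -
  interpret product_sigma_finite "\<lambda>_. lborel" by (rule product_sigma_finite_lborel)
  let ?P = "PiM I (\<lambda>_. lborel :: 'a measure)"
  let ?T = "\<lambda>x. \<lambda>i\<in>I. d i + c *\<^sub>R x i"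
  let ?k = "ennreal (\<bar>c\<bar> ^ DIM('a)) ^ card I"
  have T [measurable]: "?T \<in> ?P \<rightarrow>\<^sub>M ?P"
    by measurable
  have "density (distr ?P ?P ?T) (\<lambda>_. ?k) = ?P"
  proof (rule PiM_eqI[OF I])
    show "sets (density (distr ?P ?P ?T) (\<lambda>_. ?k)) = sets ?P" by simp
    fix A :: "'i \<Rightarrow> 'a set" assume A: "\<And>i. i \<in> I \<Longrightarrow> A i \<in> sets lborel"
    have PA: "PiE I A \<in> sets ?P"
      using A I by (intro sets_PiM_I_finite) auto
    have pre: "?T -` PiE I A \<inter> space ?P = PiE I (\<lambda>i. (\<lambda>x. d i + c *\<^sub>R x) -` A i)"
      by (auto simp: space_PiM PiE_def Pi_def extensional_def)
    have m: "(\<lambda>x. d i + c *\<^sub>R x) -` A i \<in> sets lborel" if "i \<in> I" for i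
    proof -
      have "(\<lambda>x. d i + c *\<^sub>R x) \<in> borel \<rightarrow>\<^sub>M borel" by measurable
      from measurable_sets[OF this, of "A i"] A[OF that] show ?thesis by simp
    qed
    have one: "emeasure lborel (A i) = ennreal (\<bar>c\<bar> ^ DIM('a)) * emeasure lborel ((\<lambda>x. d i + c *\<^sub>R x) -` A i)"
      if "i \<in> I" for i
    proof -
      have "emeasure lborel (A i) = (\<integral>\<^sup>+x. indicator (A i) x \<partial>lborel)"
        using A[OF that] by simp
      also have "\<dots> = ennreal (\<bar>c\<bar> ^ DIM('a)) * (\<integral>\<^sup>+x. indicator (A i) (d i + c *\<^sub>R x) \<partial>lborel)"
        using A[OF that] by (intro nn_integral_lborel_affine c) simp
      also have "(\<integral>\<^sup>+x. indicator (A i) (d i + c *\<^sub>R x) \<partial>lborel)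
          = (\<integral>\<^sup>+x. indicator ((\<lambda>x. d i + c *\<^sub>R x) -` A i) x \<partial>lborel)"
        by (intro nn_integral_cong) (auto simp: indicator_def)
      finally show ?thesis using m[OF that] by simp
    qed
    have "emeasure (density (distr ?P ?P ?T) (\<lambda>_. ?k)) (PiE I A) = ?k * emeasure ?P (?T -` PiE I A \<inter> space ?P)"
      using PA by (simp add: emeasure_density nn_integral_cmult_indicator emeasure_distr)
    also have "\<dots> = (\<Prod>i\<in>I. emeasure lborel (A i))"
      unfolding pre using one m I by (simp add: emeasure_PiM prod.distrib)
    finally show "emeasure (density (distr ?P ?P ?T) (\<lambda>_. ?k)) (PiE I A) = (\<Prod>i\<in>I. emeasure lborel (A i))" .
  qed
  then have "(\<integral>\<^sup>+x. f x \<partial>?P) = (\<integral>\<^sup>+x. f x \<partial>density (distr ?P ?P ?T) (\<lambda>_. ?k))"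
    by simp
  also have "\<dots> = ?k * (\<integral>\<^sup>+x. f (?T x) \<partial>?P)"
    by (simp add: nn_integral_density nn_integral_distr nn_integral_cmult)
  finally show ?thesis .
qed

lemma nn_integral_PiM_translate:
  fixes d :: "'i \<Rightarrow> 'a::euclidean_space"
  assumes "finite I" and "f \<in> borel_measurable (PiM I (\<lambda>_. lborel))"
  shows "(\<integral>\<^sup>+x. f (\<lambda>i\<in>I. d i + x i) \<partial>PiM I (\<lambda>_. lborel)) = (\<integral>\<^sup>+x. f x \<partial>PiM I (\<lambda>_. lborel))"
  using nn_integral_PiM_affine[OF assms(1) _ assms(2), of 1 d] by simp

text \<open>The slab serves as a weight: every line parallel to the unit vector \<open>e\<close> meets it in a segment of
length one.\<close>

definition slab :: "'a::euclidean_space \<Rightarrow> 'a set" where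
  "slab e = {y. 0 \<le> y \<bullet> e \<and> y \<bullet> e \<le> 1}"

lemma slab_measurable [measurable]: "slab e \<in> sets borel"
  unfolding slab_def by measurable

lemma slab_line_integral:
  assumes "norm e = 1"
  shows "(\<integral>\<^sup>+t. indicator (slab e) (y - t *\<^sub>R e) \<partial>lborel) = 1"
proof -
  have "e \<bullet> e = 1" using assms by (simp add: norm_eq_1)
  then have "(\<integral>\<^sup>+t. indicator (slab e) (y - t *\<^sub>R e) \<partial>lborel) = (\<integral>\<^sup>+t. indicator {y \<bullet> e - 1 .. y \<bullet> e} t \<partial>lborel)"
    by (intro nn_integral_cong) (auto simp: indicator_def slab_def inner_diff_left)
  then show ?thesis by simp
qed

text \<open>Integration over the whole space as integration over lines parallel to \<open>e\<close>. A parametrization of the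
set of lines is avoided: each line is represented by all of its points inside the slab, and these have
total weight one. The proof is Tonelli's theorem and translation invariance.\<close>

lemma nn_integral_lines:
  fixes e :: "'a::euclidean_space"
  assumes e: "norm e = 1" and [measurable]: "f \<in> borel_measurable borel"
  shows "(\<integral>\<^sup>+x. f x \<partial>lborel) = (\<integral>\<^sup>+y. indicator (slab e) y * (\<integral>\<^sup>+t. f (y + t *\<^sub>R e) \<partial>lborel) \<partial>lborel)"
proof -
  have "(\<integral>\<^sup>+y. indicator (slab e) y * (\<integral>\<^sup>+t. f (y + t *\<^sub>R e) \<partial>lborel) \<partial>lborel)
      = (\<integral>\<^sup>+y. \<integral>\<^sup>+t. indicator (slab e) y * f (y + t *\<^sub>R e) \<partial>lborel \<partial>lborel)"
    by (simp add: nn_integral_cmult)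
  also have "\<dots> = (\<integral>\<^sup>+t. \<integral>\<^sup>+y. indicator (slab e) y * f (y + t *\<^sub>R e) \<partial>lborel \<partial>lborel)"
    by (rule lborel_pair.Fubini'[symmetric]) measurable
  also have "\<dots> = (\<integral>\<^sup>+t. \<integral>\<^sup>+y. indicator (slab e) (y - t *\<^sub>R e) * f y \<partial>lborel \<partial>lborel)"
    using nn_integral_lborel_affine[of 1 "\<lambda>y. indicator (slab e) y * f (y + t *\<^sub>R e)" "- t *\<^sub>R e" for t]
    by simp
  also have "\<dots> = (\<integral>\<^sup>+y. \<integral>\<^sup>+t. indicator (slab e) (y - t *\<^sub>R e) * f y \<partial>lborel \<partial>lborel)"
    by (rule lborel_pair.Fubini') measurable
  also have "\<dots> = (\<integral>\<^sup>+y. f y \<partial>lborel)"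
    by (simp add: nn_integral_multc slab_line_integral[OF e])
  finally show ?thesis by simp
qed

text \<open>The same with one line for each factor of the product, all parallel to the same vector \<open>e\<close>.\<close>

lemma nn_integral_PiM_lines:
  fixes e :: "'a::euclidean_space"
  assumes I: "finite I" and e: "norm e = 1"
    and f [measurable]: "f \<in> borel_measurable (PiM I (\<lambda>_. lborel :: 'a measure))"
  shows "(\<integral>\<^sup>+x. f x \<partial>PiM I (\<lambda>_. lborel))
    = (\<integral>\<^sup>+Y. (\<Prod>i\<in>I. indicator (slab e) (Y i)) *
        (\<integral>\<^sup>+T. f (\<lambda>i\<in>I. Y i + T i *\<^sub>R e) \<partial>PiM I (\<lambda>_. lborel)) \<partial>PiM I (\<lambda>_. lborel))"
proof -
  let ?P = "PiM I (\<lambda>_. lborel :: 'a measure)" and ?R = "PiM I (\<lambda>_. lborel :: real measure)"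
  interpret R: product_sigma_finite "\<lambda>_. lborel :: real measure" by (rule product_sigma_finite_lborel)
  interpret P: product_sigma_finite "\<lambda>_. lborel :: 'a measure" by (rule product_sigma_finite_lborel)
  interpret pair_sigma_finite ?P ?R
    by (intro pair_sigma_finite.intro R.sigma_finite P.sigma_finite I)
  define s :: "('b \<Rightarrow> 'a) \<Rightarrow> ennreal" where "s Y = (\<Prod>i\<in>I. indicator (slab e) (Y i))" for Y
  have [measurable]: "s \<in> borel_measurable ?P"
    unfolding s_def by measurable
  have mf [measurable]: "(\<lambda>(Y, T). f (\<lambda>i\<in>I. Y i + T i *\<^sub>R e)) \<in> borel_measurable (?P \<Otimes>\<^sub>M ?R)"
  proof -
    have "(\<lambda>(Y, T). \<lambda>i\<in>I. Y i + T i *\<^sub>R e) \<in> ?P \<Otimes>\<^sub>M ?R \<rightarrow>\<^sub>M ?P"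
      unfolding case_prod_beta by measurable
    from measurable_compose[OF this f] show ?thesis by (simp add: case_prod_beta)
  qed
  have mf' [measurable]: "(\<lambda>T. f (\<lambda>i\<in>I. Y i + T i *\<^sub>R e)) \<in> borel_measurable ?R" for Y
  proof -
    have "(\<lambda>T. \<lambda>i\<in>I. Y i + T i *\<^sub>R e) \<in> ?R \<rightarrow>\<^sub>M ?P" by measurable
    from measurable_compose[OF this f] show ?thesis .
  qed
  have mf'' [measurable]: "(\<lambda>Y. f (\<lambda>i\<in>I. Y i + T i *\<^sub>R e)) \<in> borel_measurable ?P" for T
  proof -
    have "(\<lambda>Y. \<lambda>i\<in>I. Y i + T i *\<^sub>R e) \<in> ?P \<rightarrow>\<^sub>M ?P" by measurable
    from measurable_compose[OF this f] show ?thesis .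
  qed
  have ms [measurable]: "(\<lambda>(Y, T). s (\<lambda>i\<in>I. Y i - T i *\<^sub>R e)) \<in> borel_measurable (?P \<Otimes>\<^sub>M ?R)"
  proof -
    have "(\<lambda>(Y, T). s (\<lambda>i\<in>I. Y i - T i *\<^sub>R e)) = (\<lambda>(Y, T). \<Prod>i\<in>I. indicator (slab e) (Y i - T i *\<^sub>R e))"
      unfolding s_def by (auto simp: fun_eq_iff intro!: prod.cong)
    then show ?thesis unfolding case_prod_beta by simp
  qed
  have shift: "(\<integral>\<^sup>+Y. s Y * f (\<lambda>i\<in>I. Y i + T i *\<^sub>R e) \<partial>?P) = (\<integral>\<^sup>+Y. s (\<lambda>i\<in>I. Y i - T i *\<^sub>R e) * f Y \<partial>?P)" for T
  proof -
    have "(\<integral>\<^sup>+Y. s Y * f (\<lambda>i\<in>I. Y i + T i *\<^sub>R e) \<partial>?P)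
       = (\<integral>\<^sup>+Y. s (\<lambda>i\<in>I. - T i *\<^sub>R e + Y i) * f (\<lambda>i\<in>I. (\<lambda>i\<in>I. - T i *\<^sub>R e + Y i) i + T i *\<^sub>R e) \<partial>?P)"
      by (rule nn_integral_PiM_translate[OF I, symmetric]) measurable
    also have "\<dots> = (\<integral>\<^sup>+Y. s (\<lambda>i\<in>I. Y i - T i *\<^sub>R e) * f Y \<partial>?P)"
    proof (rule nn_integral_cong)
      fix Y assume "Y \<in> space ?P"
      then have "(\<lambda>i\<in>I. (\<lambda>i\<in>I. - T i *\<^sub>R e + Y i) i + T i *\<^sub>R e) = Y"
        by (auto simp: fun_eq_iff restrict_def space_PiM PiE_def extensional_def)
      then show "s (\<lambda>i\<in>I. - T i *\<^sub>R e + Y i) * f (\<lambda>i\<in>I. (\<lambda>i\<in>I. - T i *\<^sub>R e + Y i) i + T i *\<^sub>R e)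
          = s (\<lambda>i\<in>I. Y i - T i *\<^sub>R e) * f Y"
        by (simp only: uminus_add_conv_diff scaleR_minus_left)
    qed
    finally show ?thesis .
  qed
  have one: "(\<integral>\<^sup>+T. s (\<lambda>i\<in>I. Y i - T i *\<^sub>R e) \<partial>?R) = 1" for Y
  proof -
    have "(\<integral>\<^sup>+T. s (\<lambda>i\<in>I. Y i - T i *\<^sub>R e) \<partial>?R)
        = (\<integral>\<^sup>+T. (\<Prod>i\<in>I. indicator (slab e) (Y i - T i *\<^sub>R e)) \<partial>?R)"
      unfolding s_def by (intro nn_integral_cong prod.cong) auto
    also have "\<dots> = 1"
      by (subst R.product_nn_integral_prod[OF I]) (simp_all add: slab_line_integral[OF e])
    finally show ?thesis .
  qed
  have "(\<integral>\<^sup>+Y. s Y * (\<integral>\<^sup>+T. f (\<lambda>i\<in>I. Y i + T i *\<^sub>R e) \<partial>?R) \<partial>?P)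
      = (\<integral>\<^sup>+Y. \<integral>\<^sup>+T. s Y * f (\<lambda>i\<in>I. Y i + T i *\<^sub>R e) \<partial>?R \<partial>?P)"
    by (simp add: nn_integral_cmult)
  also have "\<dots> = (\<integral>\<^sup>+T. \<integral>\<^sup>+Y. s Y * f (\<lambda>i\<in>I. Y i + T i *\<^sub>R e) \<partial>?P \<partial>?R)"
    by (rule Fubini'[symmetric]) measurable
  also have "\<dots> = (\<integral>\<^sup>+T. \<integral>\<^sup>+Y. s (\<lambda>i\<in>I. Y i - T i *\<^sub>R e) * f Y \<partial>?P \<partial>?R)"
    by (simp only: shift)
  also have "\<dots> = (\<integral>\<^sup>+Y. \<integral>\<^sup>+T. s (\<lambda>i\<in>I. Y i - T i *\<^sub>R e) * f Y \<partial>?R \<partial>?P)"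
    by (rule Fubini') measurable
  also have "\<dots> = (\<integral>\<^sup>+Y. (\<integral>\<^sup>+T. s (\<lambda>i\<in>I. Y i - T i *\<^sub>R e) \<partial>?R) * f Y \<partial>?P)"
    by (intro nn_integral_cong nn_integral_multc) (auto simp: s_def)
  also have "\<dots> = (\<integral>\<^sup>+Y. f Y \<partial>?P)"
    by (simp add: one)
  finally show ?thesis by (simp add: s_def)
qed

section \<open>Symmetric convex sets and boxes of intervals\<close>

lemma ennreal_le_of_scaled_epsilon:
  fixes X Y K :: ennreal
  assumes K: "K < \<top>" and le: "\<And>\<epsilon>. 0 < \<epsilon> \<Longrightarrow> \<epsilon> \<le> 1 \<Longrightarrow> X \<le> Y + ennreal \<epsilon> * K"
  shows "X \<le> Y"
proof (rule ennreal_le_epsilon)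
  fix e :: real assume e: "0 < e"
  obtain k where k: "K = ennreal k" "0 \<le> k" using K by (cases K) auto
  define \<epsilon> where "\<epsilon> = min 1 (e / (k + 1))"
  have eps: "0 < \<epsilon>" "\<epsilon> \<le> 1" using e k by (auto simp: \<epsilon>_def)
  have "\<epsilon> * k \<le> e / (k + 1) * (k + 1)"
    using k eps by (intro mult_mono) (auto simp: \<epsilon>_def)
  also have "\<dots> = e" using k by simp
  finally have "ennreal \<epsilon> * K \<le> ennreal e"
    using k eps by (simp flip: ennreal_mult add: ennreal_leI)
  then have "Y + ennreal \<epsilon> * K \<le> Y + ennreal e" by (rule add_left_mono)
  with le[OF eps] show "X \<le> Y + ennreal e" by (rule order_trans)
qed

lemma emeasure_PiM_lborel:
  assumes "finite I" and "\<And>i. i \<in> I \<Longrightarrow> A i \<in> sets borel"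
  shows "emeasure (PiM I (\<lambda>_. lborel)) (PiE I A) = (\<Prod>i\<in>I. emeasure lborel (A i))"
  using product_sigma_finite.emeasure_PiM[OF product_sigma_finite_lborel assms(1), of A] assms(2) by simp

text \<open>A point of the first box outside the second has some coordinate \<open>x i\<close> in \<open>A i - B i\<close>.\<close>

lemma emeasure_PiE_le_of_diff:
  fixes A B :: "'i \<Rightarrow> 'a::euclidean_space set"
  assumes I: "finite I" and E: "E \<in> sets (PiM I (\<lambda>_. lborel))"
    and A: "\<And>i. i \<in> I \<Longrightarrow> A i \<in> sets borel" and B: "\<And>i. i \<in> I \<Longrightarrow> B i \<in> sets borel"
  shows "emeasure (PiM I (\<lambda>_. lborel)) (E \<inter> PiE I A)
    \<le> emeasure (PiM I (\<lambda>_. lborel)) (E \<inter> PiE I B)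
      + (\<Sum>i\<in>I. emeasure lborel (A i - B i) * (\<Prod>j\<in>I - {i}. emeasure lborel (A j)))"
proof -
  let ?P = "PiM I (\<lambda>_. lborel :: 'a measure)"
  define D where "D i = PiE I (A(i := A i - B i))" for i
  have D: "D i \<in> sets ?P" if "i \<in> I" for i
    unfolding D_def using A B I that by (intro sets_PiM_I_finite) auto
  have PB: "E \<inter> PiE I B \<in> sets ?P"
    using E B I by (intro sets.Int sets_PiM_I_finite) auto
  have "E \<inter> PiE I A \<subseteq> (E \<inter> PiE I B) \<union> (\<Union>i\<in>I. D i)"
  proof
    fix x assume x: "x \<in> E \<inter> PiE I A"
    show "x \<in> (E \<inter> PiE I B) \<union> (\<Union>i\<in>I. D i)"
    proof (cases "\<forall>i\<in>I. x i \<in> B i")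
      case True
      with x show ?thesis by (auto simp: PiE_def)
    next
      case False
      then obtain i where i: "i \<in> I" "x i \<notin> B i" by auto
      with x have "x \<in> D i" by (auto simp: D_def PiE_def Pi_def)
      with i show ?thesis by auto
    qed
  qed
  then have "emeasure ?P (E \<inter> PiE I A) \<le> emeasure ?P ((E \<inter> PiE I B) \<union> (\<Union>i\<in>I. D i))"
    using PB D I by (intro emeasure_mono sets.Un sets.finite_UN) auto
  also have "\<dots> \<le> emeasure ?P (E \<inter> PiE I B) + emeasure ?P (\<Union>i\<in>I. D i)"
    using PB D I by (intro emeasure_subadditive sets.finite_UN) auto
  also have "emeasure ?P (\<Union>i\<in>I. D i) \<le> (\<Sum>i\<in>I. emeasure ?P (D i))"
    using D I by (intro emeasure_subadditive_finite) auto
  also have "(\<Sum>i\<in>I. emeasure ?P (D i)) = (\<Sum>i\<in>I. emeasure lborel (A i - B i) * (\<Prod>j\<in>I - {i}. emeasure lborel (A j)))"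
  proof (rule sum.cong)
    fix i assume i: "i \<in> I"
    have "emeasure ?P (D i) = (\<Prod>j\<in>I. emeasure lborel ((A(i := A i - B i)) j))"
      unfolding D_def using A B i I by (intro emeasure_PiM_lborel) auto
    also have "\<dots> = emeasure lborel (A i - B i) * (\<Prod>j\<in>I - {i}. emeasure lborel (A j))"
      using I i by (subst prod.remove[of _ i]) (auto intro!: arg_cong2[where f = "(*)"] prod.cong)
    finally show "emeasure ?P (D i) = emeasure lborel (A i - B i) * (\<Prod>j\<in>I - {i}. emeasure lborel (A j))" .
  qed simp
  finally show ?thesis by (simp add: add_left_mono)
qed

text \<open>A form of Anderson's inequality. The box at \<open>\<tau> c\<close> contains the combination, with weights
\<open>(1 + \<tau>) / 2\<close> and \<open>(1 - \<tau>) / 2\<close>, of the boxes at \<open>c\<close> and at \<open>- c\<close>, and \<open>C\<close> is convex. The parts of \<open>C\<close> in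
the latter two boxes are reflections of each other, so the geometric mean of their measures that the
Prekopa-Leindler inequality produces is just the left-hand side.\<close>

lemma anderson_box:
  fixes C :: "('i \<Rightarrow> real) set"
  assumes I: "finite I" and C: "C \<in> sets (PiM I (\<lambda>_. lborel))"
    and conv: "\<And>x y t. x \<in> C \<Longrightarrow> y \<in> C \<Longrightarrow> 0 \<le> t \<Longrightarrow> t \<le> 1 \<Longrightarrow> (\<lambda>i\<in>I. (1 - t) * x i + t * y i) \<in> C"
    and sym: "\<And>x. x \<in> C \<Longrightarrow> (\<lambda>i\<in>I. - x i) \<in> C"
    and tau: "0 \<le> \<tau>" "\<tau> \<le> 1"
  shows "emeasure (PiM I (\<lambda>_. lborel)) (C \<inter> PiE I (\<lambda>i. ball (c i) (l i)))
    \<le> emeasure (PiM I (\<lambda>_. lborel)) (C \<inter> PiE I (\<lambda>i. ball (\<tau> * c i) (l i)))"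
proof (cases "\<tau> = 1")
  case False
  let ?P = "PiM I (\<lambda>_. lborel :: real measure)"
  (* The weight of the reflected box, chosen so that the midpoints combine to
     (1 - \<mu>) c + \<mu> (- c) = \<tau> c. *)
  define \<mu> where "\<mu> = (1 - \<tau>) / 2"
  have mu: "0 < \<mu>" "0 < 1 - \<mu>" "\<mu> \<le> 1" "\<tau> = 1 - 2 * \<mu>"
    using tau False by (auto simp: \<mu>_def field_simps)
  define Bx where "Bx s = C \<inter> PiE I (\<lambda>i. ball (s * c i) (l i))" for s
  have Bx [measurable]: "Bx s \<in> sets ?P" for s
    unfolding Bx_def using C I by (intro sets.Int sets_PiM_I_finite) auto
  have C_ext: "x \<in> C \<Longrightarrow> x \<in> PiE I (\<lambda>_. UNIV)" for x
    using sets.sets_into_space[OF C] by (auto simp: space_PiM)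
  have refl: "emeasure ?P (Bx (-1)) = emeasure ?P (Bx 1)"
  proof -
    have "emeasure ?P (Bx (-1)) = (\<integral>\<^sup>+x. indicator (Bx (-1)) x \<partial>?P)" by simp
    also have "\<dots> = (\<integral>\<^sup>+x. indicator (Bx (-1)) (\<lambda>i\<in>I. 0 + (-1) *\<^sub>R x i) \<partial>?P)"
      by (subst nn_integral_PiM_affine[OF I, of "-1" _ "\<lambda>_. 0"]) auto
    also have "\<dots> = (\<integral>\<^sup>+x. indicator (Bx 1) x \<partial>?P)"
    proof (rule nn_integral_cong)
      fix x assume "x \<in> space ?P"
      then have x: "x \<in> PiE I (\<lambda>_. UNIV)" by (simp add: space_PiM)
      have "(\<lambda>i\<in>I. - (\<lambda>i\<in>I. - x i) i) = x"
        using x by (auto simp: fun_eq_iff PiE_def extensional_def)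
      then have "(\<lambda>i\<in>I. - x i) \<in> C \<longleftrightarrow> x \<in> C"
        using sym[of x] sym[of "\<lambda>i\<in>I. - x i"] by auto
      then have "(\<lambda>i\<in>I. 0 + (-1) *\<^sub>R x i) \<in> Bx (-1) \<longleftrightarrow> x \<in> Bx 1"
        using x by (auto simp: Bx_def PiE_def Pi_def dist_real_def)
      then show "indicator (Bx (-1)) (\<lambda>i\<in>I. 0 + (-1) *\<^sub>R x i) = (indicator (Bx 1) x :: ennreal)"
        by (simp add: indicator_def)
    qed
    finally show ?thesis by simp
  qed
  have "emeasure ?P (Bx 1) \<le> emeasure ?P (Bx \<tau>)"
  proof (rule dense_le)
    fix z assume z: "z < emeasure ?P (Bx 1)"
    then obtain a where a: "z = ennreal a" "0 \<le> a" by (cases z) (auto simp: top_unique)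
    show "z \<le> emeasure ?P (Bx \<tau>)"
    proof (cases "a = 0")
      case False
      then have a0: "0 < a" using a by simp
      have "ennreal (a powr (1 - \<mu>) * a powr \<mu>) \<le> (\<integral>\<^sup>+x. indicator (Bx \<tau>) x \<partial>?P)"
      proof (rule prekopa_leindler_PiM[OF I, where u = "indicator (Bx 1)" and v = "indicator (Bx (-1))"])
        fix x y :: "'i \<Rightarrow> real" and p q :: real
        assume pq: "0 < p" "0 < q" "ennreal p < indicator (Bx 1) x" "ennreal q < indicator (Bx (-1)) y"
        have x: "x \<in> Bx 1" "p < 1" and y: "y \<in> Bx (-1)" "q < 1"
          using pq by (cases "x \<in> Bx 1"; cases "y \<in> Bx (-1)"; simp add: ennreal_less_one_iff)+
        have "(\<lambda>i\<in>I. (1 - \<mu>) * x i + \<mu> * y i) \<in> C"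
          using x y mu by (intro conv) (auto simp: Bx_def)
        moreover have "(1 - \<mu>) * x i + \<mu> * y i \<in> ball (\<tau> * c i) (l i)" if i: "i \<in> I" for i
        proof -
          have "\<bar>x i - c i\<bar> < l i" "\<bar>y i + c i\<bar> < l i"
            using x y i by (auto simp: Bx_def PiE_def Pi_def dist_real_def abs_minus_commute add.commute)
          then have "\<bar>(1 - \<mu>) * (x i - c i) + \<mu> * (y i + c i)\<bar> < l i"
          proof -
            assume *: "\<bar>x i - c i\<bar> < l i" "\<bar>y i + c i\<bar> < l i"
            have "\<bar>(1 - \<mu>) * (x i - c i) + \<mu> * (y i + c i)\<bar>
                \<le> (1 - \<mu>) * \<bar>x i - c i\<bar> + \<mu> * \<bar>y i + c i\<bar>"
              using mu abs_triangle_ineq[of "(1 - \<mu>) * (x i - c i)" "\<mu> * (y i + c i)"]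
              by (simp add: abs_mult)
            also have "\<dots> < (1 - \<mu>) * l i + \<mu> * l i"
              using * mu by (intro add_strict_mono mult_strict_left_mono) auto
            finally show ?thesis by (simp add: algebra_simps)
          qed
          moreover have "(1 - \<mu>) * (x i - c i) + \<mu> * (y i + c i) = (1 - \<mu>) * x i + \<mu> * y i - \<tau> * c i"
            by (simp add: mu(4) algebra_simps)
          ultimately show ?thesis by (simp add: dist_real_def abs_minus_commute)
        qed
        ultimately have "(\<lambda>i\<in>I. (1 - \<mu>) * x i + \<mu> * y i) \<in> Bx \<tau>"
          by (auto simp: Bx_def PiE_def Pi_def)
        moreover have "p powr (1 - \<mu>) * q powr \<mu> \<le> 1 * 1"
          using pq x y mu by (intro mult_mono powr_le1) auto
        ultimately show "ennreal (p powr (1 - \<mu>) * q powr \<mu>) \<le> indicator (Bx \<tau>) (\<lambda>i\<in>I. (1 - \<mu>) * x i + \<mu> * y i)"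
          by simp
      qed (use mu a0 z a refl in simp_all)
      moreover have "a powr (1 - \<mu>) * a powr \<mu> = a"
        using a0 by (simp flip: powr_add)
      ultimately show ?thesis using a by simp
    qed (use a in simp)
  qed
  then show ?thesis by (simp add: Bx_def)
qed simp

lemma emeasure_PiE_UN_disjoint:
  fixes B :: "'i \<Rightarrow> 'q \<Rightarrow> real set"
  assumes I: "finite I" and C: "C \<in> sets (PiM I (\<lambda>_. lborel))"
    and S: "\<And>i. i \<in> I \<Longrightarrow> finite (S i)" and B: "\<And>i q. i \<in> I \<Longrightarrow> B i q \<in> sets borel"
    and disj: "\<And>i p q. i \<in> I \<Longrightarrow> p \<in> S i \<Longrightarrow> q \<in> S i \<Longrightarrow> p \<noteq> q \<Longrightarrow> B i p \<inter> B i q = {}"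
  shows "emeasure (PiM I (\<lambda>_. lborel)) (C \<inter> PiE I (\<lambda>i. \<Union>q\<in>S i. B i q))
    = (\<Sum>j\<in>PiE I S. emeasure (PiM I (\<lambda>_. lborel)) (C \<inter> PiE I (\<lambda>i. B i (j i))))"
proof -
  let ?P = "PiM I (\<lambda>_. lborel :: real measure)"
  have eq: "C \<inter> PiE I (\<lambda>i. \<Union>q\<in>S i. B i q) = (\<Union>j\<in>PiE I S. C \<inter> PiE I (\<lambda>i. B i (j i)))"
  proof (intro equalityI subsetI)
    fix x assume x: "x \<in> C \<inter> PiE I (\<lambda>i. \<Union>q\<in>S i. B i q)"
    then have "\<forall>i\<in>I. \<exists>q\<in>S i. x i \<in> B i q" by (auto simp: PiE_def Pi_def)
    then obtain j where j: "\<forall>i\<in>I. j i \<in> S i \<and> x i \<in> B i (j i)" by metis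
    then have "restrict j I \<in> PiE I S" "x \<in> C \<inter> PiE I (\<lambda>i. B i (restrict j I i))"
      using x by (auto simp: PiE_def Pi_def)
    then show "x \<in> (\<Union>j\<in>PiE I S. C \<inter> PiE I (\<lambda>i. B i (j i)))" by blast
  next
    fix x assume "x \<in> (\<Union>j\<in>PiE I S. C \<inter> PiE I (\<lambda>i. B i (j i)))"
    then show "x \<in> C \<inter> PiE I (\<lambda>i. \<Union>q\<in>S i. B i q)"
      by (auto simp: PiE_def Pi_def)
  qed
  have fin: "finite (PiE I S)" using I S by (rule finite_PiE)
  have "disjoint_family_on (\<lambda>j. C \<inter> PiE I (\<lambda>i. B i (j i))) (PiE I S)"
  proof (unfold disjoint_family_on_def, intro ballI impI)
    fix j k assume jk: "j \<in> PiE I S" "k \<in> PiE I S" "j \<noteq> k"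
    then obtain i where "i \<in> I" "j i \<noteq> k i" by (metis PiE_ext)
    then have "B i (j i) \<inter> B i (k i) = {}" using disj[of i "j i" "k i"] jk by (auto simp: PiE_def Pi_def)
    then show "(C \<inter> PiE I (\<lambda>i. B i (j i))) \<inter> (C \<inter> PiE I (\<lambda>i. B i (k i))) = {}"
      using \<open>i \<in> I\<close> by (fastforce simp: PiE_def Pi_def)
  qed
  moreover have "C \<inter> PiE I (\<lambda>i. B i (j i)) \<in> sets ?P" for j
    using C B I by (intro sets.Int sets_PiM_I_finite) auto
  ultimately show ?thesis
    unfolding eq using fin by (intro sum_emeasure[symmetric]) auto
qed

text \<open>An interval is encoded by the pair of its midpoint and half its length.\<close>

definition interval_union :: "(real \<times> real) set \<Rightarrow> real set" where
  "interval_union Q = (\<Union>q\<in>Q. ball (fst q) (snd q))"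

lemma open_interval_union: "open (interval_union Q)"
  unfolding interval_union_def by auto

lemma interval_union_measurable [measurable]: "interval_union Q \<in> sets borel"
  using open_interval_union by simp

text \<open>Merging two touching or overlapping intervals into one adds at most one point to the union, so the
measure is unchanged although there are fewer intervals.\<close>

lemma join_touching_intervals:
  assumes Q: "finite Q" "\<And>q. q \<in> Q \<Longrightarrow> 0 < snd q" and pq: "p \<in> Q" "q \<in> Q" "p \<noteq> q"
    and touch: "\<bar>fst p - fst q\<bar> \<le> snd p + snd q"
  shows "\<exists>Q'. finite Q' \<and> card Q' < card Q \<and> (\<forall>r\<in>Q'. 0 < snd r) \<and> interval_union Q \<subseteq> interval_union Q'
    \<and> measure lborel (interval_union Q') = measure lborel (interval_union Q)"
proof -
  define lo where "lo = min (fst p - snd p) (fst q - snd q)"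
  define hi where "hi = max (fst p + snd p) (fst q + snd q)"
  define r where "r = ((lo + hi) / 2, (hi - lo) / 2)"
  have pos: "0 < snd p" "0 < snd q" using Q pq by auto
  have r: "0 < snd r" using pos by (auto simp: r_def lo_def hi_def)
  have ballr: "x \<in> ball (fst r) (snd r) \<longleftrightarrow> lo < x \<and> x < hi" for x
    by (auto simp: r_def dist_real_def abs_less_iff field_simps)
  have sub: "ball (fst p) (snd p) \<union> ball (fst q) (snd q) \<subseteq> ball (fst r) (snd r)"
    unfolding subset_iff ballr by (auto simp: lo_def hi_def dist_real_def)
  define z where "z = (if fst p \<le> fst q then fst p + snd p else fst q + snd q)"
  have diff: "ball (fst r) (snd r) \<subseteq> insert z (ball (fst p) (snd p) \<union> ball (fst q) (snd q))"
  proof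
    fix x assume "x \<in> ball (fst r) (snd r)"
    then have "lo < x" "x < hi" unfolding ballr by auto
    then show "x \<in> insert z (ball (fst p) (snd p) \<union> ball (fst q) (snd q))"
      using touch pos unfolding lo_def hi_def z_def
      by (simp add: dist_real_def split: if_splits) linarith+
  qed
  define Q' where "Q' = insert r (Q - {p, q})"
  have "card Q' < card Q"
  proof -
    have "card (Q - {p, q}) = card Q - 2"
      using pq Q by (subst card_Diff_subset) auto
    moreover have "2 \<le> card Q"
      using card_mono[of Q "{p, q}"] pq Q by auto
    moreover have "card Q' \<le> Suc (card (Q - {p, q}))"
      unfolding Q'_def by (rule card_insert_le_m1) (use Q in auto)
    ultimately show ?thesis by linarith
  qed
  moreover have U1: "interval_union Q \<subseteq> interval_union Q'"
    using sub by (auto simp: interval_union_def Q'_def)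
  moreover have "measure lborel (interval_union Q') = measure lborel (interval_union Q)"
  proof -
    have "interval_union Q' \<subseteq> insert z (interval_union Q)"
      using diff pq by (auto simp: interval_union_def Q'_def)
    then have "emeasure lborel (interval_union Q') \<le> emeasure lborel (insert z (interval_union Q))"
      by (intro emeasure_mono) auto
    also have "\<dots> = emeasure lborel (interval_union Q)"
    proof -
      have "emeasure lborel (interval_union Q \<union> {z}) = emeasure lborel (interval_union Q)"
        by (rule emeasure_Un_null_set) auto
      then show ?thesis by simp
    qed
    finally have "emeasure lborel (interval_union Q') = emeasure lborel (interval_union Q)"
      using emeasure_mono[OF U1, of lborel] by (intro antisym) auto
    then show ?thesis by (simp add: measure_def)
  qed
  ultimately show ?thesis
    using Q r by (intro exI[of _ Q']) (auto simp: Q'_def)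
qed

lemma emeasure_interval_union_disjoint:
  assumes "finite S" "\<And>q. q \<in> S \<Longrightarrow> 0 < snd q"
    and "\<And>p q. p \<in> S \<Longrightarrow> q \<in> S \<Longrightarrow> p \<noteq> q \<Longrightarrow> ball (c p) (snd p) \<inter> ball (c q) (snd q) = {}"
  shows "emeasure lborel (\<Union>q\<in>S. ball (c q :: real) (snd q)) = (\<Sum>q\<in>S. ennreal (2 * snd q))"
proof -
  have "emeasure lborel (\<Union>q\<in>S. ball (c q :: real) (snd q)) = (\<Sum>q\<in>S. emeasure lborel (ball (c q) (snd q)))"
    using assms by (intro sum_emeasure[symmetric]) (auto simp: disjoint_family_on_def)
  also have "\<dots> = (\<Sum>q\<in>S. ennreal (2 * snd q))"
    using assms(2) by (intro sum.cong refl) (simp add: ball_eq_greaterThanLessThan less_imp_le)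
  finally show ?thesis .
qed

lemma emeasure_PiE_mono:
  fixes A B :: "'i \<Rightarrow> 'a::euclidean_space set"
  assumes I: "finite I" and C: "C \<in> sets (PiM I (\<lambda>_. lborel))"
    and B: "\<And>i. i \<in> I \<Longrightarrow> B i \<in> sets borel" and AB: "\<And>i. i \<in> I \<Longrightarrow> A i \<subseteq> B i"
  shows "emeasure (PiM I (\<lambda>_. lborel)) (C \<inter> PiE I A) \<le> emeasure (PiM I (\<lambda>_. lborel)) (C \<inter> PiE I B)"
proof (rule emeasure_mono)
  show "C \<inter> PiE I A \<subseteq> C \<inter> PiE I B" using AB by (auto simp: PiE_def Pi_def)
  show "C \<inter> PiE I B \<in> sets (PiM I (\<lambda>_. lborel))"
    using C B I by (intro sets.Int sets_PiM_I_finite) auto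
qed

lemma disjoint_intervals_dist:
  fixes c d :: real
  assumes "0 < l" "0 < m"
  shows "ball c l \<inter> ball d m = {} \<longleftrightarrow> l + m \<le> \<bar>c - d\<bar>"
proof
  assume e: "ball c l \<inter> ball d m = {}"
  show "l + m \<le> \<bar>c - d\<bar>"
  proof (rule ccontr)
    assume n: "\<not> l + m \<le> \<bar>c - d\<bar>"
    (* The point that divides the segment between the midpoints in the ratio of the lengths. *)
    define x where "x = (m * c + l * d) / (l + m)"
    have "c - x = l * (c - d) / (l + m)" "x - d = m * (c - d) / (l + m)"
      using assms by (auto simp: x_def field_simps)
    then have "\<bar>c - x\<bar> = l * (\<bar>c - d\<bar> / (l + m))" "\<bar>d - x\<bar> = m * (\<bar>c - d\<bar> / (l + m))"
      using assms by (auto simp: abs_mult abs_minus_commute[of d])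
    moreover have "\<bar>c - d\<bar> / (l + m) < 1" using n assms by auto
    ultimately have "\<bar>c - x\<bar> < l * 1" "\<bar>d - x\<bar> < m * 1"
      using assms by (simp_all only: mult_strict_left_mono)
    then have "x \<in> ball c l \<inter> ball d m"
      by (simp add: dist_real_def)
    with e show False by auto
  qed
next
  assume "l + m \<le> \<bar>c - d\<bar>"
  then show "ball c l \<inter> ball d m = {}"
    by (auto simp: dist_real_def)
qed

section \<open>Rearrangement on the real line\<close>

text \<open>Induction over the total number of intervals. If two intervals of the same coordinate touch or overlap,
they are merged. Otherwise all midpoints are scaled by the largest factor \<open>\<tau> < 1\<close> for which two
intervals of some coordinate touch. Up to then the intervals of each coordinate stay disjoint, so the
box of unions splits into boxes of single intervals, to each of which \<open>anderson_box\<close> applies. If every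
coordinate has a single interval, the factor \<open>\<tau> = 0\<close> centres all of them at once.\<close>

lemma rearrangement_interval_unions:
  fixes C :: "('i \<Rightarrow> real) set"
  assumes I: "finite I" and C: "C \<in> sets (PiM I (\<lambda>_. lborel))"
    and conv: "\<And>x y t. x \<in> C \<Longrightarrow> y \<in> C \<Longrightarrow> 0 \<le> t \<Longrightarrow> t \<le> 1 \<Longrightarrow> (\<lambda>i\<in>I. (1 - t) * x i + t * y i) \<in> C"
    and sym: "\<And>x. x \<in> C \<Longrightarrow> (\<lambda>i\<in>I. - x i) \<in> C"
    and "\<And>i. i \<in> I \<Longrightarrow> finite (S i)" and "\<And>i q. i \<in> I \<Longrightarrow> q \<in> S i \<Longrightarrow> 0 < snd q"
  shows "emeasure (PiM I (\<lambda>_. lborel)) (C \<inter> PiE I (\<lambda>i. interval_union (S i)))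
    \<le> emeasure (PiM I (\<lambda>_. lborel)) (C \<inter> PiE I (\<lambda>i. ball 0 (measure lborel (interval_union (S i)) / 2)))"
  using assms(5,6)
proof (induction "\<Sum>i\<in>I. card (S i)" arbitrary: S rule: less_induct)
  case less
  let ?P = "PiM I (\<lambda>_. lborel :: real measure)"
  have join: "emeasure ?P (C \<inter> PiE I (\<lambda>i. interval_union (T i)))
      \<le> emeasure ?P (C \<inter> PiE I (\<lambda>i. ball 0 (measure lborel (interval_union (T i)) / 2)))"
    if T: "\<And>i. i \<in> I \<Longrightarrow> finite (T i)" "\<And>i q. i \<in> I \<Longrightarrow> q \<in> T i \<Longrightarrow> 0 < snd q"
      and le: "(\<Sum>i\<in>I. card (T i)) \<le> (\<Sum>i\<in>I. card (S i))"
      and touch: "i0 \<in> I" "p \<in> T i0" "q \<in> T i0" "p \<noteq> q" "\<bar>fst p - fst q\<bar> \<le> snd p + snd q" for T i0 p q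
  proof -
    obtain Q where Q: "finite Q" "card Q < card (T i0)" "\<forall>r\<in>Q. 0 < snd r"
        "interval_union (T i0) \<subseteq> interval_union Q"
        "measure lborel (interval_union Q) = measure lborel (interval_union (T i0))"
      using join_touching_intervals[of "T i0" p q] T touch by blast
    define T' where "T' = T(i0 := Q)"
    have "(\<Sum>i\<in>I. card (T' i)) < (\<Sum>i\<in>I. card (T i))"
      using I touch(1) Q(2) by (intro sum_strict_mono_ex1) (auto simp: T'_def)
    then have small: "(\<Sum>i\<in>I. card (T' i)) < (\<Sum>i\<in>I. card (S i))"
      using le by linarith
    have "emeasure ?P (C \<inter> PiE I (\<lambda>i. interval_union (T i))) \<le> emeasure ?P (C \<inter> PiE I (\<lambda>i. interval_union (T' i)))"
      using Q(4) by (intro emeasure_PiE_mono I C) (auto simp: T'_def)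
    also have "\<dots> \<le> emeasure ?P (C \<inter> PiE I (\<lambda>i. ball 0 (measure lborel (interval_union (T' i)) / 2)))"
      using T Q by (intro less.hyps small) (auto simp: T'_def split: if_splits)
    also have "(\<lambda>i. ball 0 (measure lborel (interval_union (T' i)) / 2)) = (\<lambda>i. ball (0::real) (measure lborel (interval_union (T i)) / 2))"
      by (simp add: T'_def fun_eq_iff Q(5))
    finally show ?thesis .
  qed
  consider (touching) i0 p q where "i0 \<in> I" "p \<in> S i0" "q \<in> S i0" "p \<noteq> q" "\<bar>fst p - fst q\<bar> \<le> snd p + snd q"
    | (empty) i0 where "i0 \<in> I" "S i0 = {}"
    | (single) "\<forall>i\<in>I. \<exists>q. S i = {q}"
    | (apart) i0 p q where "i0 \<in> I" "p \<in> S i0" "q \<in> S i0" "p \<noteq> q"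
        "\<And>i p q. i \<in> I \<Longrightarrow> p \<in> S i \<Longrightarrow> q \<in> S i \<Longrightarrow> p \<noteq> q \<Longrightarrow> snd p + snd q < \<bar>fst p - fst q\<bar>"
  proof (cases "\<exists>i0\<in>I. \<exists>p\<in>S i0. \<exists>q\<in>S i0. p \<noteq> q \<and> \<bar>fst p - fst q\<bar> \<le> snd p + snd q")
    case True then show ?thesis using touching by blast
  next
    case far: False
    show ?thesis
    proof (cases "\<exists>i0\<in>I. \<exists>p\<in>S i0. \<exists>q\<in>S i0. p \<noteq> q")
      case True then show ?thesis using apart far by (meson linorder_not_less)
    next
      case False
      show ?thesis
      proof (cases "\<exists>i0\<in>I. S i0 = {}")
        case True then show ?thesis using empty by blast
      next
        case nonempty: False
        have "\<exists>q. S i = {q}" if i: "i \<in> I" for i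
        proof -
          obtain q where "q \<in> S i" using nonempty i by blast
          then have "S i = {q}" using False i by blast
          then show ?thesis by blast
        qed
        then show ?thesis using single by blast
      qed
    qed
  qed
  then show ?case
  proof cases
    case touching
    then show ?thesis using join[of S] less.prems by blast
  next
    case empty
    then have "PiE I (\<lambda>i. interval_union (S i)) = {}"
      by (auto simp: interval_union_def PiE_eq_empty_iff)
    then show ?thesis by simp
  next
    case single
    then obtain q where q: "\<And>i. i \<in> I \<Longrightarrow> S i = {q i}" by metis
    have U: "interval_union (S i) = ball (fst (q i)) (snd (q i))" if "i \<in> I" for i
      using q[OF that] by (simp add: interval_union_def)
    have "0 < snd (q i)" if "i \<in> I" for i
      using less.prems(2)[OF that] q[OF that] by simp
    then have V: "ball 0 (measure lborel (interval_union (S i)) / 2) = ball (0 * fst (q i)) (snd (q i))" if "i \<in> I" for i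
      using that by (simp add: U ball_eq_greaterThanLessThan less_imp_le)
    have "PiE I (\<lambda>i. interval_union (S i)) = PiE I (\<lambda>i. ball (fst (q i)) (snd (q i)))"
      by (intro PiE_cong U)
    moreover have "PiE I (\<lambda>i. ball 0 (measure lborel (interval_union (S i)) / 2)) = PiE I (\<lambda>i. ball (0 * fst (q i)) (snd (q i)))"
      by (intro PiE_cong V)
    moreover have "emeasure ?P (C \<inter> PiE I (\<lambda>i. ball (fst (q i)) (snd (q i))))
        \<le> emeasure ?P (C \<inter> PiE I (\<lambda>i. ball (0 * fst (q i)) (snd (q i))))"
      by (rule anderson_box[OF I C conv sym]) simp_all
    ultimately show ?thesis by (simp only:)
  next
    case (apart i0 p0 q0)
    define Z where "Z = (SIGMA i:I. {(p, q). p \<in> S i \<and> q \<in> S i \<and> p \<noteq> q})"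
    define g where "g = (\<lambda>(i::'i, p::real \<times> real, q::real \<times> real). (snd p + snd q) / \<bar>fst p - fst q\<bar>)"
    have "finite Z"
    proof -
      have "Z \<subseteq> (SIGMA i:I. S i \<times> S i)" by (auto simp: Z_def)
      moreover have "finite (SIGMA i:I. S i \<times> S i)" using I less.prems by (intro finite_SigmaI finite_cartesian_product) auto
      ultimately show ?thesis by (rule finite_subset)
    qed
    have "(i0, p0, q0) \<in> Z" using apart(1-4) by (simp add: Z_def)
    (* For a pair of intervals, g is the scaling factor at which they touch; the pair with the
       largest factor touches first. *)
    define \<tau> where "\<tau> = Max (g ` Z)"
    have "\<tau> \<in> g ` Z"
      unfolding \<tau>_def using \<open>finite Z\<close> \<open>(i0, p0, q0) \<in> Z\<close> by (intro Max_in) auto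
    then obtain z where z: "z \<in> Z" "\<tau> = g z" by (elim imageE)
    obtain i1 p1 q1 where z_eq: "z = (i1, p1, q1)" by (cases z)
    have 1: "i1 \<in> I" "p1 \<in> S i1" "q1 \<in> S i1" "p1 \<noteq> q1"
      and tau_eq: "\<tau> = (snd p1 + snd q1) / \<bar>fst p1 - fst q1\<bar>"
      using z by (simp_all add: Z_def g_def z_eq)
    have pos: "0 < snd p" if "i \<in> I" "p \<in> S i" for i p using less.prems that by auto
    have d1: "snd p1 + snd q1 < \<bar>fst p1 - fst q1\<bar>" "0 < snd p1" "0 < snd q1"
      using apart(5)[OF 1] pos[OF 1(1,2)] pos[OF 1(1,3)] by simp_all
    have tau: "0 < \<tau>" "\<tau> \<le> 1" using d1 unfolding tau_eq by (simp_all add: divide_le_eq)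
    have far: "snd p + snd q \<le> \<bar>\<tau> * fst p - \<tau> * fst q\<bar>"
      if pq: "i \<in> I" "p \<in> S i" "q \<in> S i" "p \<noteq> q" for i p q
    proof -
      have "(snd p + snd q) / \<bar>fst p - fst q\<bar> \<le> \<tau>"
      proof -
        have "(i, p, q) \<in> Z" using pq by (simp add: Z_def)
        then have "g (i, p, q) \<le> \<tau>"
          unfolding \<tau>_def using \<open>finite Z\<close> by (intro Max_ge) simp_all
        then show ?thesis by (simp add: g_def)
      qed
      moreover have "0 < \<bar>fst p - fst q\<bar>"
        using apart(5)[OF pq] pos[OF pq(1,2)] pos[OF pq(1,3)] by linarith
      ultimately have "snd p + snd q \<le> \<tau> * \<bar>fst p - fst q\<bar>"
        by (simp add: divide_le_eq)
      also have "\<dots> = \<bar>\<tau> * fst p - \<tau> * fst q\<bar>"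
        using tau by (simp add: abs_mult flip: right_diff_distrib)
      finally show ?thesis .
    qed
    have disj1: "ball (fst p) (snd p) \<inter> ball (fst q) (snd q) = {}"
      if "i \<in> I" "p \<in> S i" "q \<in> S i" "p \<noteq> q" for i p q
      using apart(5)[OF that] pos[OF that(1,2)] pos[OF that(1,3)] by (simp add: disjoint_intervals_dist)
    have disj2: "ball (\<tau> * fst p) (snd p) \<inter> ball (\<tau> * fst q) (snd q) = {}"
      if "i \<in> I" "p \<in> S i" "q \<in> S i" "p \<noteq> q" for i p q
      using far[OF that] pos[OF that(1,2)] pos[OF that(1,3)] by (simp add: disjoint_intervals_dist)
    define m where "m = (\<lambda>q::real \<times> real. (\<tau> * fst q, snd q))"
    define T where "T i = m ` S i" for i
    have UT: "interval_union (T i) = (\<Union>q\<in>S i. ball (\<tau> * fst q) (snd q))" for i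
      by (simp add: interval_union_def T_def m_def)
    have measT: "measure lborel (interval_union (T i)) = measure lborel (interval_union (S i))" if i: "i \<in> I" for i
      unfolding measure_def UT unfolding interval_union_def
      using emeasure_interval_union_disjoint[OF less.prems(1)[OF i] pos[OF i] disj1[OF i]]
        emeasure_interval_union_disjoint[OF less.prems(1)[OF i] pos[OF i] disj2[OF i]] by simp
    have "emeasure ?P (C \<inter> PiE I (\<lambda>i. interval_union (S i)))
        = (\<Sum>j\<in>PiE I S. emeasure ?P (C \<inter> PiE I (\<lambda>i. ball (fst (j i)) (snd (j i)))))"
      unfolding interval_union_def
      by (intro emeasure_PiE_UN_disjoint I C less.prems(1) disj1) auto
    also have "\<dots> \<le> (\<Sum>j\<in>PiE I S. emeasure ?P (C \<inter> PiE I (\<lambda>i. ball (\<tau> * fst (j i)) (snd (j i)))))"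
      using tau by (intro sum_mono anderson_box[OF I C conv sym]) auto
    also have "\<dots> = emeasure ?P (C \<inter> PiE I (\<lambda>i. interval_union (T i)))"
      unfolding UT by (intro emeasure_PiE_UN_disjoint[symmetric] I C less.prems(1) disj2) auto
    also have "\<dots> \<le> emeasure ?P (C \<inter> PiE I (\<lambda>i. ball 0 (measure lborel (interval_union (T i)) / 2)))"
    proof (rule join)
      show "finite (T i)" if "i \<in> I" for i using less.prems that by (simp add: T_def)
      show "0 < snd q" if "i \<in> I" "q \<in> T i" for i q using pos that by (auto simp: T_def m_def)
      show "(\<Sum>i\<in>I. card (T i)) \<le> (\<Sum>i\<in>I. card (S i))"
        unfolding T_def using less.prems by (intro sum_mono card_image_le) auto
      show "i1 \<in> I" "m p1 \<in> T i1" "m q1 \<in> T i1" using 1 by (auto simp: T_def)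
      have "\<bar>\<tau> * fst p1 - \<tau> * fst q1\<bar> = \<tau> * \<bar>fst p1 - fst q1\<bar>"
        using tau by (simp add: abs_mult flip: right_diff_distrib)
      also have "\<dots> = snd p1 + snd q1"
        using d1 unfolding tau_eq by auto
      finally have eq: "\<bar>\<tau> * fst p1 - \<tau> * fst q1\<bar> = snd p1 + snd q1" .
      then show "\<bar>fst (m p1) - fst (m q1)\<bar> \<le> snd (m p1) + snd (m q1)" by (simp add: m_def)
      show "m p1 \<noteq> m q1" using eq d1 by (auto simp: m_def)
    qed
    also have "PiE I (\<lambda>i. ball 0 (measure lborel (interval_union (T i)) / 2))
        = PiE I (\<lambda>i. ball 0 (measure lborel (interval_union (S i)) / 2))"
      by (intro PiE_cong) (simp add: measT)
    finally show ?thesis .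
  qed
qed

lemma open_real_incseq_interval_unions:
  fixes U :: "real set"
  assumes "open U"
  obtains S :: "nat \<Rightarrow> (real \<times> real) set"
  where "\<And>k. finite (S k)" "\<And>k q. q \<in> S k \<Longrightarrow> 0 < snd q" "incseq (\<lambda>k. interval_union (S k))"
    "U = (\<Union>k. interval_union (S k))"
proof -
  define D where "D = {q \<in> \<rat> \<times> \<rat>. 0 < snd q \<and> ball (fst q) (snd q) \<subseteq> U}"
  have cD: "countable D"
    unfolding D_def by (rule countable_subset[of _ "\<rat> \<times> \<rat>"]) (auto intro: countable_rat)
  define S where "S k = {q \<in> D. to_nat_on D q < k}" for k
  have "finite (S k)" for k
  proof -
    have "S k = to_nat_on D -` {..<k} \<inter> D" by (auto simp: S_def)
    then show ?thesis using inj_on_to_nat_on[OF cD] by (simp add: finite_vimage_IntI)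
  qed
  moreover have "0 < snd q" if "q \<in> S k" for k q using that by (auto simp: S_def D_def)
  moreover have "incseq (\<lambda>k. interval_union (S k))"
    by (auto simp: incseq_def interval_union_def S_def intro: less_le_trans)
  moreover have "U = (\<Union>k. interval_union (S k))"
  proof (intro equalityI subsetI)
    fix x assume "x \<in> U"
    then obtain e where e: "0 < e" "ball x e \<subseteq> U" using assms by (auto simp: open_contains_ball)
    obtain c where c: "c \<in> \<rat>" "x - e / 3 < c" "c < x + e / 3"
      using Rats_dense_in_real[of "x - e / 3" "x + e / 3"] e by auto
    obtain l where l: "l \<in> \<rat>" "e / 3 < l" "l < 2 * e / 3"
      using Rats_dense_in_real[of "e / 3" "2 * e / 3"] e by auto
    have "ball c l \<subseteq> ball x e" using c l by (auto simp: dist_real_def)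
    then have "(c, l) \<in> D" using c l e by (auto simp: D_def)
    then have "(c, l) \<in> S (Suc (to_nat_on D (c, l)))" by (simp add: S_def)
    moreover have "x \<in> ball c l" using c l by (auto simp: dist_real_def)
    ultimately show "x \<in> (\<Union>k. interval_union (S k))" by (force simp: interval_union_def)
  next
    fix x assume "x \<in> (\<Union>k. interval_union (S k))"
    then show "x \<in> U" by (auto simp: interval_union_def S_def D_def)
  qed
  ultimately show ?thesis by (rule that)
qed

lemma PiE_UN_incseq:
  fixes V :: "nat \<Rightarrow> 'i \<Rightarrow> 'a set"
  assumes I: "finite I" and inc: "\<And>i. i \<in> I \<Longrightarrow> incseq (\<lambda>k. V k i)"
  shows "PiE I (\<lambda>i. \<Union>k. V k i) = (\<Union>k. PiE I (V k))" and "incseq (\<lambda>k. PiE I (V k))"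
proof -
  show "incseq (\<lambda>k. PiE I (V k))"
    using inc by (auto simp: incseq_def PiE_def Pi_def) blast
  show "PiE I (\<lambda>i. \<Union>k. V k i) = (\<Union>k. PiE I (V k))"
  proof (intro equalityI subsetI)
    fix x assume x: "x \<in> PiE I (\<lambda>i. \<Union>k. V k i)"
    then have "\<forall>i\<in>I. \<exists>k. x i \<in> V k i" by (auto simp: PiE_def Pi_def)
    then obtain k where k: "\<And>i. i \<in> I \<Longrightarrow> x i \<in> V (k i) i" by metis
    have "x i \<in> V (Max (insert 0 (k ` I))) i" if i: "i \<in> I" for i
    proof -
      have "k i \<le> Max (insert 0 (k ` I))" using I i by (intro Max_ge) auto
      then show ?thesis using inc[OF i] k[OF i] by (auto simp: incseq_def)
    qed
    then have "x \<in> PiE I (V (Max (insert 0 (k ` I))))" using x by (auto simp: PiE_def)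
    then show "x \<in> (\<Union>k. PiE I (V k))" by blast
  qed (auto simp: PiE_def Pi_def)
qed

lemma emeasure_PiE_incseq_SUP:
  fixes V :: "nat \<Rightarrow> 'i \<Rightarrow> 'a::euclidean_space set"
  assumes I: "finite I" and C: "C \<in> sets (PiM I (\<lambda>_. lborel))"
    and inc: "\<And>i. i \<in> I \<Longrightarrow> incseq (\<lambda>k. V k i)" and V: "\<And>i k. i \<in> I \<Longrightarrow> V k i \<in> sets borel"
  shows "emeasure (PiM I (\<lambda>_. lborel)) (C \<inter> PiE I (\<lambda>i. \<Union>k. V k i))
    = (SUP k. emeasure (PiM I (\<lambda>_. lborel)) (C \<inter> PiE I (V k)))"
proof -
  have "C \<inter> PiE I (\<lambda>i. \<Union>k. V k i) = (\<Union>k. C \<inter> PiE I (V k))"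
    using PiE_UN_incseq(1)[of I V, OF I inc] by auto
  moreover have "(SUP k. emeasure (PiM I (\<lambda>_. lborel)) (C \<inter> PiE I (V k))) = emeasure (PiM I (\<lambda>_. lborel)) (\<Union>k. C \<inter> PiE I (V k))"
  proof (rule SUP_emeasure_incseq)
    show "range (\<lambda>k. C \<inter> PiE I (V k)) \<subseteq> sets (PiM I (\<lambda>_. lborel))"
      using C V I by (auto intro!: sets.Int sets_PiM_I_finite)
    show "incseq (\<lambda>k. C \<inter> PiE I (V k))"
      using PiE_UN_incseq(2)[of I V, OF I inc] by (auto simp: incseq_def)
  qed
  ultimately show ?thesis by simp
qed

text \<open>Each \<open>A i\<close> is enclosed in an open set of nearly the same measure, which is an increasing limit of
finite unions of intervals.\<close>

theorem rearrangement_real: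
  fixes C :: "('i \<Rightarrow> real) set"
  assumes I: "finite I" and C: "C \<in> sets (PiM I (\<lambda>_. lborel))"
    and conv: "\<And>x y t. x \<in> C \<Longrightarrow> y \<in> C \<Longrightarrow> 0 \<le> t \<Longrightarrow> t \<le> 1 \<Longrightarrow> (\<lambda>i\<in>I. (1 - t) * x i + t * y i) \<in> C"
    and sym: "\<And>x. x \<in> C \<Longrightarrow> (\<lambda>i\<in>I. - x i) \<in> C"
    and A: "\<And>i. i \<in> I \<Longrightarrow> A i \<in> sets borel" "\<And>i. i \<in> I \<Longrightarrow> emeasure lborel (A i) < \<top>"
  shows "emeasure (PiM I (\<lambda>_. lborel)) (C \<inter> PiE I A)
    \<le> emeasure (PiM I (\<lambda>_. lborel)) (C \<inter> PiE I (\<lambda>i. ball 0 (measure lborel (A i) / 2)))"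
proof (rule ennreal_le_of_scaled_epsilon)
  let ?P = "PiM I (\<lambda>_. lborel :: real measure)"
  let ?a = "\<lambda>i. measure lborel (A i)"
  let ?K = "(\<Sum>i\<in>I. \<Prod>j\<in>I - {i}. ennreal (?a j + 1))"
  show "?K < \<top>"
  proof -
    have "?K = ennreal (\<Sum>i\<in>I. \<Prod>j\<in>I - {i}. ?a j + 1)"
      by (simp add: prod_ennreal sum_ennreal prod_nonneg del: ennreal_plus)
    then show ?thesis by simp
  qed
  fix \<epsilon> :: real assume eps: "0 < \<epsilon>" "\<epsilon> \<le> 1"
  have "\<exists>U. open U \<and> A i \<subseteq> U \<and> emeasure lborel U \<le> ennreal (?a i + \<epsilon>)" if i: "i \<in> I" for i
  proof -
    obtain U where U: "open U" "A i \<subseteq> U" "emeasure lborel (U - A i) < \<epsilon>"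
      using outer_regular_lborel[OF A(1)[OF i] eps(1)] by metis
    have "emeasure lborel U = emeasure lborel (A i) + emeasure lborel (U - A i)"
      using U A(1)[OF i] by (subst plus_emeasure) (auto simp: Un_absorb1)
    also have "\<dots> \<le> ennreal (?a i) + ennreal \<epsilon>"
      using A(2)[OF i] U(3) by (intro add_mono) (auto simp: emeasure_eq_ennreal_measure)
    finally show ?thesis using U eps by (auto simp: ennreal_plus)
  qed
  then obtain U where U: "\<And>i. i \<in> I \<Longrightarrow> open (U i)" "\<And>i. i \<in> I \<Longrightarrow> A i \<subseteq> U i"
      "\<And>i. i \<in> I \<Longrightarrow> emeasure lborel (U i) \<le> ennreal (?a i + \<epsilon>)"
    by metis
  have "\<exists>S. (\<forall>k. finite (S k)) \<and> (\<forall>k. \<forall>q\<in>S k. 0 < snd q) \<and> incseq (\<lambda>k. interval_union (S k)) \<and>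
      U i = (\<Union>k. interval_union (S k))" if i: "i \<in> I" for i
    using open_real_incseq_interval_unions[OF U(1)[OF i]] by metis
  then obtain S where S: "\<And>i k. i \<in> I \<Longrightarrow> finite (S i k)" "\<And>i k q. i \<in> I \<Longrightarrow> q \<in> S i k \<Longrightarrow> 0 < snd q"
      "\<And>i. i \<in> I \<Longrightarrow> incseq (\<lambda>k. interval_union (S i k))" "\<And>i. i \<in> I \<Longrightarrow> U i = (\<Union>k. interval_union (S i k))"
    by metis
  have "emeasure ?P (C \<inter> PiE I A) \<le> emeasure ?P (C \<inter> PiE I U)"
    using U by (intro emeasure_PiE_mono I C) auto
  also have "PiE I U = PiE I (\<lambda>i. \<Union>k. interval_union (S i k))"
    by (intro PiE_cong S(4))
  also have "emeasure ?P (C \<inter> PiE I (\<lambda>i. \<Union>k. interval_union (S i k)))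
      = (SUP k. emeasure ?P (C \<inter> PiE I (\<lambda>i. interval_union (S i k))))"
    by (rule emeasure_PiE_incseq_SUP[OF I C]) (auto intro: S)
  also have "\<dots> \<le> emeasure ?P (C \<inter> PiE I (\<lambda>i. ball 0 ((?a i + \<epsilon>) / 2)))"
  proof (rule SUP_least)
    fix k
    have "emeasure ?P (C \<inter> PiE I (\<lambda>i. interval_union (S i k)))
       \<le> emeasure ?P (C \<inter> PiE I (\<lambda>i. ball 0 (measure lborel (interval_union (S i k)) / 2)))"
      using S by (intro rearrangement_interval_unions[OF I C conv sym]) auto
    also have "\<dots> \<le> emeasure ?P (C \<inter> PiE I (\<lambda>i. ball 0 ((?a i + \<epsilon>) / 2)))"
    proof (intro emeasure_PiE_mono I C)
      fix i assume i: "i \<in> I"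
      have "emeasure lborel (interval_union (S i k)) \<le> emeasure lborel (U i)"
        using S(4)[OF i] U(1)[OF i] by (intro emeasure_mono) auto
      also have "\<dots> \<le> ennreal (?a i + \<epsilon>)" by (rule U(3)[OF i])
      finally have "measure lborel (interval_union (S i k)) \<le> ?a i + \<epsilon>"
        unfolding measure_def using eps by (intro enn2real_leI) auto
      then show "ball (0::real) (measure lborel (interval_union (S i k)) / 2) \<subseteq> ball 0 ((?a i + \<epsilon>) / 2)"
        by (intro subset_ball) simp
    qed simp
    finally show "emeasure ?P (C \<inter> PiE I (\<lambda>i. interval_union (S i k)))
       \<le> emeasure ?P (C \<inter> PiE I (\<lambda>i. ball 0 ((?a i + \<epsilon>) / 2)))" .
  qed
  also have "\<dots> \<le> emeasure ?P (C \<inter> PiE I (\<lambda>i. ball 0 (?a i / 2)))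
      + (\<Sum>i\<in>I. emeasure lborel (ball (0::real) ((?a i + \<epsilon>) / 2) - ball 0 (?a i / 2))
          * (\<Prod>j\<in>I - {i}. emeasure lborel (ball (0::real) ((?a j + \<epsilon>) / 2))))"
    by (intro emeasure_PiE_le_of_diff I C) auto
  also have "\<dots> \<le> emeasure ?P (C \<inter> PiE I (\<lambda>i. ball 0 (?a i / 2))) + ennreal \<epsilon> * ?K"
  proof -
    have vol: "emeasure lborel (ball (0::real) (c / 2)) = ennreal c" if "0 \<le> c" for c
      using that by (simp add: ball_eq_greaterThanLessThan)
    have "emeasure lborel (ball (0::real) ((?a i + \<epsilon>) / 2) - ball 0 (?a i / 2)) \<le> ennreal \<epsilon>" for i
    proof -
      have "emeasure lborel (ball (0::real) ((?a i + \<epsilon>) / 2) - ball 0 (?a i / 2))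
          = emeasure lborel (ball (0::real) ((?a i + \<epsilon>) / 2)) - emeasure lborel (ball (0::real) (?a i / 2))"
        using eps by (intro emeasure_Diff subset_ball) (auto simp: vol)
      also have "\<dots> = ennreal \<epsilon>"
        using eps by (subst (1 2) vol) (auto simp: ennreal_minus)
      finally show ?thesis by simp
    qed
    moreover have "emeasure lborel (ball (0::real) ((?a j + \<epsilon>) / 2)) \<le> ennreal (?a j + 1)" for j
      using eps by (subst vol) (auto intro!: ennreal_leI)
    ultimately show ?thesis
      unfolding sum_distrib_left by (intro add_left_mono sum_mono mult_mono prod_mono_ennreal) auto
  qed
  finally show "emeasure ?P (C \<inter> PiE I A)
      \<le> emeasure ?P (C \<inter> PiE I (\<lambda>i. ball 0 (?a i / 2))) + ennreal \<epsilon> * ?K" .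
qed

section \<open>Steiner symmetrization\<close>

definition section_length :: "'a::euclidean_space \<Rightarrow> 'a set \<Rightarrow> 'a \<Rightarrow> ennreal" where
  "section_length e A x = (\<integral>\<^sup>+t. indicator A (x + t *\<^sub>R e) \<partial>lborel)"

text \<open>The set that meets each line parallel to \<open>e\<close> in the open segment of length \<open>k\<close> whose midpoint lies on
the hyperplane orthogonal to \<open>e\<close>, provided that \<open>k\<close> is constant along these lines.\<close>

definition centred_on_lines :: "'a::euclidean_space \<Rightarrow> ('a \<Rightarrow> ennreal) \<Rightarrow> 'a set" where
  "centred_on_lines e k = {x. ennreal (2 * \<bar>x \<bullet> e\<bar>) < k x}"

definition steiner :: "'a::euclidean_space \<Rightarrow> 'a set \<Rightarrow> 'a set" where
  "steiner e A = centred_on_lines e (section_length e A)"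

lemma section_length_measurable [measurable]:
  assumes [measurable]: "A \<in> sets borel"
  shows "section_length e A \<in> borel_measurable borel"
  unfolding section_length_def by measurable

lemma centred_on_lines_measurable [measurable]:
  assumes [measurable]: "k \<in> borel_measurable borel"
  shows "centred_on_lines e k \<in> sets borel"
  unfolding centred_on_lines_def by measurable

lemma steiner_measurable [measurable]: "A \<in> sets borel \<Longrightarrow> steiner e A \<in> sets borel"
  unfolding steiner_def by (intro centred_on_lines_measurable section_length_measurable)

lemma section_length_eq_emeasure:
  assumes [measurable]: "A \<in> sets borel"
  shows "section_length e A x = emeasure lborel {t. x + t *\<^sub>R e \<in> A}"
proof -
  have "section_length e A x = (\<integral>\<^sup>+t. indicator {t. x + t *\<^sub>R e \<in> A} t \<partial>lborel)"
    unfolding section_length_def by (intro nn_integral_cong) (simp add: indicator_def)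
  also have "\<dots> = emeasure lborel {t. x + t *\<^sub>R e \<in> A}"
    by (rule nn_integral_indicator) measurable
  finally show ?thesis .
qed

lemma section_length_shift:
  assumes [measurable]: "A \<in> sets borel"
  shows "section_length e A (x + s *\<^sub>R e) = section_length e A x"
proof -
  have "section_length e A x = (\<integral>\<^sup>+t. indicator A (x + (s + t) *\<^sub>R e) \<partial>lborel)"
    unfolding section_length_def
    using nn_integral_lborel_affine[of 1 "\<lambda>t. indicator A (x + t *\<^sub>R e)" s] by simp
  then show ?thesis by (simp add: section_length_def algebra_simps)
qed

lemma section_length_mono:
  assumes "A \<subseteq> B"
  shows "section_length e A x \<le> section_length e B x"
  unfolding section_length_def using assms by (intro nn_integral_mono) (auto simp: indicator_def)

lemma section_length_Un_disjoint:
  assumes [measurable]: "A \<in> sets borel" "B \<in> sets borel" and "A \<inter> B = {}"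
  shows "section_length e (A \<union> B) x = section_length e A x + section_length e B x"
proof -
  have "indicator (A \<union> B) y = (indicator A y + indicator B y :: ennreal)" for y
    using assms(3) by (auto simp: indicator_def)
  then show ?thesis by (simp add: section_length_def nn_integral_add)
qed

lemma centred_sections:
  assumes e: "norm e = 1" and [measurable]: "k \<in> borel_measurable borel" and k: "\<And>x s. k (x + s *\<^sub>R e) = k x"
  shows "section_length e (centred_on_lines e k) x = k x"
proof -
  have ee: "e \<bullet> e = 1" using e by (simp add: norm_eq_1)
  define y where "y = x + (- (x \<bullet> e)) *\<^sub>R e"
  have ky: "k y = k x" unfolding y_def by (rule k)
  have "y \<bullet> e = 0" by (simp add: y_def inner_diff_left ee)
  then have mem: "y + t *\<^sub>R e \<in> centred_on_lines e k \<longleftrightarrow> ennreal (2 * \<bar>t\<bar>) < k x" for t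
    by (simp add: centred_on_lines_def k ky inner_add_left ee)
  have "section_length e (centred_on_lines e k) x = section_length e (centred_on_lines e k) y"
    unfolding y_def by (rule section_length_shift[symmetric]) measurable
  also have "\<dots> = emeasure lborel {t. ennreal (2 * \<bar>t\<bar>) < k x}"
    by (subst section_length_eq_emeasure) (simp_all add: mem)
  also have "\<dots> = k x"
  proof (cases "k x")
    case (real h)
    have "{t. ennreal (2 * \<bar>t\<bar>) < k x} = {- (h / 2)<..<h / 2}"
      using real by (auto simp: ennreal_less_iff)
    then show ?thesis using real by simp
  next
    case top
    then have "{t. ennreal (2 * \<bar>t\<bar>) < k x} = UNIV" by auto
    then show ?thesis using top by simp
  qed
  finally show ?thesis .
qed

lemma section_length_steiner:
  assumes "norm e = 1" and "A \<in> sets borel"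
  shows "section_length e (steiner e A) x = section_length e A x"
  unfolding steiner_def using assms by (intro centred_sections section_length_shift) auto

lemma emeasure_eq_lines:
  fixes A :: "'a::euclidean_space set"
  assumes "norm e = 1" and [measurable]: "A \<in> sets borel"
  shows "emeasure lborel A = (\<integral>\<^sup>+y. indicator (slab e) y * section_length e A y \<partial>lborel)"
  using nn_integral_lines[OF assms(1), of "indicator A"] by (simp add: section_length_def)

lemma emeasure_steiner:
  assumes "norm e = 1" and "A \<in> sets borel"
  shows "emeasure lborel (steiner e A) = emeasure lborel A"
  using assms by (simp add: emeasure_eq_lines section_length_steiner)

lemma steiner_mono:
  assumes "A \<subseteq> B"
  shows "steiner e A \<subseteq> steiner e B"
  unfolding steiner_def centred_on_lines_def using section_length_mono[OF assms] by (auto intro: less_le_trans)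

lemma norm_less_iff_square:
  assumes "0 < r"
  shows "norm x < r \<longleftrightarrow> (norm x)\<^sup>2 < r\<^sup>2"
  using assms power_mono_iff[of r "norm x" 2] by (simp flip: not_le)

lemma section_length_ball:
  fixes e x :: "'a::euclidean_space" and \<rho> :: real
  assumes e: "norm e = 1"
  defines "d \<equiv> \<rho>\<^sup>2 - (norm x)\<^sup>2 + (x \<bullet> e)\<^sup>2"
  assumes rho: "0 < \<rho>"
  shows "section_length e (ball 0 \<rho>) x = ennreal (2 * sqrt (max 0 d))"
proof -
  have ee: "e \<bullet> e = 1" using e by (simp add: norm_eq_1)
  have mem: "x + t *\<^sub>R e \<in> ball 0 \<rho> \<longleftrightarrow> (t + x \<bullet> e)\<^sup>2 < d" for t
  proof -
    have "(norm (x + t *\<^sub>R e))\<^sup>2 = (norm x)\<^sup>2 + 2 * t * (x \<bullet> e) + t\<^sup>2"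
      unfolding power2_norm_eq_inner
      by (simp add: inner_add_left inner_add_right ee inner_commute[of e x] power2_eq_square algebra_simps)
    moreover have "norm (x + t *\<^sub>R e) < \<rho> \<longleftrightarrow> (norm (x + t *\<^sub>R e))\<^sup>2 < \<rho>\<^sup>2"
      by (rule norm_less_iff_square[OF rho])
    moreover have "(t + x \<bullet> e)\<^sup>2 = t\<^sup>2 + 2 * t * (x \<bullet> e) + (x \<bullet> e)\<^sup>2"
      by (simp add: power2_eq_square algebra_simps)
    moreover have "x + t *\<^sub>R e \<in> ball 0 \<rho> \<longleftrightarrow> norm (x + t *\<^sub>R e) < \<rho>" by simp
    ultimately show ?thesis unfolding d_def by linarith
  qed
  have "section_length e (ball 0 \<rho>) x = emeasure lborel {t. (t + x \<bullet> e)\<^sup>2 < d}"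
    by (subst section_length_eq_emeasure) (simp_all add: mem del: mem_ball mem_ball_0)
  also have "{t. (t + x \<bullet> e)\<^sup>2 < d} = {- (x \<bullet> e) - sqrt (max 0 d) <..< - (x \<bullet> e) + sqrt (max 0 d)}"
  proof (cases "0 < d")
    case True
    have "s\<^sup>2 < d \<longleftrightarrow> \<bar>s\<bar> < sqrt d" for s :: real
      unfolding real_sqrt_abs[symmetric] real_sqrt_less_iff by (rule refl)
    moreover have "max 0 d = d" using True by simp
    ultimately show ?thesis by (simp only: set_eq_iff mem_Collect_eq greaterThanLessThan_iff abs_less_iff) linarith
  next
    case False
    then have "\<not> s\<^sup>2 < d" for s :: real using zero_le_power2[of s] by linarith
    then show ?thesis using False by auto
  qed
  also have "emeasure lborel \<dots> = ennreal (2 * sqrt (max 0 d))"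
    by (subst emeasure_lborel_Ioo) auto
  finally show ?thesis .
qed

text \<open>Together with \<open>steiner_mono\<close> this keeps all symmetrized sets inside a fixed ball.\<close>

lemma steiner_ball:
  fixes e :: "'a::euclidean_space"
  assumes e: "norm e = 1" and rho: "0 < \<rho>"
  shows "steiner e (ball 0 \<rho>) = ball 0 \<rho>"
proof (rule set_eqI)
  fix x :: 'a
  define d where "d = \<rho>\<^sup>2 - (norm x)\<^sup>2 + (x \<bullet> e)\<^sup>2"
  have "x \<in> steiner e (ball 0 \<rho>) \<longleftrightarrow> \<bar>x \<bullet> e\<bar> < sqrt (max 0 d)"
    unfolding steiner_def centred_on_lines_def
    by (simp add: section_length_ball[OF e rho] d_def ennreal_less_iff)
  also have "\<dots> \<longleftrightarrow> (x \<bullet> e)\<^sup>2 < max 0 d"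
    unfolding real_sqrt_abs[symmetric] real_sqrt_less_iff by (rule refl)
  also have "\<dots> \<longleftrightarrow> (norm x)\<^sup>2 < \<rho>\<^sup>2"
    using zero_le_power2[of "x \<bullet> e"] unfolding d_def by linarith
  also have "\<dots> \<longleftrightarrow> x \<in> ball 0 \<rho>"
    using norm_less_iff_square[OF rho, of x] by simp
  finally show "x \<in> steiner e (ball 0 \<rho>) \<longleftrightarrow> x \<in> ball 0 \<rho>" .
qed

lemma section_length_subset_ball:
  fixes e :: "'a::euclidean_space"
  assumes e: "norm e = 1" and R: "0 < R" and A: "A \<subseteq> ball 0 R"
  shows "section_length e A x \<le> ennreal (2 * R)"
proof -
  have "section_length e A x \<le> section_length e (ball 0 R) x" by (rule section_length_mono[OF A])
  also have "\<dots> \<le> ennreal (2 * R)"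
    unfolding section_length_ball[OF e R]
  proof (intro ennreal_leI mult_left_mono)
    have "(x \<bullet> e)\<^sup>2 \<le> (norm x)\<^sup>2"
      using Cauchy_Schwarz_ineq[of x e] e by (simp add: power2_norm_eq_inner norm_eq_1)
    then have "max 0 (R\<^sup>2 - (norm x)\<^sup>2 + (x \<bullet> e)\<^sup>2) \<le> R\<^sup>2" by simp
    then have "sqrt (max 0 (R\<^sup>2 - (norm x)\<^sup>2 + (x \<bullet> e)\<^sup>2)) \<le> sqrt (R\<^sup>2)"
      by (rule real_sqrt_le_mono)
    then show "sqrt (max 0 (R\<^sup>2 - (norm x)\<^sup>2 + (x \<bullet> e)\<^sup>2)) \<le> R"
      using R by simp
  qed simp
  finally show ?thesis .
qed

lemma steiner_subset_ball:
  assumes "norm e = 1" "0 < R" "A \<subseteq> ball 0 R"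
  shows "steiner e A \<subseteq> ball 0 R"
  using steiner_mono[OF assms(3), of e] steiner_ball[OF assms(1,2)] by simp

text \<open>On a line the symmetrized set and the ball are concentric segments, so they overlap in the shorter of
the two. If \<open>p\<close> and \<open>q\<close> denote the lengths on this line of the parts of \<open>A\<close> outside the ball and of the
ball outside \<open>A\<close>, the overlap grows by \<open>min p q\<close>, which is at least \<open>p q / (2 R)\<close> because
both lengths are at most \<open>2 R\<close>. The integral of \<open>p q\<close> over all lines is the double integral in the
statement.\<close>

lemma steiner_overlap_gain:
  fixes e :: "'a::euclidean_space"
  assumes e: "norm e = 1" and R: "0 < R" and rho: "0 < \<rho>" "\<rho> \<le> R"
    and A [measurable]: "A \<in> sets borel" and AR: "A \<subseteq> ball 0 R"
  shows "ennreal (2 * R) * emeasure lborel (A \<inter> ball 0 \<rho>)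
      + (\<integral>\<^sup>+x. indicator (A - ball 0 \<rho>) x * section_length e (ball 0 \<rho> - A) x \<partial>lborel)
    \<le> ennreal (2 * R) * emeasure lborel (steiner e A \<inter> ball 0 \<rho>)"
proof -
  define B where "B = ball (0::'a) \<rho>"
  define P where "P = A - B"
  define Q where "Q = B - A"
  have [measurable]: "B \<in> sets borel" "P \<in> sets borel" "Q \<in> sets borel"
    by (auto simp: B_def P_def Q_def)
  have BR: "B \<subseteq> ball 0 R" using rho by (auto simp: B_def)
  let ?s = "section_length e"
  have "steiner e A \<inter> B = centred_on_lines e (\<lambda>x. min (?s A x) (?s B x))"
    using steiner_ball[OF e rho(1)] by (auto simp: B_def steiner_def centred_on_lines_def)
  then have sec: "?s (steiner e A \<inter> B) y = min (?s A y) (?s B y)" for y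
    by (simp add: centred_sections[OF e] section_length_shift)
  have pt: "ennreal (2 * R) * ?s (A \<inter> B) y + ?s P y * ?s Q y \<le> ennreal (2 * R) * ?s (steiner e A \<inter> B) y" for y
  proof -
    have "P \<subseteq> ball 0 R" "Q \<subseteq> ball 0 R" using AR BR by (auto simp: P_def Q_def)
    then have le: "?s P y \<le> ennreal (2 * R)" "?s Q y \<le> ennreal (2 * R)"
      using section_length_subset_ball[OF e R] by auto
    have "(A \<inter> B) \<union> P = A" "(A \<inter> B) \<inter> P = {}" "(A \<inter> B) \<union> Q = B" "(A \<inter> B) \<inter> Q = {}"
      by (auto simp: P_def Q_def)
    then have "?s A y = ?s (A \<inter> B) y + ?s P y" "?s B y = ?s (A \<inter> B) y + ?s Q y"
      using section_length_Un_disjoint[of "A \<inter> B" P e y] section_length_Un_disjoint[of "A \<inter> B" Q e y]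
      by simp_all
    moreover have "min (a + p) (a + q) = a + min p q" for a p q :: ennreal
    proof (cases "p \<le> q")
      case True
      from add_left_mono[OF this, of a] show ?thesis using True by (simp only: min_absorb1)
    next
      case False
      then have "q \<le> p" by simp
      from add_left_mono[OF this, of a] show ?thesis using \<open>q \<le> p\<close> by (simp only: min_absorb2)
    qed
    ultimately have min_eq: "min (?s A y) (?s B y) = ?s (A \<inter> B) y + min (?s P y) (?s Q y)"
      by (simp only:)
    have "?s P y * ?s Q y \<le> ennreal (2 * R) * min (?s P y) (?s Q y)"
    proof (cases "?s P y \<le> ?s Q y")
      case True
      then show ?thesis using mult_right_mono[OF le(2), of "?s P y"] by (simp add: mult.commute min_absorb1)
    next
      case False
      then show ?thesis using mult_right_mono[OF le(1), of "?s Q y"] by (simp add: min_absorb2)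
    qed
    then show ?thesis
      unfolding sec min_eq by (simp add: distrib_left add_left_mono)
  qed
  have "(\<integral>\<^sup>+x. indicator P x * ?s Q x \<partial>lborel)
      = (\<integral>\<^sup>+y. indicator (slab e) y * (\<integral>\<^sup>+t. indicator P (y + t *\<^sub>R e) * ?s Q (y + t *\<^sub>R e) \<partial>lborel) \<partial>lborel)"
    by (rule nn_integral_lines[OF e]) measurable
  also have "\<dots> = (\<integral>\<^sup>+y. indicator (slab e) y * (?s P y * ?s Q y) \<partial>lborel)"
    by (simp add: section_length_shift nn_integral_multc section_length_def[of e P])
  finally have cross: "(\<integral>\<^sup>+x. indicator P x * ?s Q x \<partial>lborel) = \<dots>" .
  have "ennreal (2 * R) * emeasure lborel (A \<inter> B) + (\<integral>\<^sup>+x. indicator P x * ?s Q x \<partial>lborel)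
      = (\<integral>\<^sup>+y. indicator (slab e) y * (ennreal (2 * R) * ?s (A \<inter> B) y + ?s P y * ?s Q y) \<partial>lborel)"
    unfolding cross emeasure_eq_lines[OF e, of "A \<inter> B", simplified]
    by (simp add: nn_integral_add distrib_left mult.left_commute[of _ "ennreal (2 * R)"] nn_integral_cmult)
  also have "\<dots> \<le> (\<integral>\<^sup>+y. indicator (slab e) y * (ennreal (2 * R) * ?s (steiner e A \<inter> B) y) \<partial>lborel)"
    by (intro nn_integral_mono mult_left_mono pt) simp
  also have "\<dots> = ennreal (2 * R) * emeasure lborel (steiner e A \<inter> B)"
    unfolding emeasure_eq_lines[OF e, of "steiner e A \<inter> B", simplified]
    by (simp add: mult.left_commute[of _ "ennreal (2 * R)"] nn_integral_cmult)
  finally show ?thesis by (simp add: B_def P_def Q_def)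
qed

text \<open>On a product of lines parallel to \<open>e\<close>, each parametrized from its point closest to the origin, the set
\<open>E\<close> is convex, and the reflection that maps \<open>e\<close> to \<open>- e\<close> acts as the central symmetry of the parameters.
So \<open>rearrangement_real\<close> applies on each product of lines, and the centred intervals that it produces
are the sections of the symmetrized sets.\<close>

lemma steiner_increases:
  fixes E :: "('i \<Rightarrow> 'a::euclidean_space) set"
  assumes I: "finite I" and e: "norm e = 1" and E: "E \<in> sets (PiM I (\<lambda>_. lborel))"
    and conv: "\<And>x y t. x \<in> E \<Longrightarrow> y \<in> E \<Longrightarrow> 0 \<le> t \<Longrightarrow> t \<le> 1 \<Longrightarrow> (\<lambda>i\<in>I. (1 - t) *\<^sub>R x i + t *\<^sub>R y i) \<in> E"
    and refl: "\<And>x. x \<in> E \<Longrightarrow> (\<lambda>i\<in>I. x i - (2 * (x i \<bullet> e)) *\<^sub>R e) \<in> E"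
    and A: "\<And>i. i \<in> I \<Longrightarrow> A i \<in> sets borel" "\<And>i y. i \<in> I \<Longrightarrow> section_length e (A i) y < \<top>"
  shows "emeasure (PiM I (\<lambda>_. lborel)) (E \<inter> PiE I A)
    \<le> emeasure (PiM I (\<lambda>_. lborel)) (E \<inter> PiE I (\<lambda>i. steiner e (A i)))"
proof -
  let ?P = "PiM I (\<lambda>_. lborel :: 'a measure)" and ?R = "PiM I (\<lambda>_. lborel :: real measure)"
  have ee: "e \<bullet> e = 1" using e by (simp add: norm_eq_1)
  have m: "E \<inter> PiE I A \<in> sets ?P" "E \<inter> PiE I (\<lambda>i. steiner e (A i)) \<in> sets ?P"
    using E A I by (auto intro!: sets.Int sets_PiM_I_finite)
  have line: "(\<lambda>T. \<lambda>i\<in>I. Y i + T i *\<^sub>R e) \<in> ?R \<rightarrow>\<^sub>M ?P" for Y :: "'i \<Rightarrow> 'a"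
    by measurable
  have inner: "(\<integral>\<^sup>+T. indicator (E \<inter> PiE I A) (\<lambda>i\<in>I. Y i + T i *\<^sub>R e) \<partial>?R)
      \<le> (\<integral>\<^sup>+T. indicator (E \<inter> PiE I (\<lambda>i. steiner e (A i))) (\<lambda>i\<in>I. Y i + T i *\<^sub>R e) \<partial>?R)" for Y
  proof -
    (* The point closest to the origin on the line of the i-th factor. *)
    define Y' where "Y' i = Y i - (Y i \<bullet> e) *\<^sub>R e" for i
    have Y'e: "Y' i \<bullet> e = 0" for i by (simp add: Y'_def inner_diff_left ee)
    define C where "C = {T \<in> space ?R. (\<lambda>i\<in>I. Y' i + T i *\<^sub>R e) \<in> E}"
    have C: "C \<in> sets ?R"
      unfolding C_def using measurable_sets[OF line E] by (simp add: vimage_def Int_def conj_commute)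
    have Cmem: "T \<in> C \<longleftrightarrow> T \<in> PiE I (\<lambda>_. UNIV) \<and> (\<lambda>i\<in>I. Y' i + T i *\<^sub>R e) \<in> E" for T
      by (simp add: C_def space_PiM)
    have trans: "(\<integral>\<^sup>+T. indicator (E \<inter> PiE I B) (\<lambda>i\<in>I. Y i + T i *\<^sub>R e) \<partial>?R)
        = emeasure ?R (C \<inter> PiE I (\<lambda>i. {t. Y' i + t *\<^sub>R e \<in> B i}))" if B: "\<And>i. i \<in> I \<Longrightarrow> B i \<in> sets borel" for B
    proof -
      have mB: "E \<inter> PiE I B \<in> sets ?P" using E B I by (auto intro!: sets.Int sets_PiM_I_finite)
      have sB: "{t. Y' i + t *\<^sub>R e \<in> B i} \<in> sets borel" if "i \<in> I" for i
      proof -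
        note [measurable] = B[OF that]
        show ?thesis by measurable
      qed
      have "(\<integral>\<^sup>+T. indicator (E \<inter> PiE I B) (\<lambda>i\<in>I. Y i + T i *\<^sub>R e) \<partial>?R)
          = (\<integral>\<^sup>+T. indicator (E \<inter> PiE I B) (\<lambda>i\<in>I. Y i + (\<lambda>i\<in>I. - (Y i \<bullet> e) + T i) i *\<^sub>R e) \<partial>?R)"
        using measurable_compose[OF line borel_measurable_indicator[OF mB]]
        by (intro nn_integral_PiM_translate[OF I, symmetric])
      also have "\<dots> = (\<integral>\<^sup>+T. indicator (C \<inter> PiE I (\<lambda>i. {t. Y' i + t *\<^sub>R e \<in> B i})) T \<partial>?R)"
      proof (rule nn_integral_cong)
        fix T assume "T \<in> space ?R"
        then have T: "T \<in> PiE I (\<lambda>_. UNIV)" by (simp add: space_PiM)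
        have "(\<lambda>i\<in>I. Y i + (\<lambda>i\<in>I. - (Y i \<bullet> e) + T i) i *\<^sub>R e) = (\<lambda>i\<in>I. Y' i + T i *\<^sub>R e)"
          by (auto simp: fun_eq_iff Y'_def algebra_simps)
        moreover have "(\<lambda>i\<in>I. Y' i + T i *\<^sub>R e) \<in> E \<inter> PiE I B \<longleftrightarrow> T \<in> C \<inter> PiE I (\<lambda>i. {t. Y' i + t *\<^sub>R e \<in> B i})"
          using T by (auto simp: Cmem PiE_def Pi_def)
        ultimately show "indicator (E \<inter> PiE I B) (\<lambda>i\<in>I. Y i + (\<lambda>i\<in>I. - (Y i \<bullet> e) + T i) i *\<^sub>R e)
            = (indicator (C \<inter> PiE I (\<lambda>i. {t. Y' i + t *\<^sub>R e \<in> B i})) T :: ennreal)"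
          by (simp only: indicator_def)
      qed
      also have "\<dots> = emeasure ?R (C \<inter> PiE I (\<lambda>i. {t. Y' i + t *\<^sub>R e \<in> B i}))"
        using C sB I by (intro nn_integral_indicator sets.Int sets_PiM_I_finite) auto
      finally show ?thesis .
    qed
    have sec: "{t. Y' i + t *\<^sub>R e \<in> A i} \<in> sets borel"
        "emeasure lborel {t. Y' i + t *\<^sub>R e \<in> A i} = section_length e (A i) (Y' i)" if "i \<in> I" for i
    proof -
      note [measurable] = A(1)[OF that]
      show "{t. Y' i + t *\<^sub>R e \<in> A i} \<in> sets borel" by measurable
      show "emeasure lborel {t. Y' i + t *\<^sub>R e \<in> A i} = section_length e (A i) (Y' i)"
        by (simp add: section_length_eq_emeasure)
    qed
    have "emeasure ?R (C \<inter> PiE I (\<lambda>i. {t. Y' i + t *\<^sub>R e \<in> A i}))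
      \<le> emeasure ?R (C \<inter> PiE I (\<lambda>i. ball 0 (measure lborel {t. Y' i + t *\<^sub>R e \<in> A i} / 2)))"
    proof (rule rearrangement_real[OF I C])
      fix x y and t :: real assume *: "x \<in> C" "y \<in> C" "0 \<le> t" "t \<le> 1"
      then have "(\<lambda>i\<in>I. (1 - t) *\<^sub>R (\<lambda>i\<in>I. Y' i + x i *\<^sub>R e) i + t *\<^sub>R (\<lambda>i\<in>I. Y' i + y i *\<^sub>R e) i) \<in> E"
        using conv[OF _ _ *(3,4), of "\<lambda>i\<in>I. Y' i + x i *\<^sub>R e" "\<lambda>i\<in>I. Y' i + y i *\<^sub>R e"]
        unfolding Cmem by (simp only:)
      also have "(\<lambda>i\<in>I. (1 - t) *\<^sub>R (\<lambda>i\<in>I. Y' i + x i *\<^sub>R e) i + t *\<^sub>R (\<lambda>i\<in>I. Y' i + y i *\<^sub>R e) i)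
          = (\<lambda>i\<in>I. Y' i + (\<lambda>i\<in>I. (1 - t) * x i + t * y i) i *\<^sub>R e)"
        by (auto simp: fun_eq_iff algebra_simps)
      finally have mem: "(\<lambda>i\<in>I. Y' i + (\<lambda>i\<in>I. (1 - t) * x i + t * y i) i *\<^sub>R e) \<in> E" .
      show "(\<lambda>i\<in>I. (1 - t) * x i + t * y i) \<in> C"
        unfolding Cmem by (rule conjI, simp, rule mem)
    next
      fix x assume x: "x \<in> C"
      then have "(\<lambda>i\<in>I. (\<lambda>i\<in>I. Y' i + x i *\<^sub>R e) i - (2 * ((\<lambda>i\<in>I. Y' i + x i *\<^sub>R e) i \<bullet> e)) *\<^sub>R e) \<in> E"
        using refl[of "\<lambda>i\<in>I. Y' i + x i *\<^sub>R e"] unfolding Cmem by (simp only:)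
      also have "(\<lambda>i\<in>I. (\<lambda>i\<in>I. Y' i + x i *\<^sub>R e) i - (2 * ((\<lambda>i\<in>I. Y' i + x i *\<^sub>R e) i \<bullet> e)) *\<^sub>R e)
          = (\<lambda>i\<in>I. Y' i + (\<lambda>i\<in>I. - x i) i *\<^sub>R e)"
        by (auto simp: fun_eq_iff inner_add_left Y'e ee scaleR_2 simp flip: scaleR_scaleR)
      finally have mem: "(\<lambda>i\<in>I. Y' i + (\<lambda>i\<in>I. - x i) i *\<^sub>R e) \<in> E" .
      show "(\<lambda>i\<in>I. - x i) \<in> C"
        unfolding Cmem by (rule conjI, simp, rule mem)
    qed (use sec A(2) in auto)
    also have "PiE I (\<lambda>i. ball 0 (measure lborel {t. Y' i + t *\<^sub>R e \<in> A i} / 2))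
        = PiE I (\<lambda>i. {t. Y' i + t *\<^sub>R e \<in> steiner e (A i)})"
    proof (rule PiE_cong)
      fix i assume i: "i \<in> I"
      obtain h where h: "section_length e (A i) (Y' i) = ennreal h" "0 \<le> h"
        using A(2)[OF i, of "Y' i"] by (cases "section_length e (A i) (Y' i)") auto
      have "measure lborel {t. Y' i + t *\<^sub>R e \<in> A i} = h"
        using sec(2)[OF i] h by (simp add: measure_def)
      then show "ball 0 (measure lborel {t. Y' i + t *\<^sub>R e \<in> A i} / 2) = {t. Y' i + t *\<^sub>R e \<in> steiner e (A i)}"
        using h A(1)[OF i]
        by (auto simp: steiner_def centred_on_lines_def inner_add_left Y'e ee section_length_shift ennreal_less_iff)
    qed
    finally show ?thesis
      using trans[of A] trans[of "\<lambda>i. steiner e (A i)"] A(1) by simp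
  qed
  show ?thesis
    using nn_integral_PiM_lines[OF I e borel_measurable_indicator[OF m(1)]]
      nn_integral_PiM_lines[OF I e borel_measurable_indicator[OF m(2)]] m
    by (simp add: nn_integral_mono mult_left_mono inner)
qed

section \<open>Approaching balls by Steiner symmetrization\<close>

text \<open>The right-hand side measures how many pairs of points of \<open>P\<close> and \<open>Q\<close> lie on common lines parallel to \<open>e\<close>. Consider instead the quantity \<open>J v\<close>, the integral over \<open>x \<in> P\<close> of the length of
the set of \<open>s\<close> in \<open>{1..2}\<close> with \<open>x + s v \<in> Q\<close>, where \<open>v\<close> need not have length one. The integral of
\<open>J\<close> over all \<open>v\<close> is at least the product of the volumes of \<open>P\<close> and \<open>Q\<close> divided by \<open>2\<close> to the power of
the dimension. Vectors longer than \<open>2 R\<close> contribute nothing, and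
those shorter than a small \<open>\<epsilon>\<close> contribute little since \<open>J v\<close> is at most the volume of \<open>P\<close>. For the
remaining \<open>v\<close>, the number \<open>norm v * J v\<close> is a lower bound for the right-hand side in the direction of \<open>v\<close>,
so this cannot be small for all directions.\<close>

lemma direction_of_large_overlap:
  assumes R: "0 < R" and d: "0 < \<delta>"
  shows "\<exists>g>0. \<forall>P Q. P \<in> sets borel \<longrightarrow> Q \<in> sets borel \<longrightarrow> P \<subseteq> ball 0 R \<longrightarrow> Q \<subseteq> ball 0 R \<longrightarrow>
    \<delta> \<le> measure lborel P \<longrightarrow> \<delta> \<le> measure lborel Q \<longrightarrow>
    (\<exists>e::'a::euclidean_space. norm e = 1 \<and> ennreal g \<le> (\<integral>\<^sup>+x. indicator P x * section_length e Q x \<partial>lborel))"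
proof -
  let ?n = "DIM('a)"
  define \<omega> where "\<omega> = unit_ball_vol (real ?n)"
  have om: "0 < \<omega>" by (simp add: \<omega>_def)
  (* Small enough for the ball of radius \<epsilon> to have volume at most \<delta> / (2 * 2 ^ n);
     the bound \<epsilon> \<le> 1 allows estimating \<epsilon> ^ n by \<epsilon>. *)
  define \<epsilon> where "\<epsilon> = min 1 (\<delta> / (2 * 2 ^ ?n * \<omega>))"
  have eps: "0 < \<epsilon>" "\<epsilon> \<le> 1" using d om by (auto simp: \<epsilon>_def)
  define b where "b = measure lborel (ball (0::'a) \<epsilon>)"
  define V where "V = measure lborel (ball (0::'a) (2 * R))"
  have b_eq: "b = \<omega> * \<epsilon> ^ ?n" and V_eq: "V = \<omega> * (2 * R) ^ ?n"
    using eps R by (simp_all add: b_def V_def \<omega>_def content_ball)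
  have V: "0 < V" using om R by (simp add: V_eq)
  have "\<epsilon> ^ ?n \<le> \<epsilon>"
    using eps power_decreasing[of 1 ?n \<epsilon>] by simp
  then have "b \<le> \<omega> * \<epsilon>" using om by (simp add: b_eq)
  also have "\<dots> \<le> \<omega> * (\<delta> / (2 * 2 ^ ?n * \<omega>))" using om by (intro mult_left_mono) (auto simp: \<epsilon>_def)
  also have "\<dots> = \<delta> / (2 * 2 ^ ?n)" using om by simp
  finally have b: "2 ^ ?n * b \<le> \<delta> / 2" "0 \<le> b" by (auto simp: b_def field_simps)
  define g where "g = \<epsilon> * \<delta>\<^sup>2 / (4 * 2 ^ ?n * V)"
  have g: "0 < g" using eps d V by (simp add: g_def)
  show ?thesis
  proof (intro exI[of _ g] conjI g allI impI, rule ccontr)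
    fix P Q :: "'a set"
    assume [measurable]: "P \<in> sets borel" "Q \<in> sets borel"
      and PR: "P \<subseteq> ball 0 R" and QR: "Q \<subseteq> ball 0 R"
      and Pd: "\<delta> \<le> measure lborel P" and Qd: "\<delta> \<le> measure lborel Q"
      and no: "\<not> (\<exists>e::'a. norm e = 1 \<and> ennreal g \<le> (\<integral>\<^sup>+x. indicator P x * section_length e Q x \<partial>lborel))"
    have finite_vol: "emeasure lborel S = ennreal (measure lborel S)" if "S \<subseteq> ball 0 R" "S \<in> sets borel" for S :: "'a set"
    proof -
      have "emeasure lborel S \<le> emeasure lborel (ball (0::'a) R)" using that by (intro emeasure_mono) auto
      also have "\<dots> < \<top>" using R by (simp add: emeasure_ball)
      finally show ?thesis by (simp add: emeasure_eq_ennreal_measure)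
    qed
    define p where "p = measure lborel P"
    define q where "q = measure lborel Q"
    have P: "emeasure lborel P = ennreal p" and Q: "emeasure lborel Q = ennreal q"
      using PR QR by (auto simp: p_def q_def finite_vol)
    have pq: "\<delta> \<le> p" "\<delta> \<le> q" using Pd Qd by (auto simp: p_def q_def)
    define J :: "'a \<Rightarrow> ennreal" where
      "J v = (\<integral>\<^sup>+x. indicator P x * (\<integral>\<^sup>+s. indicator {1..2} s * indicator Q (x + s *\<^sub>R v) \<partial>(lborel::real measure)) \<partial>lborel)" for v
    have [measurable]: "J \<in> borel_measurable borel" unfolding J_def by measurable
    have J_le: "J v \<le> ennreal p" for v
    proof -
      have "J v \<le> (\<integral>\<^sup>+x. indicator P x * 1 \<partial>lborel)"
        unfolding J_def
      proof (intro nn_integral_mono mult_left_mono)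
        fix x
        have "(\<integral>\<^sup>+s. indicator {1..2} s * indicator Q (x + s *\<^sub>R v) \<partial>lborel) \<le> (\<integral>\<^sup>+s. indicator {1..2} s \<partial>(lborel::real measure))"
          by (intro nn_integral_mono) (auto simp: indicator_def)
        then show "(\<integral>\<^sup>+s. indicator {1..2} s * indicator Q (x + s *\<^sub>R v) \<partial>lborel) \<le> 1" by simp
      qed simp
      then show ?thesis using P by simp
    qed
    have J_0: "J v = 0" if v: "2 * R \<le> norm v" for v
    proof -
      have zero: "indicator P x * (indicator {1..2} s * indicator Q (x + s *\<^sub>R v)) = (0::ennreal)" for x s
      proof (rule ccontr)
        assume "\<not> ?thesis"
        then have "x \<in> P" "1 \<le> s" "x + s *\<^sub>R v \<in> Q" by (auto simp: indicator_def split: if_splits)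
        then have "norm x < R" "norm (x + s *\<^sub>R v) < R" using PR QR by auto
        then have "norm (s *\<^sub>R v) < 2 * R" using norm_triangle_ineq4[of "x + s *\<^sub>R v" x] by simp
        moreover have "norm v \<le> norm (s *\<^sub>R v)" using \<open>1 \<le> s\<close> by (simp add: mult_le_cancel_right1)
        ultimately show False using v by linarith
      qed
      then show ?thesis unfolding J_def
        by (subst nn_integral_cmult[symmetric]) (measurable, simp only: zero nn_integral_const mult_zero_left)
    qed
    have J_g: "J v \<le> ennreal (g / \<epsilon>)" if v: "\<epsilon> \<le> norm v" for v
    proof -
      define c where "c = norm v"
      define e where "e = (1 / c) *\<^sub>R v"
      have c: "0 < c" "\<epsilon> \<le> c" using v eps by (auto simp: c_def)
      then have "v \<noteq> 0" by (auto simp: c_def)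
      then have e: "norm e = 1" "c *\<^sub>R e = v" using c by (auto simp: e_def c_def)
      have "ennreal c * J v \<le> (\<integral>\<^sup>+x. indicator P x * section_length e Q x \<partial>lborel)"
      proof -
        have "ennreal c * J v = (\<integral>\<^sup>+x. indicator P x * (ennreal c * (\<integral>\<^sup>+s. indicator {1..2} s * indicator Q (x + s *\<^sub>R v) \<partial>lborel)) \<partial>lborel)"
          unfolding J_def by (subst nn_integral_cmult[symmetric]) (auto simp: mult.left_commute)
        also have "\<dots> \<le> (\<integral>\<^sup>+x. indicator P x * section_length e Q x \<partial>lborel)"
        proof (intro nn_integral_mono mult_left_mono)
          fix x
          have "section_length e Q x = ennreal c * (\<integral>\<^sup>+s. indicator Q (x + (c * s) *\<^sub>R e) \<partial>lborel)"
            unfolding section_length_def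
            using nn_integral_lborel_affine[of c "\<lambda>t. indicator Q (x + t *\<^sub>R e)" 0] c by simp
          also have "(\<lambda>s. x + (c * s) *\<^sub>R e) = (\<lambda>s. x + s *\<^sub>R v)"
            by (simp add: e(2)[symmetric] mult.commute)
          finally have sl: "section_length e Q x = ennreal c * (\<integral>\<^sup>+s. indicator Q (x + s *\<^sub>R v) \<partial>lborel)" 
            by (simp add: e(2)[symmetric] mult.commute)
          show "ennreal c * (\<integral>\<^sup>+s. indicator {1..2} s * indicator Q (x + s *\<^sub>R v) \<partial>lborel) \<le> section_length e Q x"
            unfolding sl by (intro mult_left_mono nn_integral_mono) (auto simp: indicator_def)
        qed simp
        finally show ?thesis .
      qed
      also have "\<dots> \<le> ennreal g" using no e(1) by (meson linear)
      finally have cJ: "ennreal c * J v \<le> ennreal g" .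
      obtain j where j: "J v = ennreal j" "0 \<le> j" using J_le[of v] by (cases "J v") (auto simp: top_unique)
      have "c * j \<le> g" using cJ j c g by (simp flip: ennreal_mult add: ennreal_le_iff)
      moreover have "\<epsilon> * j \<le> c * j" using c j by (intro mult_right_mono)
      ultimately have "\<epsilon> * j \<le> g" by linarith
      then have "j \<le> g / \<epsilon>" using eps by (simp add: field_simps)
      then show ?thesis using j by (simp add: ennreal_leI)
    qed
    have "(\<integral>\<^sup>+v. J v \<partial>lborel) \<le> (\<integral>\<^sup>+v. indicator (ball (0::'a) \<epsilon>) v * ennreal p + indicator (ball 0 (2 * R)) v * ennreal (g / \<epsilon>) \<partial>lborel)"
    proof (rule nn_integral_mono)
      fix v :: 'a
      consider "norm v < \<epsilon>" | "\<epsilon> \<le> norm v" "norm v < 2 * R" | "2 * R \<le> norm v" by linarith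
      then show "J v \<le> indicator (ball 0 \<epsilon>) v * ennreal p + indicator (ball 0 (2 * R)) v * ennreal (g / \<epsilon>)"
      proof cases
        case 1
        then show ?thesis using add_mono[OF J_le[of v], of 0] by simp
      next
        case 2
        then show ?thesis using J_g[of v] by simp
      next
        case 3
        then show ?thesis by (simp add: J_0)
      qed
    qed
    also have "\<dots> = ennreal b * ennreal p + ennreal V * ennreal (g / \<epsilon>)"
    proof -
      have "emeasure lborel (ball (0::'a) \<epsilon>) = ennreal b" "emeasure lborel (ball (0::'a) (2 * R)) = ennreal V"
        using eps R by (simp_all add: emeasure_ball b_eq V_eq \<omega>_def)
      moreover have [measurable]: "ball (0::'a) r \<in> sets borel" for r by simp
      ultimately show ?thesis by (simp add: nn_integral_add nn_integral_multc)
    qed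
    also have "\<dots> = ennreal (b * p + V * (g / \<epsilon>))"
      using b V g eps pq d by (simp add: ennreal_mult ennreal_plus del: times_divide_eq_right)
    finally have upper: "(\<integral>\<^sup>+v. J v \<partial>lborel) \<le> ennreal (b * p + V * (g / \<epsilon>))" .
    have lower: "ennreal (p * q) \<le> ennreal (2 ^ ?n) * (\<integral>\<^sup>+v. J v \<partial>lborel)"
    proof -
      have "(\<integral>\<^sup>+v. J v \<partial>lborel) = (\<integral>\<^sup>+x. \<integral>\<^sup>+v. indicator P x * (\<integral>\<^sup>+s. indicator {1..2} s * indicator Q (x + s *\<^sub>R v) \<partial>(lborel::real measure)) \<partial>lborel \<partial>lborel)"
        unfolding J_def by (rule lborel_pair.Fubini') measurable
      also have "\<dots> = (\<integral>\<^sup>+x. indicator P x * (\<integral>\<^sup>+v. \<integral>\<^sup>+s. indicator {1..2} s * indicator Q (x + s *\<^sub>R v) \<partial>(lborel::real measure) \<partial>lborel) \<partial>lborel)"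
        by (intro nn_integral_cong nn_integral_cmult) measurable
      also have "\<dots> = (\<integral>\<^sup>+x. indicator P x * (\<integral>\<^sup>+s. \<integral>\<^sup>+v. indicator {1..2} s * indicator Q (x + s *\<^sub>R v) \<partial>lborel \<partial>(lborel::real measure)) \<partial>lborel)"
        by (intro nn_integral_cong arg_cong2[where f = "(*)"] refl lborel_pair.Fubini') measurable
      finally have J_eq: "(\<integral>\<^sup>+v. J v \<partial>lborel) = \<dots>" .
      have inner: "ennreal q \<le> ennreal (2 ^ ?n) * (\<integral>\<^sup>+s. \<integral>\<^sup>+v. indicator {1..2} s * indicator Q (x + s *\<^sub>R v) \<partial>lborel \<partial>(lborel::real measure))" for x
      proof -
        have "indicator {1..2} s * ennreal q \<le> ennreal (2 ^ ?n) * (\<integral>\<^sup>+v. indicator {1..2} s * indicator Q (x + s *\<^sub>R v) \<partial>lborel)" for s :: real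
        proof (cases "s \<in> {1..2}")
          case True
          have "ennreal q = ennreal (\<bar>s\<bar> ^ ?n) * (\<integral>\<^sup>+v. indicator Q (x + s *\<^sub>R v) \<partial>lborel)"
            using nn_integral_lborel_affine[of s "indicator Q" x] True Q by simp
          also have "\<dots> \<le> ennreal (2 ^ ?n) * (\<integral>\<^sup>+v. indicator Q (x + s *\<^sub>R v) \<partial>lborel)"
            using True by (intro mult_right_mono ennreal_leI power_mono) auto
          finally show ?thesis using True by simp
        qed simp
        then have "(\<integral>\<^sup>+s. indicator {1..2} s * ennreal q \<partial>(lborel::real measure)) \<le> (\<integral>\<^sup>+s. ennreal (2 ^ ?n) * (\<integral>\<^sup>+v. indicator {1..2} s * indicator Q (x + s *\<^sub>R v) \<partial>lborel) \<partial>(lborel::real measure))"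
          by (intro nn_integral_mono)
        also have "\<dots> = ennreal (2 ^ ?n) * (\<integral>\<^sup>+s. \<integral>\<^sup>+v. indicator {1..2} s * indicator Q (x + s *\<^sub>R v) \<partial>lborel \<partial>(lborel::real measure))"
          by (rule nn_integral_cmult) measurable
        finally show ?thesis by (simp add: nn_integral_multc)
      qed
      have "ennreal (p * q) = (\<integral>\<^sup>+x. indicator P x * ennreal q \<partial>lborel)"
        using P pq d by (simp add: nn_integral_multc ennreal_mult)
      also have "\<dots> \<le> (\<integral>\<^sup>+x. indicator P x * (ennreal (2 ^ ?n) * (\<integral>\<^sup>+s. \<integral>\<^sup>+v. indicator {1..2} s * indicator Q (x + s *\<^sub>R v) \<partial>lborel \<partial>(lborel::real measure))) \<partial>lborel)"
        by (intro nn_integral_mono mult_left_mono inner) simp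
      also have "\<dots> = ennreal (2 ^ ?n) * (\<integral>\<^sup>+v. J v \<partial>lborel)"
        unfolding J_eq by (subst nn_integral_cmult[symmetric]) (measurable, simp add: mult.left_commute)
      finally show ?thesis .
    qed
    have "ennreal (p * q) \<le> ennreal (2 ^ ?n) * ennreal (b * p + V * (g / \<epsilon>))"
      by (rule order_trans[OF lower mult_left_mono[OF upper]]) simp
    also have "\<dots> = ennreal (2 ^ ?n * (b * p + V * (g / \<epsilon>)))"
      by (simp add: ennreal_mult')
    finally have "p * q \<le> 2 ^ ?n * (b * p + V * (g / \<epsilon>))"
      using b V g eps pq d by (subst (asm) ennreal_le_iff) auto
    also have "\<dots> = (2 ^ ?n * b) * p + \<delta>\<^sup>2 / 4"
      using eps V by (simp add: g_def field_simps)
    also have "\<dots> \<le> \<delta> / 2 * p + \<delta>\<^sup>2 / 4"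
      using b pq d by (intro add_right_mono mult_right_mono) auto
    finally have "p * (q - \<delta> / 2) \<le> \<delta>\<^sup>2 / 4" by (simp add: algebra_simps)
    moreover have "\<delta> * (\<delta> / 2) \<le> p * (q - \<delta> / 2)"
      using pq d by (intro mult_mono) auto
    ultimately have "\<delta>\<^sup>2 / 2 \<le> \<delta>\<^sup>2 / 4" by (simp add: power2_eq_square)
    then show False using d by simp
  qed
qed

lemma emeasure_bounded_eq_measure:
  fixes A :: "'a::euclidean_space set"
  assumes "A \<subseteq> ball 0 R" "A \<in> sets borel"
  shows "emeasure lborel A = ennreal (measure lborel A)"
proof -
  have "emeasure lborel A \<le> emeasure lborel (ball (0::'a) R)" using assms by (intro emeasure_mono) auto
  also have "\<dots> \<le> emeasure lborel (ball (0::'a) (max 0 R))" by (intro emeasure_mono subset_ball) auto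
  also have "\<dots> < \<top>" by (simp add: emeasure_ball)
  finally show ?thesis by (simp add: emeasure_eq_ennreal_measure)
qed

text \<open>The parts of \<open>A\<close> outside the ball and of the ball outside \<open>A\<close> have the same volume, at least \<open>\<delta>\<close>.
The gain \<open>g\<close> depends only on \<open>R\<close> and \<open>\<delta>\<close>, so a supremum of overlaps can be exceeded from any nearly
optimal set, which replaces the construction of a convergent sequence of symmetrizations.\<close>

lemma steiner_uniform_gain:
  assumes R: "0 < R" and d: "0 < \<delta>"
  shows "\<exists>g>0. \<forall>(A::'a::euclidean_space set) \<rho>. A \<in> sets borel \<longrightarrow> A \<subseteq> ball 0 R \<longrightarrow> 0 < \<rho> \<longrightarrow> \<rho> \<le> R \<longrightarrow>
    measure lborel A = measure lborel (ball (0::'a) \<rho>) \<longrightarrow>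
    \<delta> \<le> measure lborel (ball (0::'a) \<rho>) - measure lborel (A \<inter> ball 0 \<rho>) \<longrightarrow>
    (\<exists>e. norm e = 1 \<and> measure lborel (A \<inter> ball 0 \<rho>) + g \<le> measure lborel (steiner e A \<inter> ball 0 \<rho>))"
proof -
  from direction_of_large_overlap[OF R d, where 'a = 'a]
  obtain g where g: "0 < g" and G': "\<forall>P Q. P \<in> sets borel \<longrightarrow> Q \<in> sets borel \<longrightarrow> P \<subseteq> ball 0 R \<longrightarrow> Q \<subseteq> ball 0 R \<longrightarrow>
      \<delta> \<le> measure lborel P \<longrightarrow> \<delta> \<le> measure lborel Q \<longrightarrow>
      (\<exists>e::'a. norm e = 1 \<and> ennreal g \<le> (\<integral>\<^sup>+x. indicator P x * section_length e Q x \<partial>lborel))"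
    by (elim exE conjE)
  note G = G'[rule_format]
  show ?thesis
  proof (intro exI[of _ "g / (2 * R)"] conjI allI impI)
    show "0 < g / (2 * R)" using g R by (intro divide_pos_pos) simp_all
    fix A :: "'a set" and \<rho> :: real
    assume A [measurable]: "A \<in> sets borel" and AR: "A \<subseteq> ball 0 R" and rho: "0 < \<rho>" "\<rho> \<le> R"
      and eq: "measure lborel A = measure lborel (ball (0::'a) \<rho>)"
      and d': "\<delta> \<le> measure lborel (ball (0::'a) \<rho>) - measure lborel (A \<inter> ball 0 \<rho>)"
    let ?B = "ball (0::'a) \<rho>"
    have BR: "?B \<subseteq> ball 0 R" using rho by (intro subset_ball)
    note fin = emeasure_bounded_eq_measure
    have "measure lborel (A - ?B) = measure lborel A - measure lborel (A \<inter> ?B)"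
    proof -
      have "measure lborel (A - (A \<inter> ?B)) = measure lborel A - measure lborel (A \<inter> ?B)"
        using fin[OF AR] by (intro measure_Diff) auto
      then show ?thesis by (simp add: Diff_Int)
    qed
    moreover have "measure lborel (?B - A) = measure lborel ?B - measure lborel (A \<inter> ?B)"
    proof -
      have "measure lborel (?B - (A \<inter> ?B)) = measure lborel ?B - measure lborel (A \<inter> ?B)"
        using fin[OF BR] by (intro measure_Diff) auto
      then show ?thesis by (simp add: Diff_Int)
    qed
    ultimately have "\<delta> \<le> measure lborel (A - ?B)" "\<delta> \<le> measure lborel (?B - A)"
      using d' eq by linarith+
    obtain e :: 'a where e: "norm e = 1"
        and ge: "ennreal g \<le> (\<integral>\<^sup>+x. indicator (A - ?B) x * section_length e (?B - A) x \<partial>lborel)"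
    proof -
      have "A - ?B \<in> sets borel" "?B - A \<in> sets borel" "A - ?B \<subseteq> ball 0 R" "?B - A \<subseteq> ball 0 R"
        using AR BR by (simp_all, blast+)
      from G[OF this \<open>\<delta> \<le> measure lborel (A - ?B)\<close> \<open>\<delta> \<le> measure lborel (?B - A)\<close>] show ?thesis
        using that by blast
    qed
    have SR: "steiner e A \<inter> ?B \<subseteq> ball 0 R" using BR by auto
    have "ennreal (2 * R * measure lborel (A \<inter> ?B) + g)
        = ennreal (2 * R) * emeasure lborel (A \<inter> ?B) + ennreal g"
    proof -
      have "emeasure lborel (A \<inter> ?B) = ennreal (measure lborel (A \<inter> ?B))"
        by (rule fin[of _ R]) (rule le_infI1[OF AR], simp)
      then show ?thesis using R g by (simp only:) (simp add: ennreal_plus ennreal_mult)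
    qed
    also have "\<dots> \<le> ennreal (2 * R) * emeasure lborel (steiner e A \<inter> ?B)"
      by (rule order_trans[OF add_left_mono[OF ge] steiner_overlap_gain[OF e R rho A AR]])
    also have "\<dots> = ennreal (2 * R * measure lborel (steiner e A \<inter> ?B))"
      using fin[OF SR] R by (simp add: ennreal_mult)
    finally have "2 * R * measure lborel (A \<inter> ?B) + g \<le> 2 * R * measure lborel (steiner e A \<inter> ?B)"
      using R by (subst (asm) ennreal_le_iff) auto
    then have "measure lborel (A \<inter> ?B) + g / (2 * R) \<le> measure lborel (steiner e A \<inter> ?B)"
      using R by (simp add: field_simps)
    with e show "\<exists>e. norm e = 1 \<and> measure lborel (A \<inter> ?B) + g / (2 * R) \<le> measure lborel (steiner e A \<inter> ?B)"
      by (intro exI[of _ e] conjI)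
  qed
qed

lemma steiner_overlap_mono:
  fixes e :: "'a::euclidean_space"
  assumes e: "norm e = 1" and R: "0 < R" and rho: "0 < \<rho>" "\<rho> \<le> R"
    and A: "A \<in> sets borel" and AR: "A \<subseteq> ball 0 R"
  shows "measure lborel (A \<inter> ball 0 \<rho>) \<le> measure lborel (steiner e A \<inter> ball 0 \<rho>)"
proof -
  let ?B = "ball (0::'a) \<rho>"
  have BR: "?B \<subseteq> ball 0 R" using rho by (intro subset_ball)
  have "ennreal (2 * R) * emeasure lborel (A \<inter> ?B) \<le> ennreal (2 * R) * emeasure lborel (steiner e A \<inter> ?B)"
    using steiner_overlap_gain[OF e R rho A AR] by (meson le_iff_add order_trans)
  moreover have "emeasure lborel (A \<inter> ?B) = ennreal (measure lborel (A \<inter> ?B))"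
    "emeasure lborel (steiner e A \<inter> ?B) = ennreal (measure lborel (steiner e A \<inter> ?B))"
    using A BR by (auto intro!: emeasure_bounded_eq_measure[of _ R])
  ultimately show ?thesis
    using R by (simp flip: ennreal_mult add: ennreal_le_iff)
qed

text \<open>The class \<open>\<G>\<close> of admissible tuples is closed under simultaneous Steiner symmetrization. If the supremum
over \<open>\<G>\<close> of the total overlap \<open>\<Phi>\<close> with the balls were less than the total volume \<open>M\<close> of the balls,
then in a nearly optimal tuple some overlap would fall short by a fixed amount \<open>\<delta>\<close>, and one
symmetrization would exceed the supremum. So there are tuples in \<open>\<G>\<close> arbitrarily close to the balls.\<close>

theorem rearrangement_bounded_sets:
  fixes E :: "('i \<Rightarrow> 'a::euclidean_space) set"
  assumes I: "finite I" and E: "E \<in> sets (PiM I (\<lambda>_. lborel))"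
    and conv: "\<And>x y t. x \<in> E \<Longrightarrow> y \<in> E \<Longrightarrow> 0 \<le> t \<Longrightarrow> t \<le> 1 \<Longrightarrow> (\<lambda>i\<in>I. (1 - t) *\<^sub>R x i + t *\<^sub>R y i) \<in> E"
    and refl: "\<And>e x. norm e = 1 \<Longrightarrow> x \<in> E \<Longrightarrow> (\<lambda>i\<in>I. x i - (2 * (x i \<bullet> e)) *\<^sub>R e) \<in> E"
    and R: "0 < R" and A: "\<And>i. i \<in> I \<Longrightarrow> A i \<in> sets borel" "\<And>i. i \<in> I \<Longrightarrow> A i \<subseteq> ball 0 R"
    and rho: "\<And>i. i \<in> I \<Longrightarrow> 0 < \<rho> i" "\<And>i. i \<in> I \<Longrightarrow> \<rho> i \<le> R"
    and vol: "\<And>i. i \<in> I \<Longrightarrow> measure lborel (A i) = measure lborel (ball (0::'a) (\<rho> i))"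
  shows "emeasure (PiM I (\<lambda>_. lborel)) (E \<inter> PiE I A) \<le> emeasure (PiM I (\<lambda>_. lborel)) (E \<inter> PiE I (\<lambda>i. ball 0 (\<rho> i)))"
proof -
  let ?P = "PiM I (\<lambda>_. lborel :: 'a measure)"
  define B where "B i = ball (0::'a) (\<rho> i)" for i
  define v where "v i = measure lborel (B i)" for i
  define \<G> where "\<G> = {A'. (\<forall>i\<in>I. A' i \<in> sets borel \<and> A' i \<subseteq> ball 0 R \<and> measure lborel (A' i) = v i)
    \<and> emeasure ?P (E \<inter> PiE I A) \<le> emeasure ?P (E \<inter> PiE I A')}"
  define \<Phi> where "\<Phi> A' = (\<Sum>i\<in>I. measure lborel (A' i \<inter> B i))" for A' :: "'i \<Rightarrow> 'a set"
  define M where "M = (\<Sum>i\<in>I. v i)"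
  have BR: "B i \<subseteq> ball 0 R" if "i \<in> I" for i unfolding B_def using rho that by (intro subset_ball) auto
  have Bm [measurable]: "B i \<in> sets borel" for i by (simp add: B_def)
  note fin = emeasure_bounded_eq_measure
  have overlap_le: "measure lborel (A' i \<inter> B i) \<le> v i" if "A' \<in> \<G>" "i \<in> I" for A' i
    unfolding v_def using fin[OF BR[OF that(2)]] that by (intro measure_mono_fmeasurable) (auto simp: \<G>_def fmeasurable_def)
  have AG: "A \<in> \<G>" using A vol by (auto simp: \<G>_def v_def B_def)
  have bdd: "bdd_above (\<Phi> ` \<G>)"
    using overlap_le by (intro bdd_aboveI[of _ M]) (auto simp: \<Phi>_def M_def intro: sum_mono)
  define s where "s = Sup (\<Phi> ` \<G>)"
  have Ms: "M \<le> s"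
  proof (rule ccontr)
    assume "\<not> M \<le> s"
    then have sM: "s < M" by simp
    have Phi_le: "\<Phi> A' \<le> s" if "A' \<in> \<G>" for A' unfolding s_def using bdd that by (intro cSup_upper) auto
    have "I \<noteq> {}"
    proof
      assume "I = {}"
      then have "M = \<Phi> A" by (simp add: M_def \<Phi>_def)
      with Phi_le[OF AG] sM show False by simp
    qed
    define \<delta> where "\<delta> = (M - s) / card I"
    have cI: "0 < card I" using \<open>I \<noteq> {}\<close> I by (simp add: card_gt_0_iff)
    have d: "0 < \<delta>" using sM cI by (simp add: \<delta>_def)
    from steiner_uniform_gain[OF R d, where 'a = 'a]
    obtain g where g: "0 < g" and G': "\<forall>(A::'a set) \<rho>. A \<in> sets borel \<longrightarrow> A \<subseteq> ball 0 R \<longrightarrow> 0 < \<rho> \<longrightarrow> \<rho> \<le> R \<longrightarrow>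
        measure lborel A = measure lborel (ball (0::'a) \<rho>) \<longrightarrow>
        \<delta> \<le> measure lborel (ball (0::'a) \<rho>) - measure lborel (A \<inter> ball 0 \<rho>) \<longrightarrow>
        (\<exists>e. norm e = 1 \<and> measure lborel (A \<inter> ball 0 \<rho>) + g \<le> measure lborel (steiner e A \<inter> ball 0 \<rho>))"
      by (elim exE conjE)
    note G = G'[rule_format]
    have "s - g < Sup (\<Phi> ` \<G>)" using g by (simp add: s_def)
    then obtain A' where A': "A' \<in> \<G>" "s - g < \<Phi> A'"
      using less_cSup_iff[OF _ bdd] AG by auto
    have A'p: "A' i \<in> sets borel" "A' i \<subseteq> ball 0 R" "measure lborel (A' i) = v i" if "i \<in> I" for i
      using A'(1) that by (auto simp: \<G>_def)
    have "\<exists>i\<in>I. \<delta> \<le> v i - measure lborel (A' i \<inter> B i)"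
    proof (rule ccontr)
      assume "\<not> ?thesis"
      then have "(\<Sum>i\<in>I. v i - measure lborel (A' i \<inter> B i)) < (\<Sum>i\<in>I. \<delta>)"
        using I \<open>I \<noteq> {}\<close> by (intro sum_strict_mono) auto
      also have "\<dots> = M - s" using cI by (simp add: \<delta>_def)
      finally show False using Phi_le[OF A'(1)] by (simp add: sum_subtractf M_def \<Phi>_def)
    qed
    then obtain i0 where i0: "i0 \<in> I" "\<delta> \<le> v i0 - measure lborel (A' i0 \<inter> B i0)" by auto
    obtain e where e: "norm e = 1" and ge: "measure lborel (A' i0 \<inter> B i0) + g \<le> measure lborel (steiner e (A' i0) \<inter> B i0)"
      using G[of "A' i0" "\<rho> i0", OF A'p(1,2)[OF i0(1)] rho[OF i0(1)]
          A'p(3)[OF i0(1), unfolded v_def B_def] i0(2)[unfolded v_def B_def], folded B_def]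
      by (elim exE conjE)
    define A'' where "A'' i = steiner e (A' i)" for i
    have "A'' \<in> \<G>"
    proof -
      have "emeasure ?P (E \<inter> PiE I A) \<le> emeasure ?P (E \<inter> PiE I A')" using A'(1) by (simp add: \<G>_def)
      also have "\<dots> \<le> emeasure ?P (E \<inter> PiE I A'')"
        unfolding A''_def
      proof (rule steiner_increases[OF I e E conv refl[OF e]])
        show "section_length e (A' i) y < \<top>" if "i \<in> I" for i y
          using section_length_subset_ball[OF e R A'p(2)[OF that], of y] by (rule order.strict_trans1) simp
      qed (use A'p in auto)
      finally show ?thesis
        using A'p steiner_subset_ball[OF e R A'p(2)] e
        by (simp add: \<G>_def A''_def measure_def emeasure_steiner)
    qed
    moreover have "\<Phi> A' + g \<le> \<Phi> A''"
    proof -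
      have "\<Phi> A' + g = (\<Sum>i\<in>I. measure lborel (A' i \<inter> B i) + (if i = i0 then g else 0))"
        using I i0 by (simp add: \<Phi>_def sum.distrib)
      also have "\<dots> \<le> \<Phi> A''"
        unfolding \<Phi>_def A''_def
        using ge steiner_overlap_mono[OF e R rho A'p(1,2)] by (intro sum_mono) (auto simp: B_def)
      finally show ?thesis .
    qed
    ultimately show False using Phi_le[of A''] A'(2) by linarith
  qed
  show ?thesis
  proof (rule ennreal_le_of_scaled_epsilon)
    let ?K = "\<Sum>i\<in>I. \<Prod>j\<in>I - {i}. ennreal (v j)"
    show "?K < \<top>"
    proof -
      have "?K = ennreal (\<Sum>i\<in>I. \<Prod>j\<in>I - {i}. v j)"
        by (simp add: prod_ennreal sum_ennreal prod_nonneg v_def)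
      then show ?thesis by simp
    qed
    fix \<epsilon> :: real assume eps: "0 < \<epsilon>" "\<epsilon> \<le> 1"
    have "M - \<epsilon> < Sup (\<Phi> ` \<G>)" using Ms eps by (simp add: s_def)
    then obtain A' where A': "A' \<in> \<G>" "M - \<epsilon> < \<Phi> A'"
      using less_cSup_iff[OF _ bdd] AG by auto
    have A'p: "A' i \<in> sets borel" "A' i \<subseteq> ball 0 R" "measure lborel (A' i) = v i" if "i \<in> I" for i
      using A'(1) that by (auto simp: \<G>_def)
    have small: "emeasure lborel (A' i - B i) \<le> ennreal \<epsilon>" if i: "i \<in> I" for i
    proof -
      have "v i - measure lborel (A' i \<inter> B i) \<le> (\<Sum>i\<in>I. v i - measure lborel (A' i \<inter> B i))"
        using overlap_le[OF A'(1)] i I by (intro member_le_sum) auto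
      also have "\<dots> \<le> \<epsilon>" using A'(2) by (simp add: sum_subtractf M_def \<Phi>_def)
      finally have le: "v i - measure lborel (A' i \<inter> B i) \<le> \<epsilon>" .
      have "measure lborel (A' i - (A' i \<inter> B i)) = measure lborel (A' i) - measure lborel (A' i \<inter> B i)"
        using fin[OF A'p(2,1)[OF i]] A'p(1)[OF i] by (intro measure_Diff) auto
      then have "measure lborel (A' i - B i) \<le> \<epsilon>" using le A'p(3)[OF i] by (simp add: Diff_Int)
      moreover have "emeasure lborel (A' i - B i) = ennreal (measure lborel (A' i - B i))"
        using A'p[OF i] by (intro fin[of _ R]) auto
      ultimately show ?thesis by (simp add: ennreal_leI)
    qed
    have "emeasure ?P (E \<inter> PiE I A) \<le> emeasure ?P (E \<inter> PiE I A')" using A'(1) by (simp add: \<G>_def)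
    also have "\<dots> \<le> emeasure ?P (E \<inter> PiE I B) + (\<Sum>i\<in>I. emeasure lborel (A' i - B i) * (\<Prod>j\<in>I - {i}. emeasure lborel (A' j)))"
      using A'p by (intro emeasure_PiE_le_of_diff I E) auto
    also have "\<dots> \<le> emeasure ?P (E \<inter> PiE I B) + ennreal \<epsilon> * ?K"
    proof -
      have "emeasure lborel (A' j) \<le> ennreal (v j)" if "j \<in> I" for j
        using fin[OF A'p(2,1)[OF that]] A'p(3)[OF that] by simp
      then show ?thesis
        unfolding sum_distrib_left
        using small by (intro add_left_mono sum_mono mult_mono prod_mono_ennreal) auto
    qed
    finally show "emeasure ?P (E \<inter> PiE I A) \<le> emeasure ?P (E \<inter> PiE I (\<lambda>i. ball 0 (\<rho> i))) + ennreal \<epsilon> * ?K"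
      unfolding B_def .
  qed
qed

section \<open>Rearrangement of sets of finite volume\<close>

definition vol_radius :: "'a::euclidean_space set \<Rightarrow> real" where
  "vol_radius A = root DIM('a) (measure lborel A / unit_ball_vol (real DIM('a)))"

lemma vol_radius_nonneg: "0 \<le> vol_radius A"
  by (simp add: vol_radius_def)

lemma emeasure_ball_vol_radius:
  fixes A :: "'a::euclidean_space set"
  assumes "emeasure lborel A < \<top>"
  shows "emeasure lborel (ball (0::'a) (vol_radius A)) = emeasure lborel A"
proof -
  have "vol_radius A ^ DIM('a) = measure lborel A / unit_ball_vol (real DIM('a))"
    unfolding vol_radius_def by (rule real_root_pow_pos2) simp_all
  moreover have "unit_ball_vol (real DIM('a)) \<noteq> 0"
  proof -
    have "0 < unit_ball_vol (real DIM('a))" by simp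
    then show ?thesis by (rule less_imp_neq[symmetric])
  qed
  ultimately have "unit_ball_vol (real DIM('a)) * vol_radius A ^ DIM('a) = measure lborel A"
    by simp
  then have "emeasure lborel (ball (0::'a) (vol_radius A)) = ennreal (measure lborel A)"
    by (simp only: emeasure_ball[OF vol_radius_nonneg])
  then show ?thesis using assms by (simp add: emeasure_eq_ennreal_measure)
qed

lemma radius_le_of_ball_volume_le:
  fixes r s :: real
  assumes "0 \<le> r" "0 \<le> s" "emeasure lborel (ball (0::'a::euclidean_space) r) \<le> emeasure lborel (ball (0::'a) s)"
  shows "r \<le> s"
proof -
  have "unit_ball_vol (real DIM('a)) * r ^ DIM('a) \<le> unit_ball_vol (real DIM('a)) * s ^ DIM('a)"
    using assms by (simp add: emeasure_ball ennreal_le_iff)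
  then have "r ^ DIM('a) \<le> s ^ DIM('a)"
    using unit_ball_vol_pos[of "real DIM('a)"] by (simp add: mult_le_cancel_left)
  then show ?thesis using assms(1,2) by (simp add: power_mono_iff)
qed

theorem rearrangement_sets:
  fixes E :: "('i \<Rightarrow> 'a::euclidean_space) set"
  assumes I: "finite I" and E: "E \<in> sets (PiM I (\<lambda>_. lborel))"
    and conv: "\<And>x y t. x \<in> E \<Longrightarrow> y \<in> E \<Longrightarrow> 0 \<le> t \<Longrightarrow> t \<le> 1 \<Longrightarrow> (\<lambda>i\<in>I. (1 - t) *\<^sub>R x i + t *\<^sub>R y i) \<in> E"
    and refl: "\<And>e x. norm e = 1 \<Longrightarrow> x \<in> E \<Longrightarrow> (\<lambda>i\<in>I. x i - (2 * (x i \<bullet> e)) *\<^sub>R e) \<in> E"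
    and A: "\<And>i. i \<in> I \<Longrightarrow> A i \<in> sets borel" "\<And>i. i \<in> I \<Longrightarrow> emeasure lborel (A i) < \<top>"
  shows "emeasure (PiM I (\<lambda>_. lborel)) (E \<inter> PiE I A)
    \<le> emeasure (PiM I (\<lambda>_. lborel)) (E \<inter> PiE I (\<lambda>i. ball 0 (vol_radius (A i))))"
proof -
  let ?P = "PiM I (\<lambda>_. lborel :: 'a measure)"
  define V where "V k i = A i \<inter> ball 0 (real (Suc k))" for k i
  have U: "(\<Union>k. V k i) = A i" for i
  proof -
    have "x \<in> (\<Union>k. ball 0 (real (Suc k)))" for x :: 'a
    proof -
      obtain n where "norm x < real n" using reals_Archimedean2 by blast
      then have "x \<in> ball 0 (real (Suc n))" by simp
      then show ?thesis by blast
    qed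
    then show ?thesis by (auto simp: V_def)
  qed
  have Vm: "V k i \<in> sets borel" if "i \<in> I" for k i using A(1)[OF that] by (simp add: V_def)
  have Vf: "emeasure lborel (V k i) \<le> emeasure lborel (A i)" if "i \<in> I" for k i
    using A(1)[OF that] by (intro emeasure_mono) (auto simp: V_def)
  have "PiE I A = PiE I (\<lambda>i. \<Union>k. V k i)" by (simp add: U)
  then have "emeasure ?P (E \<inter> PiE I A) = (SUP k. emeasure ?P (E \<inter> PiE I (V k)))"
    using emeasure_PiE_incseq_SUP[OF I E, of V] Vm by (simp add: V_def incseq_def subset_iff)
  also have "\<dots> \<le> emeasure ?P (E \<inter> PiE I (\<lambda>i. ball 0 (vol_radius (A i))))"
  proof (rule SUP_least)
    fix k
    have fk: "emeasure lborel (V k i) < \<top>" if "i \<in> I" for i using Vf[OF that] A(2)[OF that] by (rule le_less_trans)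
    show "emeasure ?P (E \<inter> PiE I (V k)) \<le> emeasure ?P (E \<inter> PiE I (\<lambda>i. ball 0 (vol_radius (A i))))"
    proof (cases "\<exists>i\<in>I. vol_radius (V k i) = 0")
      case True
      then obtain i where i: "i \<in> I" "vol_radius (V k i) = 0" by auto
      then have "emeasure lborel (V k i) = 0" using emeasure_ball_vol_radius[OF fk[OF i(1)]] by simp
      then have "emeasure ?P (PiE I (V k)) = 0"
        using i I Vm by (subst emeasure_PiM_lborel) auto
      moreover have "emeasure ?P (E \<inter> PiE I (V k)) \<le> emeasure ?P (PiE I (V k))"
        using Vm I by (intro emeasure_mono sets_PiM_I_finite) auto
      ultimately show ?thesis by simp
    next
      case False
      then have pos: "0 < vol_radius (V k i)" if "i \<in> I" for i
        using vol_radius_nonneg[of "V k i"] that by (auto simp: less_le)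
      have "emeasure ?P (E \<inter> PiE I (V k)) \<le> emeasure ?P (E \<inter> PiE I (\<lambda>i. ball 0 (vol_radius (V k i))))"
      proof (rule rearrangement_bounded_sets[OF I E conv refl, where R = "real (Suc k)"])
        show "0 < real (Suc k)" by simp
        fix i assume i: "i \<in> I"
        show "V k i \<in> sets borel" "0 < vol_radius (V k i)" by (rule Vm[OF i] pos[OF i])+
        show "V k i \<subseteq> ball 0 (real (Suc k))" unfolding V_def by (rule Int_lower2)
        show "measure lborel (V k i) = measure lborel (ball (0::'a) (vol_radius (V k i)))"
          using emeasure_ball_vol_radius[OF fk[OF i]] by (simp add: measure_def)
        show "vol_radius (V k i) \<le> real (Suc k)"
        proof (rule radius_le_of_ball_volume_le)
          have "emeasure lborel (V k i) \<le> emeasure lborel (ball (0::'a) (real (Suc k)))"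
            by (intro emeasure_mono) (auto simp: V_def)
          then show "emeasure lborel (ball (0::'a) (vol_radius (V k i))) \<le> emeasure lborel (ball (0::'a) (real (Suc k)))"
            by (simp only: emeasure_ball_vol_radius[OF fk[OF i]])
        qed (simp_all add: vol_radius_nonneg)
      qed
      also have "\<dots> \<le> emeasure ?P (E \<inter> PiE I (\<lambda>i. ball 0 (vol_radius (A i))))"
      proof (intro emeasure_PiE_mono I E subset_ball)
        fix i assume i: "i \<in> I"
        show "vol_radius (V k i) \<le> vol_radius (A i)"
        proof (rule radius_le_of_ball_volume_le[where 'a = 'a])
          show "emeasure lborel (ball (0::'a) (vol_radius (V k i))) \<le> emeasure lborel (ball (0::'a) (vol_radius (A i)))"
            by (simp only: emeasure_ball_vol_radius[OF fk[OF i]] emeasure_ball_vol_radius[OF A(2)[OF i]] Vf[OF i])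
        qed (rule vol_radius_nonneg)+
      qed simp
      finally show ?thesis .
    qed
  qed
  finally show ?thesis .
qed

section \<open>The bathtub principle\<close>

text \<open>The volume of the slice depends continuously on the radius, as its increments are bounded by those of
the volume of the ball.\<close>

lemma ball_slice_of_measure:
  fixes D :: "'a::euclidean_space set"
  assumes D [measurable]: "D \<in> sets borel" and DR: "D \<subseteq> ball 0 R" and m: "0 \<le> m" "m \<le> measure lborel D"
  shows "\<exists>\<rho>. measure lborel (D \<inter> ball 0 \<rho>) = m"
proof -
  define \<phi> where "\<phi> \<rho> = measure lborel (D \<inter> ball 0 \<rho>)" for \<rho>
  define \<psi> where "\<psi> \<rho> = unit_ball_vol (real DIM('a)) * \<rho> ^ DIM('a)" for \<rho>
  have psi: "measure lborel (ball (0::'a) \<rho>) = \<psi> \<rho>" if "0 \<le> \<rho>" for \<rho>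
    using that by (simp add: \<psi>_def content_ball)
  have diff: "\<phi> \<rho> \<le> \<phi> \<sigma>" "\<phi> \<sigma> - \<phi> \<rho> \<le> \<psi> \<sigma> - \<psi> \<rho>" if rs: "0 \<le> \<rho>" "\<rho> \<le> \<sigma>" for \<rho> \<sigma>
  proof -
    have sub: "ball (0::'a) \<rho> \<subseteq> ball 0 \<sigma>" using rs by (intro subset_ball)
    have fin: "S \<in> sets borel \<Longrightarrow> S \<subseteq> ball 0 \<sigma> \<Longrightarrow> emeasure lborel S \<noteq> \<top>" for S :: "'a set"
      using emeasure_bounded_eq_measure[of S \<sigma>] by simp
    show "\<phi> \<rho> \<le> \<phi> \<sigma>"
      unfolding \<phi>_def using sub fin[of "D \<inter> ball 0 \<sigma>"] by (intro measure_mono_fmeasurable) (auto simp: fmeasurable_def less_top)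
    have "\<phi> \<sigma> - \<phi> \<rho> = measure lborel ((D \<inter> ball 0 \<sigma>) - (D \<inter> ball 0 \<rho>))"
      unfolding \<phi>_def using sub fin by (intro measure_Diff[symmetric]) auto
    also have "\<dots> \<le> measure lborel (ball (0::'a) \<sigma> - ball 0 \<rho>)"
      using fin[of "ball 0 \<sigma> - ball 0 \<rho>"] by (intro measure_mono_fmeasurable) (auto simp: fmeasurable_def less_top)
    also have "\<dots> = \<psi> \<sigma> - \<psi> \<rho>"
      using sub fin rs by (subst measure_Diff) (auto simp: psi)
    finally show "\<phi> \<sigma> - \<phi> \<rho> \<le> \<psi> \<sigma> - \<psi> \<rho>" .
  qed
  have cont_psi: "continuous_on {0..max 0 R} \<psi>"
    unfolding \<psi>_def by (intro continuous_intros)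
  have "continuous_on {0..max 0 R} \<phi>"
  proof (rule continuous_on_iff[THEN iffD2], intro ballI allI impI)
    fix x e :: real assume x: "x \<in> {0..max 0 R}" and "0 < e"
    then obtain d where d: "0 < d" "\<And>y. y \<in> {0..max 0 R} \<Longrightarrow> dist y x < d \<Longrightarrow> dist (\<psi> y) (\<psi> x) < e"
      using cont_psi unfolding continuous_on_iff by blast
    have "dist (\<phi> y) (\<phi> x) < e" if y: "y \<in> {0..max 0 R}" "dist y x < d" for y
    proof -
      have "\<bar>\<phi> y - \<phi> x\<bar> \<le> \<bar>\<psi> y - \<psi> x\<bar>"
        using diff[of x y] diff[of y x] x y(1) by (cases "x \<le> y") auto
      then show ?thesis using d(2)[OF y] by (simp add: dist_real_def)
    qed
    then show "\<exists>d>0. \<forall>y\<in>{0..max 0 R}. dist y x < d \<longrightarrow> dist (\<phi> y) (\<phi> x) < e" using d(1) by blast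
  qed
  moreover have "\<phi> 0 \<le> m" using m by (simp add: \<phi>_def)
  moreover have "m \<le> \<phi> (max 0 R)"
  proof -
    have "D \<inter> ball 0 (max 0 R) = D" using DR by auto
    then show ?thesis using m by (simp only: \<phi>_def)
  qed
  ultimately obtain \<rho> where "\<phi> \<rho> = m"
    using IVT'[of \<phi> 0 m "max 0 R"] by auto
  then show ?thesis by (auto simp: \<phi>_def)
qed

text \<open>Among all functions with values between \<open>0\<close> and \<open>a\<close> and a given integral, the integral against \<open>F\<close> is
largest for one that takes the value \<open>a\<close> where \<open>F\<close> exceeds some level \<open>s0\<close> and vanishes where \<open>F\<close> is
below it. Cutting the level set \<open>{F = s0}\<close> by a ball of suitable radius provides an indicator function
with exactly the right integral. The bounded set \<open>B\<close> ensures that the maximum is attained.\<close>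

lemma bathtub:
  fixes F f :: "'a::euclidean_space \<Rightarrow> real"
  assumes [measurable]: "F \<in> borel_measurable borel" "f \<in> borel_measurable borel" "B \<in> sets borel"
    and BR: "B \<subseteq> ball 0 R" and F: "\<And>x. 0 \<le> F x" "\<And>x. F x \<le> c"
    and f: "\<And>x. 0 \<le> f x" "\<And>x. x \<notin> B \<Longrightarrow> f x = 0" "AE x in lborel. f x \<le> a" and a: "0 < a"
  shows "\<exists>A. A \<in> sets borel \<and> ennreal a * emeasure lborel A = (\<integral>\<^sup>+x. ennreal (f x) \<partial>lborel)
    \<and> (\<integral>\<^sup>+x. ennreal (f x) * ennreal (F x) \<partial>lborel) \<le> (\<integral>\<^sup>+x. ennreal a * indicator A x * ennreal (F x) \<partial>lborel)"
proof -
  have fin: "S \<in> sets borel \<Longrightarrow> S \<subseteq> B \<Longrightarrow> emeasure lborel S = ennreal (measure lborel S)" for S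
    using emeasure_bounded_eq_measure[of S R] BR by auto
  have fin': "S \<in> sets borel \<Longrightarrow> S \<subseteq> B \<Longrightarrow> emeasure lborel S \<noteq> \<top>" for S
    using fin[of S] by simp
  have int_le: "(\<integral>\<^sup>+x. ennreal (f x) \<partial>lborel) \<le> ennreal (a * measure lborel B)"
  proof -
    have "(\<integral>\<^sup>+x. ennreal (f x) \<partial>lborel) \<le> (\<integral>\<^sup>+x. ennreal a * indicator B x \<partial>lborel)"
      using f(3) by (intro nn_integral_mono_AE, eventually_elim) (auto simp: f(2) indicator_def ennreal_leI)
    also have "\<dots> = ennreal (a * measure lborel B)"
      using a fin[of B] by (simp add: nn_integral_cmult_indicator ennreal_mult')
    finally show ?thesis .
  qed
  then obtain \<nu> where nu: "(\<integral>\<^sup>+x. ennreal (f x) \<partial>lborel) = ennreal \<nu>" "0 \<le> \<nu>"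
    by (cases "\<integral>\<^sup>+x. ennreal (f x) \<partial>lborel") (auto simp: top_unique)
  (* The volume that the set A must have. *)
  define \<kappa> where "\<kappa> = \<nu> / a"
  have kappa: "0 \<le> \<kappa>" "\<kappa> \<le> measure lborel B" "\<nu> = a * \<kappa>"
    using int_le a nu by (auto simp: \<kappa>_def field_simps ennreal_le_iff)
  define \<mu> where "\<mu> s = measure lborel {x\<in>B. s < F x}" for s
  define S where "S = {s. 0 \<le> s \<and> \<mu> s \<le> \<kappa>}"
  have "{x\<in>B. max c 0 < F x} = {}" using F(2) by (auto simp: not_less le_max_iff_disj)
  then have "\<mu> (max c 0) = 0" by (simp only: \<mu>_def measure_empty)
  then have "max c 0 \<in> S" using kappa by (simp add: S_def)
  then have S: "S \<noteq> {}" by blast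
  have S_bdd: "bdd_below S" by (rule bdd_belowI[of _ 0]) (simp add: S_def)
  define s0 where "s0 = Inf S"
  have s0: "0 \<le> s0" unfolding s0_def using S by (intro cInf_greatest) (auto simp: S_def)
  have mu_mono: "\<mu> t \<le> \<mu> s" if "s \<le> t" for s t
    unfolding \<mu>_def using that fin'[of "{x\<in>B. s < F x}"]
    by (intro measure_mono_fmeasurable) (auto simp: fmeasurable_def less_top)
  have above: "\<mu> s \<le> \<kappa>" if "s0 < s" for s
  proof -
    obtain t where "t \<in> S" "t < s" using cInf_lessD[OF S] \<open>s0 < s\<close> unfolding s0_def by blast
    then show ?thesis using mu_mono[of t s] by (simp add: S_def)
  qed
  have below: "\<kappa> < \<mu> s" if "0 \<le> s" "s < s0" for s
  proof (rule ccontr)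
    assume "\<not> \<kappa> < \<mu> s"
    then have "s \<in> S" using that by (simp add: S_def)
    then have "s0 \<le> s" unfolding s0_def using S_bdd by (intro cInf_lower)
    with that show False by simp
  qed
  define G where "G = {x\<in>B. s0 < F x}"
  define D where "D = {x\<in>B. F x = s0}"
  have [measurable]: "G \<in> sets borel" "D \<in> sets borel" by (auto simp: G_def D_def)
  have G_le: "measure lborel G \<le> \<kappa>"
  proof -
    let ?G = "\<lambda>n::nat. {x\<in>B. s0 + 1 / real (Suc n) < F x}"
    have G_eq: "G = (\<Union>n. ?G n)"
    proof (intro equalityI subsetI)
      fix x assume x: "x \<in> G"
      then obtain n where "1 / real (Suc n) < F x - s0"
        using reals_Archimedean[of "F x - s0"] by (auto simp: G_def inverse_eq_divide)
      then show "x \<in> (\<Union>n. ?G n)" using x by (auto simp: G_def intro!: exI[of _ n])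
    next
      fix x assume "x \<in> (\<Union>n. ?G n)"
      then obtain n where "x \<in> B" "s0 + 1 / real (Suc n) < F x" by auto
      moreover have "0 < 1 / real (Suc n)" by simp
      ultimately have "s0 < F x" by linarith
      with \<open>x \<in> B\<close> show "x \<in> G" unfolding G_def by simp
    qed
    have lim: "(\<lambda>n. measure lborel (?G n)) \<longlonglongrightarrow> measure lborel (\<Union>n. ?G n)"
    proof (rule Lim_measure_incseq)
      show "incseq ?G"
      proof (rule incseq_SucI, rule subsetI)
        fix n x assume "x \<in> ?G n"
        then have "x \<in> B" "s0 + 1 / real (Suc n) < F x" by blast+
        moreover have "1 / real (Suc (Suc n)) \<le> 1 / real (Suc n)" by (intro divide_left_mono) auto
        ultimately have "s0 + 1 / real (Suc (Suc n)) < F x" by linarith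
        with \<open>x \<in> B\<close> show "x \<in> ?G (Suc n)" by blast
      qed
      show "emeasure lborel (\<Union>n. ?G n) \<noteq> \<infinity>"
        using fin'[of "\<Union>n. ?G n"] by auto
    qed auto
    have "measure lborel (?G n) \<le> \<kappa>" for n
      using above[of "s0 + 1 / real (Suc n)"] by (simp add: \<mu>_def)
    then show ?thesis unfolding G_eq by (intro LIMSEQ_le_const2[OF lim] exI[of _ 0] allI impI)
  qed
  have GD_ge: "\<kappa> \<le> measure lborel (G \<union> D)"
  proof (cases "s0 = 0")
    case True
    then have "G \<union> D = B" using F(1) by (auto simp: G_def D_def less_le)
    then show ?thesis using kappa by simp
  next
    case False
    then have s0p: "0 < s0" using s0 by simp
    let ?G = "\<lambda>n::nat. {x\<in>B. s0 - s0 / real (Suc n) < F x}"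
    have GD_eq: "G \<union> D = (\<Inter>n. ?G n)"
    proof (intro equalityI subsetI)
      fix x assume x: "x \<in> G \<union> D"
      then have "x \<in> B" "s0 \<le> F x" by (auto simp: G_def D_def)
      have "x \<in> ?G n" for n
      proof -
        have "0 < s0 / real (Suc n)" using s0p by simp
        then have "s0 - s0 / real (Suc n) < F x" using \<open>s0 \<le> F x\<close> by linarith
        with \<open>x \<in> B\<close> show ?thesis by blast
      qed
      then show "x \<in> (\<Inter>n. ?G n)" by blast
    next
      fix x assume x: "x \<in> (\<Inter>n. ?G n)"
      have "s0 \<le> F x"
      proof (rule ccontr)
        assume "\<not> s0 \<le> F x"
        then have "0 < (s0 - F x) / s0" using s0p by simp
        then obtain n where "1 / real (Suc n) < (s0 - F x) / s0"
          using reals_Archimedean by (auto simp: inverse_eq_divide)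
        then have "s0 * (1 / real (Suc n)) < s0 * ((s0 - F x) / s0)"
          by (rule mult_strict_left_mono[OF _ s0p])
        also have "\<dots> = s0 - F x" using s0p by simp
        finally have "s0 * (1 / real (Suc n)) < s0 - F x" .
        moreover have "s0 - s0 / real (Suc n) < F x" using x by blast
        ultimately show False by (simp only: times_divide_eq_right mult_1_right)
      qed
      then show "x \<in> G \<union> D" using x by (auto simp: G_def D_def)
    qed
    have lim: "(\<lambda>n. measure lborel (?G n)) \<longlonglongrightarrow> measure lborel (\<Inter>n. ?G n)"
    proof (rule Lim_measure_decseq)
      show "decseq ?G"
      proof (rule decseq_SucI, rule subsetI)
        fix n x assume "x \<in> ?G (Suc n)"
        then have "x \<in> B" "s0 - s0 / real (Suc (Suc n)) < F x" by blast+
        moreover have "s0 / real (Suc (Suc n)) \<le> s0 / real (Suc n)" using s0p by (intro divide_left_mono) auto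
        ultimately have "s0 - s0 / real (Suc n) < F x" by linarith
        with \<open>x \<in> B\<close> show "x \<in> ?G n" by blast
      qed
      show "emeasure lborel (?G n) \<noteq> \<infinity>" for n
        using fin'[of "?G n"] by auto
    qed auto
    have "\<kappa> \<le> measure lborel (?G n)" for n
    proof -
      have "s0 / real (Suc n) \<le> s0" "0 < s0 / real (Suc n)" using s0p by (auto simp: divide_le_eq)
      then have "\<kappa> < \<mu> (s0 - s0 / real (Suc n))" by (intro below) linarith+
      then show ?thesis by (simp add: \<mu>_def)
    qed
    then show ?thesis unfolding GD_eq by (intro LIMSEQ_le_const[OF lim] exI[of _ 0] allI impI)
  qed
  have disj: "measure lborel (G \<union> D') = measure lborel G + measure lborel D'" if "D' \<subseteq> D" "D' \<in> sets borel" for D'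
  proof (rule measure_Union)
    show "G \<in> sets lborel" "D' \<in> sets lborel" using that by simp_all
    show "emeasure lborel G \<noteq> \<infinity>" "emeasure lborel D' \<noteq> \<infinity>"
      using fin'[of G] fin'[of D'] that by (auto simp: G_def D_def)
    show "G \<inter> D' = {}" using that by (auto simp: G_def D_def)
  qed
  have "D \<subseteq> ball 0 R" using BR by (auto simp: D_def)
  then obtain \<rho> where rho: "measure lborel (D \<inter> ball 0 \<rho>) = \<kappa> - measure lborel G"
    using ball_slice_of_measure[of D R "\<kappa> - measure lborel G"] G_le GD_ge disj[of D] by auto
  define A where "A = G \<union> (D \<inter> ball 0 \<rho>)"
  have Am [measurable]: "A \<in> sets borel" by (simp add: A_def)
  have "measure lborel A = \<kappa>" using disj[of "D \<inter> ball 0 \<rho>"] rho by (simp add: A_def)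
  moreover have "A \<subseteq> B" by (auto simp: A_def G_def D_def)
  ultimately have A: "emeasure lborel A = ennreal \<kappa>" using fin[of A] by simp
  have aA: "ennreal a * emeasure lborel A = ennreal \<nu>"
    using A a kappa by (simp add: ennreal_mult)
  have "(\<integral>\<^sup>+x. ennreal (f x) * ennreal (F x) \<partial>lborel) + ennreal (s0 * \<nu>)
      = (\<integral>\<^sup>+x. ennreal (f x) * ennreal (F x) + ennreal s0 * (ennreal a * indicator A x) \<partial>lborel)"
    using aA s0 nu by (simp add: nn_integral_add nn_integral_cmult ennreal_mult)
  also have "\<dots> \<le> (\<integral>\<^sup>+x. ennreal a * indicator A x * ennreal (F x) + ennreal s0 * ennreal (f x) \<partial>lborel)"
  proof (intro nn_integral_mono_AE)
    show "AE x in lborel. ennreal (f x) * ennreal (F x) + ennreal s0 * (ennreal a * indicator A x)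
        \<le> ennreal a * indicator A x * ennreal (F x) + ennreal s0 * ennreal (f x)"
      using f(3)
    proof eventually_elim
      case (elim x)
      (* This is (F - s0) f \<le> (F - s0) a 1_A without subtraction. *)
      have "f x * F x + s0 * (a * indicator A x) \<le> a * indicator A x * F x + s0 * f x"
      proof (cases "x \<in> A")
        case True
        then have "s0 \<le> F x" by (auto simp: A_def G_def D_def)
        then have "0 \<le> (F x - s0) * (a - f x)" using elim by simp
        then show ?thesis using True by (simp add: algebra_simps)
      next
        case False
        then have "f x * F x \<le> s0 * f x"
        proof (cases "x \<in> B")
          case True
          then have "F x \<le> s0" using False by (auto simp: A_def G_def)
          then show ?thesis using f(1)[of x] by (simp add: mult.commute mult_right_mono)
        qed (simp add: f(2))
        then show ?thesis using False by simp
      qed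
      then have "ennreal (f x * F x + s0 * (a * indicator A x)) \<le> ennreal (a * indicator A x * F x + s0 * f x)"
        by (rule ennreal_leI)
      moreover have ind: "ennreal (indicator A x) = indicator A x" by (auto simp: indicator_def)
      ultimately show ?case
        using f(1)[of x] F(1)[of x] s0 a
        by (simp add: ennreal_plus ennreal_mult ind del: ennreal_indicator)
    qed
  qed
  also have "\<dots> = (\<integral>\<^sup>+x. ennreal a * indicator A x * ennreal (F x) \<partial>lborel) + ennreal (s0 * \<nu>)"
    using s0 nu by (simp add: nn_integral_add nn_integral_cmult ennreal_mult)
  finally have "(\<integral>\<^sup>+x. ennreal (f x) * ennreal (F x) \<partial>lborel) \<le> (\<integral>\<^sup>+x. ennreal a * indicator A x * ennreal (F x) \<partial>lborel)"
    by (simp add: ennreal_add_left_cancel_le add.commute)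
  then show ?thesis using aA nu by (intro exI[of _ A]) simp
qed

section \<open>Rearrangement of functions\<close>

lemma prod_indicator_eq_PiE:
  assumes "finite I" "x \<in> PiE I (\<lambda>_. UNIV)"
  shows "(\<Prod>i\<in>I. indicator (A i) (x i)) = (indicator (PiE I A) x :: ennreal)"
proof (cases "\<forall>i\<in>I. x i \<in> A i")
  case True
  then have "x \<in> PiE I A" using assms by (auto simp: PiE_def)
  then show ?thesis using True by simp
next
  case False
  then have "x \<notin> PiE I A" by (auto simp: PiE_def)
  moreover have "(\<Prod>i\<in>I. indicator (A i) (x i)) = (0::ennreal)"
    using False assms(1) by (auto intro!: prod_zero bexI)
  ultimately show ?thesis by simp
qed

text \<open>Each factor is a superposition of indicators of its level sets \<open>L i s\<close>. The product of the \<open>N\<close> layer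
integrals is one integral over tuples \<open>S\<close> of levels, which is interchanged with the integral over \<open>x\<close>.\<close>

lemma layer_cake_PiM:
  fixes L :: "'i \<Rightarrow> real \<Rightarrow> 'a::euclidean_space set"
  assumes I: "finite I" and E [measurable]: "E \<in> sets (PiM I (\<lambda>_. lborel))"
    and L: "\<And>i. i \<in> I \<Longrightarrow> {(x, s). x \<in> L i s} \<in> sets (borel \<Otimes>\<^sub>M borel)"
  shows "(\<integral>\<^sup>+x. indicator E x * (\<Prod>i\<in>I. \<integral>\<^sup>+s. indicator {0<..} s * indicator (L i s) (x i) \<partial>lborel) \<partial>PiM I (\<lambda>_. lborel))
    = (\<integral>\<^sup>+S. (\<Prod>i\<in>I. indicator {0<..} (S i)) * emeasure (PiM I (\<lambda>_. lborel)) (E \<inter> PiE I (\<lambda>i. L i (S i))) \<partial>PiM I (\<lambda>_. lborel))"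
proof -
  let ?P = "PiM I (\<lambda>_. lborel :: 'a measure)" and ?R = "PiM I (\<lambda>_. lborel :: real measure)"
  interpret R: product_sigma_finite "\<lambda>_. lborel :: real measure" by (rule product_sigma_finite_lborel)
  interpret P: product_sigma_finite "\<lambda>_. lborel :: 'a measure" by (rule product_sigma_finite_lborel)
  interpret pair_sigma_finite ?P ?R
    by (intro pair_sigma_finite.intro R.sigma_finite P.sigma_finite I)
  have L_ind: "(\<lambda>p. indicator (L i (snd p)) (fst p) :: ennreal) \<in> borel_measurable (borel \<Otimes>\<^sub>M borel)" if "i \<in> I" for i
  proof -
    have "(\<lambda>p. indicator {(x, s). x \<in> L i s} p :: ennreal) \<in> borel_measurable (borel \<Otimes>\<^sub>M borel)"
      using L[OF that] by simp
    moreover have "(\<lambda>p. indicator {(x, s). x \<in> L i s} p :: ennreal) = (\<lambda>p. indicator (L i (snd p)) (fst p))"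
      by (auto simp: fun_eq_iff indicator_def)
    ultimately show ?thesis by simp
  qed
  have Li1: "(\<lambda>s. indicator (L i s) x :: ennreal) \<in> borel_measurable borel" if "i \<in> I" for i x
    using measurable_compose[OF measurable_Pair1'[of x borel borel] L_ind[OF that]] by simp
  have Li2: "L i s \<in> sets borel" if "i \<in> I" for i s
  proof -
    have "(\<lambda>x. indicator (L i s) x :: ennreal) \<in> borel_measurable borel"
      using measurable_compose[OF measurable_Pair2'[of s borel borel] L_ind[OF that]] by simp
    then show ?thesis by (simp add: borel_measurable_indicator_iff)
  qed
  have Lp [measurable]: "(\<lambda>p. indicator (L i (snd p i)) (fst p i) :: ennreal) \<in> borel_measurable (?P \<Otimes>\<^sub>M ?R)" if "i \<in> I" for i
  proof -
    have "(\<lambda>p. (fst p i, snd p i)) \<in> ?P \<Otimes>\<^sub>M ?R \<rightarrow>\<^sub>M borel \<Otimes>\<^sub>M borel"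
      using that by measurable
    from measurable_compose[OF this L_ind[OF that]] show ?thesis by simp
  qed
  have "(\<integral>\<^sup>+x. indicator E x * (\<Prod>i\<in>I. \<integral>\<^sup>+s. indicator {0<..} s * indicator (L i s) (x i) \<partial>lborel) \<partial>?P)
      = (\<integral>\<^sup>+x. indicator E x * (\<integral>\<^sup>+S. (\<Prod>i\<in>I. indicator {0<..} (S i) * indicator (L i (S i)) (x i)) \<partial>?R) \<partial>?P)"
    by (subst R.product_nn_integral_prod[OF I]) (use Li1 in auto)
  also have "\<dots> = (\<integral>\<^sup>+x. \<integral>\<^sup>+S. indicator E x * (\<Prod>i\<in>I. indicator {0<..} (S i) * indicator (L i (S i)) (x i)) \<partial>?R \<partial>?P)"
  proof (rule nn_integral_cong)
    fix x :: "'i \<Rightarrow> 'a"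
    have "(\<lambda>S. indicator {0<..} (S i) * indicator (L i (S i)) (x i) :: ennreal) \<in> borel_measurable ?R" if "i \<in> I" for i
    proof -
      have [measurable]: "(\<lambda>S. S i) \<in> ?R \<rightarrow>\<^sub>M borel" using that by measurable
      note [measurable] = measurable_compose[OF \<open>(\<lambda>S. S i) \<in> ?R \<rightarrow>\<^sub>M borel\<close> Li1[OF that, of "x i"]]
      show ?thesis by measurable
    qed
    then show "indicator E x * (\<integral>\<^sup>+S. (\<Prod>i\<in>I. indicator {0<..} (S i) * indicator (L i (S i)) (x i)) \<partial>?R)
        = (\<integral>\<^sup>+S. indicator E x * (\<Prod>i\<in>I. indicator {0<..} (S i) * indicator (L i (S i)) (x i)) \<partial>?R)"
      by (intro nn_integral_cmult[symmetric] borel_measurable_prod_ennreal)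
  qed
  also have "\<dots> = (\<integral>\<^sup>+S. \<integral>\<^sup>+x. indicator E x * (\<Prod>i\<in>I. indicator {0<..} (S i) * indicator (L i (S i)) (x i)) \<partial>?P \<partial>?R)"
  proof (rule Fubini'[symmetric])
    have "(\<lambda>p. indicator E (fst p) * (\<Prod>i\<in>I. indicator {0<..} (snd p i) * indicator (L i (snd p i)) (fst p i)) :: ennreal) \<in> borel_measurable (?P \<Otimes>\<^sub>M ?R)"
      by (intro borel_measurable_times_ennreal borel_measurable_prod_ennreal Lp) measurable
    then show "(\<lambda>(x, S). indicator E x * (\<Prod>i\<in>I. indicator {0<..} (S i) * indicator (L i (S i)) (x i)) :: ennreal) \<in> borel_measurable (?P \<Otimes>\<^sub>M ?R)"
      by (simp add: case_prod_beta)
  qed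
  also have "\<dots> = (\<integral>\<^sup>+S. (\<Prod>i\<in>I. indicator {0<..} (S i)) * emeasure ?P (E \<inter> PiE I (\<lambda>i. L i (S i))) \<partial>?R)"
  proof (rule nn_integral_cong)
    fix S
    have m: "E \<inter> PiE I (\<lambda>i. L i (S i)) \<in> sets ?P"
      using Li2 I by (intro sets.Int sets_PiM_I_finite E) auto
    have "(\<integral>\<^sup>+x. indicator E x * (\<Prod>i\<in>I. indicator {0<..} (S i) * indicator (L i (S i)) (x i)) \<partial>?P)
        = (\<integral>\<^sup>+x. (\<Prod>i\<in>I. indicator {0<..} (S i)) * indicator (E \<inter> PiE I (\<lambda>i. L i (S i))) x \<partial>?P)"
    proof (rule nn_integral_cong)
      fix x assume "x \<in> space ?P"
      then have x: "x \<in> PiE I (\<lambda>_. UNIV)" by (simp add: space_PiM)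
      note prod_eq = prod_indicator_eq_PiE[OF I x]
      show "indicator E x * (\<Prod>i\<in>I. indicator {0<..} (S i) * indicator (L i (S i)) (x i))
          = (\<Prod>i\<in>I. indicator {0<..} (S i)) * (indicator (E \<inter> PiE I (\<lambda>i. L i (S i))) x :: ennreal)"
        unfolding prod.distrib prod_eq indicator_inter_arith by (rule mult.left_commute)
    qed
    also have "\<dots> = (\<Prod>i\<in>I. indicator {0<..} (S i)) * emeasure ?P (E \<inter> PiE I (\<lambda>i. L i (S i)))"
      by (rule nn_integral_cmult_indicator[OF m])
    finally show "(\<integral>\<^sup>+x. indicator E x * (\<Prod>i\<in>I. indicator {0<..} (S i) * indicator (L i (S i)) (x i)) \<partial>?P)
        = (\<Prod>i\<in>I. indicator {0<..} (S i)) * emeasure ?P (E \<inter> PiE I (\<lambda>i. L i (S i)))" .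
  qed
  finally show ?thesis .
qed

lemma superlevel_volume_measurable:
  assumes [measurable]: "f \<in> borel_measurable (borel :: 'a::euclidean_space measure)"
  shows "(\<lambda>s. emeasure lborel {y. s < (f y :: real)}) \<in> borel_measurable borel"
proof -
  have "(\<lambda>s. \<integral>\<^sup>+y. indicator {s. s < f y} s \<partial>lborel) \<in> borel_measurable borel"
    by measurable
  moreover have "(\<integral>\<^sup>+y. indicator {s. s < f y} s \<partial>lborel) = emeasure lborel {y. s < f y}" for s
  proof -
    have "(\<integral>\<^sup>+y. indicator {s. s < f y} s \<partial>lborel) = (\<integral>\<^sup>+y. indicator {y. s < f y} y \<partial>lborel)"
      by (intro nn_integral_cong) (simp add: indicator_def)
    also have "\<dots> = emeasure lborel {y. s < f y}" by (rule nn_integral_indicator) measurable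
    finally show ?thesis .
  qed
  ultimately show ?thesis by simp
qed

text \<open>The inequality for sets is applied to the superlevel sets at each tuple of levels. The levels are
restricted to positive numbers, where superlevel sets of integrable functions have finite volume.\<close>

theorem rearrangement_functions:
  fixes E :: "('i \<Rightarrow> 'a::euclidean_space) set" and f :: "'i \<Rightarrow> 'a \<Rightarrow> real"
  assumes I: "finite I" and E: "E \<in> sets (PiM I (\<lambda>_. lborel))"
    and conv: "\<And>x y t. x \<in> E \<Longrightarrow> y \<in> E \<Longrightarrow> 0 \<le> t \<Longrightarrow> t \<le> 1 \<Longrightarrow> (\<lambda>i\<in>I. (1 - t) *\<^sub>R x i + t *\<^sub>R y i) \<in> E"
    and refl: "\<And>e x. norm e = 1 \<Longrightarrow> x \<in> E \<Longrightarrow> (\<lambda>i\<in>I. x i - (2 * (x i \<bullet> e)) *\<^sub>R e) \<in> E"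
    and f: "\<And>i. i \<in> I \<Longrightarrow> f i \<in> borel_measurable borel" "\<And>i x. i \<in> I \<Longrightarrow> 0 \<le> f i x"
      "\<And>i s. i \<in> I \<Longrightarrow> 0 < s \<Longrightarrow> emeasure lborel {y. s < f i y} < \<top>"
  shows "(\<integral>\<^sup>+x. indicator E x * (\<Prod>i\<in>I. ennreal (f i (x i))) \<partial>PiM I (\<lambda>_. lborel))
    \<le> (\<integral>\<^sup>+x. indicator E x * (\<Prod>i\<in>I. \<integral>\<^sup>+s. indicator {0<..} s * indicator (ball 0 (vol_radius {y. s < f i y})) (x i) \<partial>lborel)
        \<partial>PiM I (\<lambda>_. lborel))"
proof -
  let ?P = "PiM I (\<lambda>_. lborel :: 'a measure)" and ?R = "PiM I (\<lambda>_. lborel :: real measure)"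
  have layer: "ennreal (f i x) = (\<integral>\<^sup>+s. indicator {0<..} s * indicator {y. s < f i y} x \<partial>lborel)" if "i \<in> I" for i x
  proof -
    have "(\<integral>\<^sup>+s. indicator {0<..} s * indicator {y. s < f i y} x \<partial>lborel) = (\<integral>\<^sup>+s. indicator {0<..<f i x} s \<partial>lborel)"
      by (intro nn_integral_cong) (auto simp: indicator_def)
    then show ?thesis using f(2)[OF that] by simp
  qed
  have L1: "{(x, s). x \<in> {y. s < f i y}} \<in> sets (borel \<Otimes>\<^sub>M borel)" if "i \<in> I" for i
  proof -
    note [measurable] = f(1)[OF that]
    have "{p \<in> space (borel \<Otimes>\<^sub>M borel). snd p < f i (fst p)} \<in> sets (borel \<Otimes>\<^sub>M borel)" by measurable
    then show ?thesis by (simp add: case_prod_beta' space_pair_measure)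
  qed
  have L2: "{(x, s). x \<in> ball (0::'a) (vol_radius {y. s < f i y})} \<in> sets (borel \<Otimes>\<^sub>M borel)" if "i \<in> I" for i
  proof -
    note [measurable] = superlevel_volume_measurable[OF f(1)[OF that]]
    have [measurable]: "root n \<in> borel_measurable borel" for n
      by (intro borel_measurable_continuous_onI continuous_intros)
    have [measurable]: "(\<lambda>s. vol_radius {y. s < f i y}) \<in> borel_measurable borel"
      unfolding vol_radius_def measure_def by measurable
    have "{p \<in> space (borel \<Otimes>\<^sub>M borel). norm (fst p) < vol_radius {y. snd p < f i y}} \<in> sets (borel \<Otimes>\<^sub>M borel :: ('a \<times> real) measure)" by measurable
    then show ?thesis by (simp add: case_prod_beta' space_pair_measure)
  qed
  have "(\<integral>\<^sup>+x. indicator E x * (\<Prod>i\<in>I. ennreal (f i (x i))) \<partial>?P)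
      = (\<integral>\<^sup>+x. indicator E x * (\<Prod>i\<in>I. \<integral>\<^sup>+s. indicator {0<..} s * indicator {y. s < f i y} (x i) \<partial>lborel) \<partial>?P)"
    by (simp add: layer)
  also have "\<dots> = (\<integral>\<^sup>+S. (\<Prod>i\<in>I. indicator {0<..} (S i)) * emeasure ?P (E \<inter> PiE I (\<lambda>i. {y. S i < f i y})) \<partial>?R)"
    by (rule layer_cake_PiM[OF I E L1])
  also have "\<dots> \<le> (\<integral>\<^sup>+S. (\<Prod>i\<in>I. indicator {0<..} (S i)) * emeasure ?P (E \<inter> PiE I (\<lambda>i. ball 0 (vol_radius {y. S i < f i y}))) \<partial>?R)"
  proof (rule nn_integral_mono)
    fix S :: "'i \<Rightarrow> real"
    show "(\<Prod>i\<in>I. indicator {0<..} (S i)) * emeasure ?P (E \<inter> PiE I (\<lambda>i. {y. S i < f i y}))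
      \<le> (\<Prod>i\<in>I. indicator {0<..} (S i)) * emeasure ?P (E \<inter> PiE I (\<lambda>i. ball 0 (vol_radius {y. S i < f i y})))"
    proof (cases "\<forall>i\<in>I. 0 < S i")
      case True
      have "{y. S i < f i y} \<in> sets borel" if "i \<in> I" for i
      proof -
        note [measurable] = f(1)[OF that]
        show ?thesis by measurable
      qed
      then show ?thesis
        using True f(3) by (intro mult_left_mono rearrangement_sets[OF I E conv refl]) auto
    next
      case False
      then have "(\<Prod>i\<in>I. indicator {0<..} (S i)) = (0::ennreal)"
        using I by (auto intro!: prod_zero bexI)
      then show ?thesis by (simp only: mult_zero_left order_refl)
    qed
  qed
  also have "\<dots> = (\<integral>\<^sup>+x. indicator E x * (\<Prod>i\<in>I. \<integral>\<^sup>+s. indicator {0<..} s * indicator (ball 0 (vol_radius {y. s < f i y})) (x i) \<partial>lborel) \<partial>?P)"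
    by (rule layer_cake_PiM[OF I E L2, symmetric])
  finally show ?thesis .
qed

section \<open>Bounded functions and uniform densities\<close>

lemma measurable_PiM_prod:
  fixes g :: "'i \<Rightarrow> 'a::euclidean_space \<Rightarrow> ennreal"
  assumes "\<And>i. i \<in> J \<Longrightarrow> g i \<in> borel_measurable borel" "J \<subseteq> I"
  shows "(\<lambda>x. \<Prod>i\<in>J. g i (x i)) \<in> borel_measurable (PiM I (\<lambda>_. lborel))"
proof (rule borel_measurable_prod_ennreal)
  fix i assume i: "i \<in> J"
  then have "i \<in> I" using assms(2) by blast
  from measurable_component_singleton[OF this, of "\<lambda>_. lborel :: 'a measure"]
  have "(\<lambda>x. x i) \<in> PiM I (\<lambda>_. lborel :: 'a measure) \<rightarrow>\<^sub>M borel"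
    by simp
  from measurable_compose[OF this assms(1)[OF i]]
  show "(\<lambda>x. g i (x i)) \<in> borel_measurable (PiM I (\<lambda>_. lborel))" .
qed

text \<open>As a function of the \<open>j\<close>-th factor alone, the integral is linear: it is the integral of this factor against a
bounded weight \<open>F\<close>, obtained by integrating out the other variables.\<close>

lemma marginal_weight:
  fixes E :: "('i \<Rightarrow> 'a::euclidean_space) set" and g :: "'i \<Rightarrow> 'a \<Rightarrow> ennreal"
  assumes I: "finite I" and j: "j \<in> I" and E: "E \<in> sets (PiM I (\<lambda>_. lborel))"
    and g: "\<And>i. i \<in> I \<Longrightarrow> g i \<in> borel_measurable borel"
  obtains F where "F \<in> borel_measurable borel" "\<And>y. F y \<le> (\<Prod>i\<in>I - {j}. \<integral>\<^sup>+x. g i x \<partial>lborel)"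
    "\<And>h. h \<in> borel_measurable borel \<Longrightarrow>
      (\<integral>\<^sup>+x. indicator E x * (\<Prod>i\<in>I. (g(j := h)) i (x i)) \<partial>PiM I (\<lambda>_. lborel)) = (\<integral>\<^sup>+y. h y * F y \<partial>lborel)"
proof -
  interpret product_sigma_finite "\<lambda>_. lborel :: 'a measure" by (rule product_sigma_finite_lborel)
  let ?Q = "PiM (I - {j}) (\<lambda>_. lborel :: 'a measure)"
  have ins: "insert j (I - {j}) = I" using j by auto
  have fin: "finite (I - {j})" "j \<notin> I - {j}" using I by auto
  define F where "F y = (\<integral>\<^sup>+x. indicator E (x(j := y)) * (\<Prod>i\<in>I - {j}. g i (x i)) \<partial>?Q)" for y
  have upd: "(\<lambda>p. (fst p)(j := snd p)) \<in> ?Q \<Otimes>\<^sub>M lborel \<rightarrow>\<^sub>M PiM I (\<lambda>_. lborel :: 'a measure)"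
    using measurable_add_dim[of j "I - {j}" "\<lambda>_. lborel :: 'a measure"] ins by (simp add: case_prod_beta')
  have upd': "(\<lambda>p. (snd p)(j := fst p)) \<in> lborel \<Otimes>\<^sub>M ?Q \<rightarrow>\<^sub>M PiM I (\<lambda>_. lborel :: 'a measure)"
    using measurable_compose[OF measurable_pair_swap' upd] by (simp add: case_prod_beta')
  have indE: "(\<lambda>p. indicator E ((snd p)(j := fst p)) :: ennreal) \<in> borel_measurable (lborel \<Otimes>\<^sub>M ?Q)"
    using measurable_compose[OF upd' borel_measurable_indicator[OF E]] .
  have gQ: "(\<lambda>x. \<Prod>i\<in>I - {j}. g i (x i)) \<in> borel_measurable ?Q"
    using g by (intro measurable_PiM_prod) auto
  interpret Q: sigma_finite_measure ?Q by (rule sigma_finite) (rule fin)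
  have indE1: "(\<lambda>x. indicator E (x(j := y)) :: ennreal) \<in> borel_measurable ?Q" for y
    using measurable_compose[OF measurable_Pair1'[of y lborel ?Q] indE] by simp
  have "(\<lambda>p. indicator E ((snd p)(j := fst p)) * (\<Prod>i\<in>I - {j}. g i (snd p i))) \<in> borel_measurable (lborel \<Otimes>\<^sub>M ?Q)"
    using measurable_compose[OF measurable_snd gQ] by (intro borel_measurable_times_ennreal indE)
  then have Fm: "F \<in> borel_measurable lborel"
    unfolding F_def by (intro Q.borel_measurable_nn_integral) (simp add: case_prod_beta')
  show ?thesis
  proof (rule that[of F])
    show "F \<in> borel_measurable borel" using Fm by simp
    show "F y \<le> (\<Prod>i\<in>I - {j}. \<integral>\<^sup>+x. g i x \<partial>lborel)" for y
    proof -
      have "F y \<le> (\<integral>\<^sup>+x. (\<Prod>i\<in>I - {j}. g i (x i)) \<partial>?Q)"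
        unfolding F_def by (intro nn_integral_mono) (auto simp: indicator_def)
      also have "\<dots> = (\<Prod>i\<in>I - {j}. \<integral>\<^sup>+x. g i x \<partial>lborel)"
        using g by (intro product_nn_integral_prod fin(1)) auto
      finally show ?thesis .
    qed
    fix h :: "'a \<Rightarrow> ennreal" assume h: "h \<in> borel_measurable borel"
    have gh: "(g(j := h)) i \<in> borel_measurable borel" if "i \<in> I" for i using g h that by simp
    have "(\<lambda>x. indicator E x * (\<Prod>i\<in>I. (g(j := h)) i (x i))) \<in> borel_measurable (PiM I (\<lambda>_. lborel))"
      using gh by (intro borel_measurable_times_ennreal borel_measurable_indicator E measurable_PiM_prod) auto
    then have "(\<integral>\<^sup>+x. indicator E x * (\<Prod>i\<in>I. (g(j := h)) i (x i)) \<partial>PiM I (\<lambda>_. lborel))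
        = (\<integral>\<^sup>+y. (\<integral>\<^sup>+x. indicator E (x(j := y)) * (\<Prod>i\<in>I. (g(j := h)) i ((x(j := y)) i)) \<partial>?Q) \<partial>lborel)"
      using product_nn_integral_insert_rev[OF fin, of "\<lambda>x. indicator E x * (\<Prod>i\<in>I. (g(j := h)) i (x i))"]
      unfolding ins by simp
    also have "\<dots> = (\<integral>\<^sup>+y. h y * F y \<partial>lborel)"
    proof (rule nn_integral_cong)
      fix y
      have "(\<Prod>i\<in>I. (g(j := h)) i ((x(j := y)) i)) = h y * (\<Prod>i\<in>I - {j}. g i (x i))" for x
        using I j by (subst prod.remove[of _ j]) (auto intro!: arg_cong2[where f = "(*)"] prod.cong)
      then have "(\<integral>\<^sup>+x. indicator E (x(j := y)) * (\<Prod>i\<in>I. (g(j := h)) i ((x(j := y)) i)) \<partial>?Q)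
          = (\<integral>\<^sup>+x. h y * (indicator E (x(j := y)) * (\<Prod>i\<in>I - {j}. g i (x i))) \<partial>?Q)"
        by (simp only: mult.left_commute)
      also have "\<dots> = h y * F y"
        unfolding F_def by (intro nn_integral_cmult borel_measurable_times_ennreal indE1 gQ)
      finally show "(\<integral>\<^sup>+x. indicator E (x(j := y)) * (\<Prod>i\<in>I. (g(j := h)) i ((x(j := y)) i)) \<partial>?Q) = h y * F y" .
    qed
    finally show "(\<integral>\<^sup>+x. indicator E x * (\<Prod>i\<in>I. (g(j := h)) i (x i)) \<partial>PiM I (\<lambda>_. lborel)) = (\<integral>\<^sup>+y. h y * F y \<partial>lborel)" .
  qed
qed

text \<open>By \<open>marginal_weight\<close> and the bathtub principle, one factor after the other is replaced, by induction over
the set \<open>J\<close> of factors already replaced. The remaining factors have integral at most one throughout,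
which keeps the weights bounded.\<close>

lemma replace_by_indicators:
  fixes E :: "('i \<Rightarrow> 'a::euclidean_space) set" and f :: "'i \<Rightarrow> 'a \<Rightarrow> real"
  assumes I: "finite I" and E: "E \<in> sets (PiM I (\<lambda>_. lborel))"
    and f: "\<And>i. i \<in> I \<Longrightarrow> f i \<in> borel_measurable borel" "\<And>i x. i \<in> I \<Longrightarrow> 0 \<le> f i x"
      "\<And>i. i \<in> I \<Longrightarrow> (\<integral>\<^sup>+x. ennreal (f i x) \<partial>lborel) \<le> 1"
      "\<And>i x. i \<in> I \<Longrightarrow> x \<notin> ball 0 R \<Longrightarrow> f i x = 0"
      "\<And>i. i \<in> I \<Longrightarrow> AE x in lborel. f i x \<le> a i"
    and a: "\<And>i. i \<in> I \<Longrightarrow> 0 < a i"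
  shows "\<exists>A. (\<forall>i\<in>I. A i \<in> sets borel \<and> ennreal (a i) * emeasure lborel (A i) \<le> 1) \<and>
    (\<integral>\<^sup>+x. indicator E x * (\<Prod>i\<in>I. ennreal (f i (x i))) \<partial>PiM I (\<lambda>_. lborel))
      \<le> (\<integral>\<^sup>+x. indicator E x * (\<Prod>i\<in>I. ennreal (a i) * indicator (A i) (x i)) \<partial>PiM I (\<lambda>_. lborel))"
proof -
  define K where "K g = (\<integral>\<^sup>+x. indicator E x * (\<Prod>i\<in>I. g i (x i)) \<partial>PiM I (\<lambda>_. lborel))" for g :: "'i \<Rightarrow> 'a \<Rightarrow> ennreal"
  define G where "G J A = (\<lambda>i x. if i \<in> J then ennreal (a i) * indicator (A i) x else ennreal (f i x))"
    for J and A :: "'i \<Rightarrow> 'a set"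
  have "\<exists>A. (\<forall>i\<in>J. A i \<in> sets borel \<and> ennreal (a i) * emeasure lborel (A i) \<le> 1) \<and> K (G {} A) \<le> K (G J A)"
    if "J \<subseteq> I" "finite J" for J
    using that(2,1)
  proof (induction J rule: finite_induct)
    case empty
    then show ?case by auto
  next
    case (insert j J)
    then obtain A where A: "\<forall>i\<in>J. A i \<in> sets borel \<and> ennreal (a i) * emeasure lborel (A i) \<le> 1"
        and le: "K (G {} A) \<le> K (G J A)" by auto
    have j: "j \<in> I" using insert.prems by simp
    have Gm: "G J A i \<in> borel_measurable borel" if "i \<in> I" for i
    proof (cases "i \<in> J")
      case True
      then have [measurable]: "A i \<in> sets borel" using A by simp
      show ?thesis using True by (simp add: G_def)
    next
      case False
      have [measurable]: "f i \<in> borel_measurable borel" by (rule f(1)[OF that])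
      show ?thesis using False by (simp add: G_def)
    qed
    have G1: "(\<integral>\<^sup>+x. G J A i x \<partial>lborel) \<le> 1" if "i \<in> I" for i
      using A f(3)[OF that] by (cases "i \<in> J") (simp_all add: G_def nn_integral_cmult_indicator)
    obtain F where F: "F \<in> borel_measurable borel" "\<And>y. F y \<le> (\<Prod>i\<in>I - {j}. \<integral>\<^sup>+x. G J A i x \<partial>lborel)"
      and FK: "\<And>h. h \<in> borel_measurable borel \<Longrightarrow> K ((G J A)(j := h)) = (\<integral>\<^sup>+y. h y * F y \<partial>lborel)"
      by (rule marginal_weight[OF I j E Gm], assumption, rule that) (simp_all only: K_def)
    have F1: "F y \<le> 1" for y
    proof -
      have "(\<Prod>i\<in>I - {j}. \<integral>\<^sup>+x. G J A i x \<partial>lborel) \<le> (\<Prod>i\<in>I - {j}. 1)"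
        using G1 by (intro prod_mono_ennreal) auto
      then show ?thesis using F(2)[of y] by simp
    qed
    define F' where "F' y = enn2real (F y)" for y
    have F': "F y = ennreal (F' y)" for y
      unfolding F'_def by (rule ennreal_enn2real[symmetric]) (rule le_less_trans[OF F1], simp)
    have F'b: "0 \<le> F' y" "F' y \<le> 1" for y
      using F1[of y] by (simp_all add: F'_def enn2real_leI)
    have [measurable]: "F' \<in> borel_measurable borel" unfolding F'_def using F(1) by measurable
    have ball_meas: "ball (0::'a) R \<in> sets borel" by simp
    have "\<exists>A. A \<in> sets borel \<and> ennreal (a j) * emeasure lborel A = (\<integral>\<^sup>+x. ennreal (f j x) \<partial>lborel) \<and>
        (\<integral>\<^sup>+x. ennreal (f j x) * ennreal (F' x) \<partial>lborel) \<le> (\<integral>\<^sup>+x. ennreal (a j) * indicator A x * ennreal (F' x) \<partial>lborel)"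
      by (rule bathtub[OF \<open>F' \<in> borel_measurable borel\<close> f(1)[OF j] ball_meas order_refl F'b f(2)[OF j] _ f(5)[OF j] a[OF j]])
        (rule f(4)[OF j])
    then obtain Aj where Aj: "Aj \<in> sets borel" "ennreal (a j) * emeasure lborel Aj = (\<integral>\<^sup>+x. ennreal (f j x) \<partial>lborel)"
        "(\<integral>\<^sup>+x. ennreal (f j x) * ennreal (F' x) \<partial>lborel) \<le> (\<integral>\<^sup>+x. ennreal (a j) * indicator Aj x * ennreal (F' x) \<partial>lborel)"
      by (elim exE conjE)
    define A' where "A' = A(j := Aj)"
    have [measurable]: "f j \<in> borel_measurable borel" "Aj \<in> sets borel" using f(1)[OF j] Aj(1) by auto
    have G_old: "G J A = (G J A)(j := \<lambda>x. ennreal (f j x))"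
      using insert.hyps by (auto simp: G_def fun_eq_iff)
    have G_new: "G (insert j J) A' = (G J A)(j := \<lambda>x. ennreal (a j) * indicator Aj x)"
      using insert.hyps by (auto simp: G_def fun_eq_iff A'_def)
    have "K (G J A) = K ((G J A)(j := \<lambda>x. ennreal (f j x)))" using G_old by simp
    also have "\<dots> = (\<integral>\<^sup>+y. ennreal (f j y) * F y \<partial>lborel)" by (rule FK) measurable
    also have "\<dots> \<le> (\<integral>\<^sup>+y. ennreal (a j) * indicator Aj y * F y \<partial>lborel)" using Aj(3) by (simp only: F')
    also have "\<dots> = K ((G J A)(j := \<lambda>x. ennreal (a j) * indicator Aj x))" by (rule FK[symmetric]) measurable
    also have "\<dots> = K (G (insert j J) A')" by (simp only: G_new)
    finally have "K (G J A) \<le> K (G (insert j J) A')" .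
    then have "K (G {} A) \<le> K (G (insert j J) A')" by (rule order_trans[OF le])
    moreover have "G {} A' = G {} A" by (simp add: G_def)
    ultimately have "K (G {} A') \<le> K (G (insert j J) A')" by (simp only:)
    moreover have "\<forall>i\<in>insert j J. A' i \<in> sets borel \<and> ennreal (a i) * emeasure lborel (A' i) \<le> 1"
      using A Aj(1,2) f(3)[OF j] by (auto simp: A'_def)
    ultimately show ?case by blast
  qed
  from this[OF subset_refl I] obtain A where A: "\<forall>i\<in>I. A i \<in> sets borel \<and> ennreal (a i) * emeasure lborel (A i) \<le> 1"
      and le: "K (G {} A) \<le> K (G I A)" by blast
  have "K (G {} A) = (\<integral>\<^sup>+x. indicator E x * (\<Prod>i\<in>I. ennreal (f i (x i))) \<partial>PiM I (\<lambda>_. lborel))"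
    by (simp add: K_def G_def)
  moreover have "K (G I A) = (\<integral>\<^sup>+x. indicator E x * (\<Prod>i\<in>I. ennreal (a i) * indicator (A i) (x i)) \<partial>PiM I (\<lambda>_. lborel))"
    by (simp add: K_def G_def)
  ultimately show ?thesis using A le by (intro exI[of _ A]) simp
qed

lemma nn_integral_PiM_exhaust_balls:
  fixes h :: "('i \<Rightarrow> 'a::euclidean_space) \<Rightarrow> ennreal"
  assumes I: "finite I" and h: "h \<in> borel_measurable (PiM I (\<lambda>_. lborel))"
  shows "(\<integral>\<^sup>+x. h x \<partial>PiM I (\<lambda>_. lborel))
    = (SUP k. \<integral>\<^sup>+x. h x * indicator (PiE I (\<lambda>_. ball 0 (real k))) x \<partial>PiM I (\<lambda>_. lborel))"
proof -
  let ?P = "PiM I (\<lambda>_. lborel :: 'a measure)"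
  define S where "S k = PiE I (\<lambda>_. ball (0::'a) (real k))" for k :: nat
  have S: "S k \<in> sets ?P" for k unfolding S_def using I by (intro sets_PiM_I_finite) auto
  have inc: "incseq (\<lambda>k. ball (0::'a) (real k))" by (auto simp: incseq_def)
  have U: "(\<Union>k. S k) = space ?P"
  proof -
    have "(\<Union>k. ball (0::'a) (real k)) = UNIV"
      using reals_Archimedean2 by auto
    then show ?thesis
      using PiE_UN_incseq(1)[OF I, of "\<lambda>k _. ball (0::'a) (real k)"] inc by (simp add: S_def space_PiM)
  qed
  have "(\<integral>\<^sup>+x. h x \<partial>?P) = emeasure (density ?P h) (space ?P)"
    using h by (simp add: emeasure_density cong: nn_integral_cong)
  also have "\<dots> = (SUP k. emeasure (density ?P h) (S k))"
    unfolding U[symmetric] using S PiE_UN_incseq(2)[OF I, of "\<lambda>k _. ball (0::'a) (real k)"] inc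
    by (intro SUP_emeasure_incseq[symmetric]) (auto simp: S_def)
  also have "\<dots> = (SUP k. \<integral>\<^sup>+x. h x * indicator (S k) x \<partial>?P)"
    using h S by (simp add: emeasure_density)
  finally show ?thesis by (simp add: S_def)
qed

text \<open>After replacement by indicators, \<open>rearrangement_sets\<close> gives centred balls of volume at most \<open>1 / a i\<close>. Since
the bathtub principle needs bounded supports, this is done for the functions cut off outside a ball, whose
radius then tends to infinity.\<close>

theorem rearrangement_bounded_functions:
  fixes E :: "('i \<Rightarrow> 'a::euclidean_space) set" and f :: "'i \<Rightarrow> 'a \<Rightarrow> real"
  assumes I: "finite I" and E: "E \<in> sets (PiM I (\<lambda>_. lborel))"
    and conv: "\<And>x y t. x \<in> E \<Longrightarrow> y \<in> E \<Longrightarrow> 0 \<le> t \<Longrightarrow> t \<le> 1 \<Longrightarrow> (\<lambda>i\<in>I. (1 - t) *\<^sub>R x i + t *\<^sub>R y i) \<in> E"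
    and refl: "\<And>e x. norm e = 1 \<Longrightarrow> x \<in> E \<Longrightarrow> (\<lambda>i\<in>I. x i - (2 * (x i \<bullet> e)) *\<^sub>R e) \<in> E"
    and f: "\<And>i. i \<in> I \<Longrightarrow> f i \<in> borel_measurable borel" "\<And>i x. i \<in> I \<Longrightarrow> 0 \<le> f i x"
      "\<And>i. i \<in> I \<Longrightarrow> (\<integral>\<^sup>+x. ennreal (f i x) \<partial>lborel) \<le> 1"
      "\<And>i. i \<in> I \<Longrightarrow> AE x in lborel. f i x \<le> a i"
    and a: "\<And>i. i \<in> I \<Longrightarrow> 0 < a i"
    and b: "\<And>i. i \<in> I \<Longrightarrow> 0 \<le> b i" "\<And>i. i \<in> I \<Longrightarrow> ennreal (a i) * emeasure lborel (ball (0::'a) (b i)) = 1"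
  shows "(\<integral>\<^sup>+x. indicator E x * (\<Prod>i\<in>I. ennreal (f i (x i))) \<partial>PiM I (\<lambda>_. lborel))
    \<le> (\<integral>\<^sup>+x. indicator E x * (\<Prod>i\<in>I. ennreal (a i) * indicator (ball 0 (b i)) (x i)) \<partial>PiM I (\<lambda>_. lborel))"
proof -
  let ?P = "PiM I (\<lambda>_. lborel :: 'a measure)"
  have boxes: "(\<integral>\<^sup>+x. indicator E x * (\<Prod>i\<in>I. ennreal (a i) * indicator (A i) (x i)) \<partial>?P)
      = (\<Prod>i\<in>I. ennreal (a i)) * emeasure ?P (E \<inter> PiE I A)" if A: "\<And>i. i \<in> I \<Longrightarrow> A i \<in> sets borel" for A
  proof -
    have "(\<integral>\<^sup>+x. indicator E x * (\<Prod>i\<in>I. ennreal (a i) * indicator (A i) (x i)) \<partial>?P)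
        = (\<integral>\<^sup>+x. (\<Prod>i\<in>I. ennreal (a i)) * indicator (E \<inter> PiE I A) x \<partial>?P)"
    proof (rule nn_integral_cong)
      fix x assume "x \<in> space ?P"
      then have "x \<in> PiE I (\<lambda>_. UNIV)" by (simp add: space_PiM)
      note eq = prod_indicator_eq_PiE[OF I this, of A]
      show "indicator E x * (\<Prod>i\<in>I. ennreal (a i) * indicator (A i) (x i)) = (\<Prod>i\<in>I. ennreal (a i)) * indicator (E \<inter> PiE I A) x"
        unfolding prod.distrib eq indicator_inter_arith by (rule mult.left_commute)
    qed
    also have "\<dots> = (\<Prod>i\<in>I. ennreal (a i)) * emeasure ?P (E \<inter> PiE I A)"
      using A I E by (intro nn_integral_cmult_indicator sets.Int sets_PiM_I_finite) auto
    finally show ?thesis .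
  qed
  have h: "(\<lambda>x. indicator E x * (\<Prod>i\<in>I. ennreal (f i (x i)))) \<in> borel_measurable ?P"
  proof (intro borel_measurable_times_ennreal borel_measurable_indicator E measurable_PiM_prod subset_refl)
    fix i assume i: "i \<in> I"
    note [measurable] = f(1)[OF i]
    show "(\<lambda>x. ennreal (f i x)) \<in> borel_measurable borel" by measurable
  qed
  show ?thesis
    unfolding nn_integral_PiM_exhaust_balls[OF I h]
  proof (rule SUP_least)
    fix k :: nat
    define f' where "f' i x = f i x * indicator (ball 0 (real k)) x" for i x
    have f'_le: "f' i x \<le> f i x" if "i \<in> I" for i x using f(2)[OF that] by (auto simp: f'_def indicator_def)
    have trunc: "(\<integral>\<^sup>+x. indicator E x * (\<Prod>i\<in>I. ennreal (f i (x i))) * indicator (PiE I (\<lambda>_. ball 0 (real k))) x \<partial>?P)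
        = (\<integral>\<^sup>+x. indicator E x * (\<Prod>i\<in>I. ennreal (f' i (x i))) \<partial>?P)"
    proof (rule nn_integral_cong)
      fix x assume "x \<in> space ?P"
      then have "x \<in> PiE I (\<lambda>_. UNIV)" by (simp add: space_PiM)
      note eq = prod_indicator_eq_PiE[OF I this, of "\<lambda>_. ball 0 (real k)"]
      have "ennreal (f' i (x i)) = ennreal (f i (x i)) * indicator (ball 0 (real k)) (x i)" for i
        by (auto simp: f'_def indicator_def)
      then show "indicator E x * (\<Prod>i\<in>I. ennreal (f i (x i))) * indicator (PiE I (\<lambda>_. ball 0 (real k))) x
          = indicator E x * (\<Prod>i\<in>I. ennreal (f' i (x i)))"
        by (simp only: prod.distrib eq mult.assoc)
    qed
    have "\<exists>A. (\<forall>i\<in>I. A i \<in> sets borel \<and> ennreal (a i) * emeasure lborel (A i) \<le> 1) \<and>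
        (\<integral>\<^sup>+x. indicator E x * (\<Prod>i\<in>I. ennreal (f' i (x i))) \<partial>?P)
        \<le> (\<integral>\<^sup>+x. indicator E x * (\<Prod>i\<in>I. ennreal (a i) * indicator (A i) (x i)) \<partial>?P)"
    proof (rule replace_by_indicators[OF I E _ _ _ _ _ a, where R = "real k"])
      fix i assume i: "i \<in> I"
      note [measurable] = f(1)[OF i]
      have [measurable]: "ball (0::'a) (real k) \<in> sets borel" by simp
      show "f' i \<in> borel_measurable borel" unfolding f'_def by measurable
      show "0 \<le> f' i x" for x using f(2)[OF i] by (simp add: f'_def)
      show "f' i x = 0" if "x \<notin> ball 0 (real k)" for x using that by (simp add: f'_def)
      have "(\<integral>\<^sup>+x. ennreal (f' i x) \<partial>lborel) \<le> (\<integral>\<^sup>+x. ennreal (f i x) \<partial>lborel)"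
        by (intro nn_integral_mono ennreal_leI f'_le i)
      then show "(\<integral>\<^sup>+x. ennreal (f' i x) \<partial>lborel) \<le> 1" using f(3)[OF i] by (rule order_trans)
      show "AE x in lborel. f' i x \<le> a i"
        using f(4)[OF i] by eventually_elim (rule order_trans[OF f'_le[OF i]])
    qed
    then obtain A where A: "\<And>i. i \<in> I \<Longrightarrow> A i \<in> sets borel" "\<And>i. i \<in> I \<Longrightarrow> ennreal (a i) * emeasure lborel (A i) \<le> 1"
      and le: "(\<integral>\<^sup>+x. indicator E x * (\<Prod>i\<in>I. ennreal (f' i (x i))) \<partial>?P)
        \<le> (\<integral>\<^sup>+x. indicator E x * (\<Prod>i\<in>I. ennreal (a i) * indicator (A i) (x i)) \<partial>?P)"
      by blast
    have vol: "emeasure lborel (A i) \<le> emeasure lborel (ball (0::'a) (b i))" if i: "i \<in> I" for i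
    proof -
      have "ennreal (a i) * emeasure lborel (A i) \<le> ennreal (a i) * emeasure lborel (ball (0::'a) (b i))"
        using A(2)[OF i] b(2)[OF i] by simp
      then show ?thesis
        using a[OF i] by (subst (asm) ennreal_mult_le_mult_iff) auto
    qed
    have fin: "emeasure lborel (A i) < \<top>" if i: "i \<in> I" for i
      by (rule le_less_trans[OF vol[OF i]]) (simp add: emeasure_ball[OF b(1)[OF i]])
    note le
    also have "(\<integral>\<^sup>+x. indicator E x * (\<Prod>i\<in>I. ennreal (a i) * indicator (A i) (x i)) \<partial>?P)
        = (\<Prod>i\<in>I. ennreal (a i)) * emeasure ?P (E \<inter> PiE I A)"
      by (rule boxes[OF A(1)])
    also have "\<dots> \<le> (\<Prod>i\<in>I. ennreal (a i)) * emeasure ?P (E \<inter> PiE I (\<lambda>i. ball 0 (vol_radius (A i))))"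
      by (intro mult_left_mono rearrangement_sets[OF I E conv refl A(1) fin]) auto
    also have "\<dots> \<le> (\<Prod>i\<in>I. ennreal (a i)) * emeasure ?P (E \<inter> PiE I (\<lambda>i. ball 0 (b i)))"
    proof (intro mult_left_mono emeasure_PiE_mono I E subset_ball)
      fix i assume i: "i \<in> I"
      show "vol_radius (A i) \<le> b i"
      proof (rule radius_le_of_ball_volume_le[where 'a = 'a])
        show "emeasure lborel (ball (0::'a) (vol_radius (A i))) \<le> emeasure lborel (ball (0::'a) (b i))"
          by (simp only: emeasure_ball_vol_radius[OF fin[OF i]] vol[OF i])
      qed (rule vol_radius_nonneg b(1)[OF i])+
    qed simp_all
    also have "\<dots> = (\<integral>\<^sup>+x. indicator E x * (\<Prod>i\<in>I. ennreal (a i) * indicator (ball 0 (b i)) (x i)) \<partial>?P)"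
      by (rule boxes[symmetric]) simp
    finally show "(\<integral>\<^sup>+x. indicator E x * (\<Prod>i\<in>I. ennreal (f i (x i))) * indicator (PiE I (\<lambda>_. ball 0 (real k))) x \<partial>?P)
      \<le> (\<integral>\<^sup>+x. indicator E x * (\<Prod>i\<in>I. ennreal (a i) * indicator (ball 0 (b i)) (x i)) \<partial>?P)"
      unfolding trunc .
  qed
qed

section \<open>Symmetric convex sets up to null sets\<close>

text \<open>Points of the finite product are functions on the whole index type, and \<open>C\<close> depends only on their values
on \<open>I\<close>. In this form sums and multiples can be taken pointwise and open sets are those of the product
topology, while the product measure lives on the functions that are undefined outside \<open>I\<close>.\<close>

locale symmetric_convex_cylinder =
  fixes I :: "'i::countable set" and C :: "('i \<Rightarrow> 'a::euclidean_space) set"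
  assumes finite_I: "finite I"
    and cylinder: "x \<in> C \<Longrightarrow> (\<And>i. i \<in> I \<Longrightarrow> y i = x i) \<Longrightarrow> y \<in> C"
    and convex: "x \<in> C \<Longrightarrow> y \<in> C \<Longrightarrow> 0 \<le> t \<Longrightarrow> t \<le> 1 \<Longrightarrow> (\<lambda>i. (1 - t) *\<^sub>R x i + t *\<^sub>R y i) \<in> C"
    and symmetric: "x \<in> C \<Longrightarrow> (\<lambda>i. - x i) \<in> C"
    and nonempty: "C \<noteq> {}"
begin

text \<open>The multiple \<open>s C\<close>, again as a cylinder over \<open>I\<close>; this includes the case \<open>s = 0\<close>.\<close>

definition dilate :: "real \<Rightarrow> ('i \<Rightarrow> 'a) set" where
  "dilate s = {x. \<exists>c\<in>C. \<forall>i\<in>I. x i = s *\<^sub>R c i}"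

lemma zero_mem: "(\<lambda>i. 0) \<in> C"
proof -
  obtain x where x: "x \<in> C" using nonempty by blast
  show ?thesis
    using convex[OF x symmetric[OF x], of "1 / 2"] by (simp add: scaleR_left_diff_distrib[symmetric])
qed

lemma shrink_mem:
  assumes "x \<in> C" "0 \<le> t" "t \<le> 1"
  shows "(\<lambda>i. t *\<^sub>R x i) \<in> C"
  using convex[OF zero_mem assms] by simp

lemma dilate_1: "dilate 1 = C"
proof (rule set_eqI)
  fix x
  show "x \<in> dilate 1 \<longleftrightarrow> x \<in> C"
  proof
    assume "x \<in> dilate 1"
    then obtain c where c: "c \<in> C" "\<forall>i\<in>I. x i = 1 *\<^sub>R c i" unfolding dilate_def by blast
    show "x \<in> C" by (rule cylinder[OF c(1)]) (use c(2) in simp)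
  next
    assume "x \<in> C"
    then show "x \<in> dilate 1" unfolding dilate_def by (intro CollectI bexI[of _ x]) simp_all
  qed
qed

lemma dilate_cylinder: "x \<in> dilate s \<Longrightarrow> (\<And>i. i \<in> I \<Longrightarrow> y i = x i) \<Longrightarrow> y \<in> dilate s"
  unfolding dilate_def by auto

lemma dilate_scale:
  assumes "x \<in> dilate s"
  shows "(\<lambda>i. a *\<^sub>R x i) \<in> dilate (\<bar>a\<bar> * s)"
proof -
  obtain c where c: "c \<in> C" "\<forall>i\<in>I. x i = s *\<^sub>R c i" using assms by (auto simp: dilate_def)
  show ?thesis
  proof (cases "0 \<le> a")
    case True
    then show ?thesis using c by (auto simp: dilate_def intro!: bexI[of _ c])
  next
    case False
    then show ?thesis using c symmetric[OF c(1)] by (auto simp: dilate_def intro!: bexI[of _ "\<lambda>i. - c i"])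
  qed
qed

lemma dilate_mono:
  assumes "x \<in> dilate s" "0 \<le> s" "s \<le> t"
  shows "x \<in> dilate t"
proof (cases "t = 0")
  case False
  obtain c where c: "c \<in> C" "\<forall>i\<in>I. x i = s *\<^sub>R c i" using assms by (auto simp: dilate_def)
  have "(\<lambda>i. (s / t) *\<^sub>R c i) \<in> C" using assms False by (intro shrink_mem c) auto
  then show ?thesis
    using c False by (auto simp: dilate_def intro!: bexI[of _ "\<lambda>i. (s / t) *\<^sub>R c i"])
qed (use assms in simp)

text \<open>The inclusion of \<open>s C + t C\<close> in \<open>(s + t) C\<close> is convexity of \<open>C\<close> in homogeneous form.\<close>

lemma dilate_add:
  assumes x: "x \<in> dilate s" and y: "y \<in> dilate t" and st: "0 \<le> s" "0 \<le> t"
  shows "(\<lambda>i. x i + y i) \<in> dilate (s + t)"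
proof -
  obtain c where c: "c \<in> C" "\<forall>i\<in>I. x i = s *\<^sub>R c i" using x by (auto simp: dilate_def)
  obtain d where d: "d \<in> C" "\<forall>i\<in>I. y i = t *\<^sub>R d i" using y by (auto simp: dilate_def)
  show ?thesis
  proof (cases "s + t = 0")
    case True
    then have "s = 0" "t = 0" using st by auto
    then show ?thesis using c d by (auto simp: dilate_def)
  next
    case False
    define l where "l = t / (s + t)"
    have l: "0 \<le> l" "l \<le> 1" "(s + t) * l = t" "(s + t) * (1 - l) = s"
      using st False by (auto simp: l_def field_simps)
    have "(\<lambda>i. (1 - l) *\<^sub>R c i + l *\<^sub>R d i) \<in> C" by (intro convex c d l)
    moreover have "x i + y i = (s + t) *\<^sub>R ((1 - l) *\<^sub>R c i + l *\<^sub>R d i)" if "i \<in> I" for i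
      using c(2) d(2) that l(3,4) by (simp add: scaleR_add_right)
    ultimately show ?thesis by (auto simp: dilate_def)
  qed
qed

lemma dilate_sum:
  assumes "finite F" "\<And>k. k \<in> F \<Longrightarrow> v k \<in> dilate (s k)" "\<And>k. k \<in> F \<Longrightarrow> 0 \<le> s k"
  shows "(\<lambda>i. \<Sum>k\<in>F. v k i) \<in> dilate (\<Sum>k\<in>F. s k)"
  using assms
proof (induction F rule: finite_induct)
  case empty
  then show ?case using zero_mem by (auto simp: dilate_def)
next
  case (insert k F)
  have "(\<lambda>i. v k i + (\<Sum>k\<in>F. v k i)) \<in> dilate (s k + (\<Sum>k\<in>F. s k))"
    using insert by (intro dilate_add sum_nonneg) auto
  then show ?case using insert.hyps by simp
qed

definition coords :: "('i \<times> 'a) set" where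
  "coords = I \<times> Basis"

definition coord :: "'i \<times> 'a \<Rightarrow> ('i \<Rightarrow> 'a) \<Rightarrow> real" where
  "coord k x = x (fst k) \<bullet> snd k"

definition unit_vector :: "'i \<times> 'a \<Rightarrow> 'i \<Rightarrow> 'a" where
  "unit_vector k i = (if i = fst k then snd k else 0)"

lemma finite_coords: "finite coords"
  using finite_I by (simp add: coords_def)

lemma coord_unit_vector: "k \<in> coords \<Longrightarrow> l \<in> coords \<Longrightarrow> coord k (unit_vector l) = (if k = l then 1 else 0)"
  by (auto simp: coord_def unit_vector_def coords_def inner_Basis prod_eq_iff)

lemma sum_coords:
  assumes "i \<in> I"
  shows "(\<Sum>k\<in>coords. coord k x *\<^sub>R unit_vector k i) = x i"
proof -
  have "(\<Sum>k\<in>coords. coord k x *\<^sub>R unit_vector k i) = (\<Sum>j\<in>I. \<Sum>b\<in>Basis. (x j \<bullet> b) *\<^sub>R (if i = j then b else 0))"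
    unfolding coords_def coord_def unit_vector_def by (simp add: sum.cartesian_product case_prod_beta')
  also have "\<dots> = (\<Sum>j\<in>I. if j = i then (\<Sum>b\<in>Basis. (x j \<bullet> b) *\<^sub>R b) else 0)"
    by (intro sum.cong) auto
  also have "\<dots> = x i"
    using assms finite_I by (simp add: euclidean_representation)
  finally show ?thesis .
qed

lemma eq_of_coords_eq:
  assumes "i \<in> I" "\<And>k. k \<in> coords \<Longrightarrow> coord k x = coord k y"
  shows "x i = y i"
proof (rule euclidean_eqI)
  fix b :: 'a assume "b \<in> Basis"
  then have "(i, b) \<in> coords" using assms(1) by (simp add: coords_def)
  from assms(2)[OF this] show "x i \<bullet> b = y i \<bullet> b" by (simp add: coord_def)
qed

text \<open>The multiples of \<open>C\<close> fill a linear subspace \<open>V\<close>, which meets the axis of \<open>k0\<close> only in the origin. Take a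
maximal set \<open>J\<close> of coordinates that contains \<open>k0\<close> and whose coordinate subspace meets \<open>V\<close> only
in the origin. By maximality, for every \<open>k\<close> outside \<open>J\<close> there is \<open>w k \<in> V\<close> that has \<open>k\<close>-th coordinate one
and is otherwise supported in \<open>J\<close>. Subtracting suitable multiples of these from \<open>x \<in> C\<close> leaves an element of
\<open>V\<close> supported in \<open>J\<close>, hence the origin; its \<open>k0\<close>-th coordinate is the required relation.\<close>

lemma degenerate_relation:
  assumes k0: "k0 \<in> coords" and no: "\<And>t. t \<noteq> 0 \<Longrightarrow> (\<lambda>i. t *\<^sub>R unit_vector k0 i) \<notin> C"
  shows "\<exists>L a. L \<subseteq> coords \<and> k0 \<notin> L \<and> (\<forall>x\<in>C. coord k0 x = (\<Sum>k\<in>L. a k * coord k x))"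
proof -
  define V where "V = {x. \<exists>s\<ge>0. x \<in> dilate s}"
  have V_scale: "(\<lambda>i. a *\<^sub>R x i) \<in> V" if "x \<in> V" for a x
  proof -
    from that obtain s where "0 \<le> s" "x \<in> dilate s" by (auto simp: V_def)
    then have "(\<lambda>i. a *\<^sub>R x i) \<in> dilate (\<bar>a\<bar> * s)" "0 \<le> \<bar>a\<bar> * s" by (auto intro: dilate_scale)
    then show ?thesis unfolding V_def by blast
  qed
  have V_sum: "(\<lambda>i. \<Sum>k\<in>F. v k i) \<in> V" if F: "finite F" "\<And>k. k \<in> F \<Longrightarrow> v k \<in> V" for F :: "('i \<times> 'a) set" and v
  proof -
    have "\<forall>k\<in>F. \<exists>s\<ge>0. v k \<in> dilate s" using F(2) by (simp add: V_def)
    then obtain s where s: "\<And>k. k \<in> F \<Longrightarrow> 0 \<le> s k \<and> v k \<in> dilate (s k)" by metis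
    have "(\<lambda>i. \<Sum>k\<in>F. v k i) \<in> dilate (\<Sum>k\<in>F. s k)" "0 \<le> (\<Sum>k\<in>F. s k)"
      using s F(1) by (auto intro: dilate_sum sum_nonneg)
    then show ?thesis unfolding V_def by blast
  qed
  have V_diff: "(\<lambda>i. x i - y i) \<in> V" if xy: "x \<in> V" "y \<in> V" for x y
  proof -
    obtain s where s: "0 \<le> s" "x \<in> dilate s" using xy(1) by (auto simp: V_def)
    obtain t where t: "0 \<le> t" "(\<lambda>i. - y i) \<in> dilate t" using V_scale[OF xy(2), of "-1"] by (auto simp: V_def)
    have "(\<lambda>i. x i - y i) \<in> dilate (s + t)" using dilate_add[OF s(2) t(2) s(1) t(1)] by simp
    moreover have "0 \<le> s + t" using s t by simp
    ultimately show ?thesis unfolding V_def by blast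
  qed
  (* V meets the subspace of vectors supported in J only in the origin. *)
  define good where "good J \<longleftrightarrow> J \<subseteq> coords \<and> k0 \<in> J \<and>
    (\<forall>x\<in>V. (\<forall>k\<in>coords - J. coord k x = 0) \<longrightarrow> (\<forall>k\<in>coords. coord k x = 0))" for J
  have "good {k0}"
    unfolding good_def
  proof (intro conjI ballI impI)
    fix x k assume x: "x \<in> V" and z: "\<forall>k\<in>coords - {k0}. coord k x = 0" and k: "k \<in> coords"
    show "coord k x = 0"
    proof (rule ccontr)
      assume nz: "coord k x \<noteq> 0"
      then have kk: "k = k0" using z k by auto
      have x_eq: "x i = coord k0 x *\<^sub>R unit_vector k0 i" if i: "i \<in> I" for i
      proof (rule eq_of_coords_eq[OF i])
        fix l assume l: "l \<in> coords"
        have "coord l (\<lambda>i. coord k0 x *\<^sub>R unit_vector k0 i) = coord k0 x * coord l (unit_vector k0)"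
          by (simp add: coord_def)
        then show "coord l x = coord l (\<lambda>i. coord k0 x *\<^sub>R unit_vector k0 i)"
          using coord_unit_vector[OF l k0] z l by (cases "l = k0") auto
      qed
      obtain s where s: "0 \<le> s" "x \<in> dilate s" using x by (auto simp: V_def)
      then obtain c where c: "c \<in> C" "\<forall>i\<in>I. x i = s *\<^sub>R c i" by (auto simp: dilate_def)
      have "s \<noteq> 0"
      proof
        assume "s = 0"
        then have "x (fst k) = 0" using c(2) k by (auto simp: coords_def)
        then show False using nz by (simp add: coord_def)
      qed
      have "(\<lambda>i. (coord k0 x / s) *\<^sub>R unit_vector k0 i) \<in> C"
      proof (rule cylinder[OF c(1)])
        fix i assume i: "i \<in> I"
        have "s *\<^sub>R c i = x i" using c(2) i by simp
        also have "\<dots> = coord k0 x *\<^sub>R unit_vector k0 i" by (rule x_eq[OF i])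
        finally have "s *\<^sub>R c i = coord k0 x *\<^sub>R unit_vector k0 i" .
        then have "(1 / s) *\<^sub>R (s *\<^sub>R c i) = (1 / s) *\<^sub>R (coord k0 x *\<^sub>R unit_vector k0 i)" by simp
        then show "(coord k0 x / s) *\<^sub>R unit_vector k0 i = c i" using \<open>s \<noteq> 0\<close> by simp
      qed
      then show False using no[of "coord k0 x / s"] nz kk \<open>s \<noteq> 0\<close> by simp
    qed
  qed (use k0 in auto)
  moreover have "finite {J. good J}"
    using finite_coords by (intro finite_subset[of "{J. good J}" "Pow coords"]) (auto simp: good_def)
  ultimately obtain J where J: "good J" and max: "\<And>J'. good J' \<Longrightarrow> J \<subseteq> J' \<Longrightarrow> J = J'"
    using finite_has_maximal[of "{J. good J}"] by auto
  have "\<exists>w\<in>V. coord k w = 1 \<and> (\<forall>l\<in>coords - insert k J. coord l w = 0)" if k: "k \<in> coords - J" for k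
  proof -
    have "\<not> good (insert k J)" using max[of "insert k J"] k by auto
    then obtain x where x: "x \<in> V" "\<forall>l\<in>coords - insert k J. coord l x = 0" "\<not> (\<forall>l\<in>coords. coord l x = 0)"
      using J k unfolding good_def by blast
    have nz: "coord k x \<noteq> 0"
    proof
      assume "coord k x = 0"
      then have "\<forall>l\<in>coords - J. coord l x = 0" using x(2) by auto
      then show False using J x(1,3) unfolding good_def by blast
    qed
    have c: "coord l (\<lambda>i. (1 / coord k x) *\<^sub>R x i) = coord l x / coord k x" for l by (simp add: coord_def)
    show ?thesis
      using V_scale[OF x(1), of "1 / coord k x"] x(2) nz c by (intro bexI[of _ "\<lambda>i. (1 / coord k x) *\<^sub>R x i"]) auto
  qed
  then obtain w where w: "\<And>k. k \<in> coords - J \<Longrightarrow> w k \<in> V" "\<And>k. k \<in> coords - J \<Longrightarrow> coord k (w k) = 1"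
      "\<And>k l. k \<in> coords - J \<Longrightarrow> l \<in> coords - insert k J \<Longrightarrow> coord l (w k) = 0"
    by metis
  have "coord k0 x = (\<Sum>k\<in>coords - J. coord k0 (w k) * coord k x)" if x: "x \<in> C" for x
  proof -
    define y where "y = (\<lambda>i. x i - (\<Sum>k\<in>coords - J. coord k x *\<^sub>R w k i))"
    have "x \<in> V" using x dilate_1 unfolding V_def by (auto intro!: exI[of _ 1])
    then have "y \<in> V"
      unfolding y_def using finite_coords w(1) by (intro V_diff V_sum V_scale) auto
    have cy: "coord l y = coord l x - (\<Sum>k\<in>coords - J. coord k x * coord l (w k))" for l
      by (simp add: y_def coord_def inner_diff_left inner_sum_left)
    have "coord l y = 0" if l: "l \<in> coords - J" for l
    proof -
      have "(\<Sum>k\<in>coords - J. coord k x * coord l (w k)) = (\<Sum>k\<in>coords - J. if k = l then coord l x else 0)"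
        using w(2,3) l by (intro sum.cong) auto
      also have "\<dots> = coord l x" using l finite_coords by simp
      finally show ?thesis by (simp add: cy)
    qed
    then have "\<forall>k\<in>coords. coord k y = 0" using J \<open>y \<in> V\<close> unfolding good_def by blast
    then have "coord k0 y = 0" using k0 by blast
    then show ?thesis by (simp add: cy mult.commute)
  qed
  moreover have "k0 \<notin> coords - J" using J by (auto simp: good_def)
  ultimately show ?thesis by (intro exI[of _ "coords - J"] exI[of _ "\<lambda>k. coord k0 (w k)"]) auto
qed

text \<open>With all variables but the one that contains the coordinate \<open>k0\<close> fixed, the relation confines the remaining
vector to a hyperplane orthogonal to a nonzero vector \<open>w\<close>.\<close>

lemma hyperplane_null:
  assumes k0: "k0 \<in> coords" and L: "L \<subseteq> coords" "k0 \<notin> L"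
  shows "{x \<in> space (PiM I (\<lambda>_. lborel)). coord k0 x = (\<Sum>k\<in>L. a k * coord k x)} \<in> null_sets (PiM I (\<lambda>_. lborel))"
proof -
  let ?P = "PiM I (\<lambda>_. lborel :: 'a measure)"
  interpret product_sigma_finite "\<lambda>_. lborel :: 'a measure" by (rule product_sigma_finite_lborel)
  define H where "H = {x \<in> space ?P. coord k0 x = (\<Sum>k\<in>L. a k * coord k x)}"
  define i0 where "i0 = fst k0"
  define b0 where "b0 = snd k0"
  have i0: "i0 \<in> I" "b0 \<in> Basis" using k0 by (auto simp: coords_def i0_def b0_def)
  have ins: "insert i0 (I - {i0}) = I" using i0 by auto
  have fin: "finite (I - {i0})" "i0 \<notin> I - {i0}" using finite_I by auto
  have finL: "finite L" using L finite_coords by (blast intro: finite_subset)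
  have cm: "(\<lambda>x. coord k x) \<in> borel_measurable ?P" if "k \<in> coords" for k
  proof -
    have "fst k \<in> I" using that by (auto simp: coords_def)
    from measurable_component_singleton[OF this, of "\<lambda>_. lborel :: 'a measure"]
    have [measurable]: "(\<lambda>x. x (fst k)) \<in> ?P \<rightarrow>\<^sub>M borel" by simp
    show ?thesis unfolding coord_def by measurable
  qed
  have Hm: "H \<in> sets ?P"
  proof -
    have [measurable]: "(\<lambda>x. coord k0 x) \<in> borel_measurable ?P" by (rule cm[OF k0])
    have [measurable]: "(\<lambda>x. \<Sum>k\<in>L. a k * coord k x) \<in> borel_measurable ?P"
      using L by (intro borel_measurable_sum borel_measurable_times cm borel_measurable_const) auto
    show ?thesis unfolding H_def by measurable
  qed
  define w where "w = b0 - (\<Sum>k\<in>{k \<in> L. fst k = i0}. a k *\<^sub>R snd k)"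
  have "w \<bullet> b0 = 1 - (\<Sum>k\<in>{k \<in> L. fst k = i0}. a k * (snd k \<bullet> b0))"
    using i0 by (simp add: w_def inner_diff_left inner_sum_left inner_Basis)
  also have "(\<Sum>k\<in>{k \<in> L. fst k = i0}. a k * (snd k \<bullet> b0)) = 0"
  proof (rule sum.neutral, intro ballI)
    fix k assume k: "k \<in> {k \<in> L. fst k = i0}"
    then have "k \<noteq> k0" "fst k = fst k0" using L(2) by (auto simp: i0_def)
    then have "snd k \<noteq> b0" by (auto simp: b0_def prod_eq_iff)
    moreover have "snd k \<in> Basis" using k L(1) by (auto simp: coords_def)
    ultimately show "a k * (snd k \<bullet> b0) = 0" using i0 by (simp add: inner_Basis)
  qed
  finally have w: "w \<noteq> 0" by auto
  have inner: "(\<integral>\<^sup>+y. indicator H (x(i0 := y)) \<partial>lborel) = 0" for x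
  proof -
    define const where "const = (\<Sum>k\<in>{k \<in> L. fst k \<noteq> i0}. a k * coord k x)"
    have mem: "w \<bullet> y = const" if "x(i0 := y) \<in> H" for y
    proof -
      have "y \<bullet> b0 = (\<Sum>k\<in>L. a k * coord k (x(i0 := y)))"
        using that by (simp add: H_def coord_def i0_def b0_def)
      also have "\<dots> = (\<Sum>k\<in>{k \<in> L. fst k = i0}. a k * coord k (x(i0 := y))) + (\<Sum>k\<in>{k \<in> L. fst k \<noteq> i0}. a k * coord k (x(i0 := y)))"
        using finL by (subst sum.union_disjoint[symmetric]) (auto intro!: sum.cong)
      also have "(\<Sum>k\<in>{k \<in> L. fst k = i0}. a k * coord k (x(i0 := y))) = (\<Sum>k\<in>{k \<in> L. fst k = i0}. a k *\<^sub>R snd k) \<bullet> y"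
        unfolding inner_sum_left by (intro sum.cong) (auto simp: coord_def inner_commute)
      also have "(\<Sum>k\<in>{k \<in> L. fst k \<noteq> i0}. a k * coord k (x(i0 := y))) = const"
        unfolding const_def by (intro sum.cong) (auto simp: coord_def)
      finally show ?thesis by (simp add: w_def inner_diff_left inner_diff_right inner_commute)
    qed
    have "(\<integral>\<^sup>+y. indicator H (x(i0 := y)) \<partial>lborel) \<le> (\<integral>\<^sup>+y. indicator {y. w \<bullet> y = const} y \<partial>lborel)"
      using mem by (intro nn_integral_mono) (auto simp: indicator_def)
    also have "\<dots> = emeasure lborel {y. w \<bullet> y = const}"
      by (rule nn_integral_indicator) (simp add: closed_hyperplane borel_closed)
    also have "\<dots> = 0"
    proof -
      have "{y. w \<bullet> y = const} \<in> null_sets lebesgue"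
        using negligible_hyperplane[of w const] w by (simp add: negligible_iff_null_sets)
      then have "{y. w \<bullet> y = const} \<in> null_sets lborel"
        by (subst (asm) null_sets_completion_iff) (auto simp: closed_hyperplane borel_closed)
      then show ?thesis by auto
    qed
    finally show ?thesis by simp
  qed
  have "emeasure ?P H = (\<integral>\<^sup>+x. indicator H x \<partial>?P)" using Hm by simp
  also have "\<dots> = (\<integral>\<^sup>+x. \<integral>\<^sup>+y. indicator H (x(i0 := y)) \<partial>lborel \<partial>PiM (I - {i0}) (\<lambda>_. lborel))"
    using product_nn_integral_insert[OF fin, of "indicator H"] Hm unfolding ins by simp
  also have "\<dots> = 0" by (simp add: inner)
  finally show ?thesis using Hm by (auto simp: H_def)
qed

text \<open>The union of the multiples \<open>t C\<close> with \<open>0 \<le> t < s\<close>. For \<open>s = 1\<close> it plays the role of the interior of \<open>C\<close>,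
for \<open>s > 1\<close> that of a neighbourhood of the closure.\<close>

definition open_dilate :: "real \<Rightarrow> ('i \<Rightarrow> 'a) set" where
  "open_dilate s = {x. \<exists>t. 0 \<le> t \<and> t < s \<and> x \<in> dilate t}"

text \<open>If a multiple of every coordinate vector lies in \<open>C\<close>, all sufficiently small vectors lie in \<open>\<epsilon> C\<close>, and
\<open>t C + \<epsilon> C\<close> is contained in \<open>(t + \<epsilon>) C\<close>.\<close>

lemma open_open_dilate:
  assumes \<tau>: "\<And>k. k \<in> coords \<Longrightarrow> 0 < \<tau> k" "\<And>k. k \<in> coords \<Longrightarrow> (\<lambda>i. \<tau> k *\<^sub>R unit_vector k i) \<in> C"
  shows "open (open_dilate s)"
proof (subst open_subopen, intro ballI)
  fix x assume "x \<in> open_dilate s"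
  then obtain t where t: "0 \<le> t" "t < s" "x \<in> dilate t" by (auto simp: open_dilate_def)
  define \<sigma> where "\<sigma> = (\<Sum>k\<in>coords. 1 / \<tau> k)"
  have sg: "0 \<le> \<sigma>" unfolding \<sigma>_def using \<tau>(1) by (intro sum_nonneg) (simp add: less_imp_le)
  (* A vector with coordinates at most \<eta> lies in the \<eta> \<sigma>-fold multiple of C, and
     \<eta> \<sigma> is less than the room s - t. *)
  define \<eta> where "\<eta> = (s - t) / (2 * (\<sigma> + 1))"
  have eta: "0 < \<eta>" using t sg by (simp add: \<eta>_def)
  have eta_sg: "\<eta> * \<sigma> < s - t"
  proof -
    have "\<eta> * \<sigma> \<le> \<eta> * (\<sigma> + 1)" using eta by simp
    also have "\<dots> = (s - t) / 2" using sg by (simp add: \<eta>_def field_simps)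
    finally show ?thesis using t by simp
  qed
  define U where "U = {y. \<forall>i\<in>I. y i \<in> ball (x i) \<eta>}"
  have "U \<subseteq> open_dilate s"
  proof
    fix y assume y: "y \<in> U"
    define d where "d = (\<lambda>i. y i - x i)"
    have "coord k d \<le> \<eta>" "- coord k d \<le> \<eta>" if "k \<in> coords" for k
    proof -
      have k: "fst k \<in> I" "snd k \<in> Basis" using that by (auto simp: coords_def)
      have "\<bar>coord k d\<bar> \<le> norm (d (fst k))" unfolding coord_def by (rule Basis_le_norm[OF k(2)])
      also have "\<dots> \<le> \<eta>" using y k(1) by (auto simp: U_def d_def dist_norm norm_minus_commute less_imp_le)
      finally show "coord k d \<le> \<eta>" "- coord k d \<le> \<eta>" by auto
    qed
    then have cd: "\<bar>coord k d\<bar> \<le> \<eta>" if "k \<in> coords" for k using that by (simp add: abs_le_iff)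
    have "(\<lambda>i. \<Sum>k\<in>coords. (coord k d / \<tau> k) *\<^sub>R (\<tau> k *\<^sub>R unit_vector k i)) \<in> dilate (\<Sum>k\<in>coords. \<bar>coord k d / \<tau> k\<bar> * 1)"
    proof (rule dilate_sum[OF finite_coords])
      fix k assume k: "k \<in> coords"
      show "(\<lambda>i. (coord k d / \<tau> k) *\<^sub>R (\<tau> k *\<^sub>R unit_vector k i)) \<in> dilate (\<bar>coord k d / \<tau> k\<bar> * 1)"
        using \<tau>(2)[OF k] by (intro dilate_scale) (simp add: dilate_1)
    qed simp
    then have d_mem: "d \<in> dilate (\<Sum>k\<in>coords. \<bar>coord k d / \<tau> k\<bar> * 1)"
    proof (rule dilate_cylinder)
      fix i assume i: "i \<in> I"
      have "(\<Sum>k\<in>coords. (coord k d / \<tau> k) *\<^sub>R (\<tau> k *\<^sub>R unit_vector k i)) = (\<Sum>k\<in>coords. coord k d *\<^sub>R unit_vector k i)"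
        using \<tau>(1) by (intro sum.cong) (auto simp: less_imp_neq[symmetric])
      then show "d i = (\<Sum>k\<in>coords. (coord k d / \<tau> k) *\<^sub>R (\<tau> k *\<^sub>R unit_vector k i))"
        using sum_coords[OF i, of d] by simp
    qed
    have le: "(\<Sum>k\<in>coords. \<bar>coord k d / \<tau> k\<bar> * 1) \<le> \<eta> * \<sigma>"
      unfolding \<sigma>_def sum_distrib_left
    proof (rule sum_mono)
      fix k assume k: "k \<in> coords"
      have "\<bar>coord k d / \<tau> k\<bar> = \<bar>coord k d\<bar> / \<tau> k" using \<tau>(1)[OF k] by simp
      also have "\<dots> \<le> \<eta> / \<tau> k" using cd[OF k] \<tau>(1)[OF k] by (intro divide_right_mono) auto
      finally show "\<bar>coord k d / \<tau> k\<bar> * 1 \<le> \<eta> * (1 / \<tau> k)" by simp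
    qed
    have nn: "0 \<le> (\<Sum>k\<in>coords. \<bar>coord k d / \<tau> k\<bar> * 1)" by (intro sum_nonneg) simp
    have "(\<lambda>i. x i + d i) \<in> dilate (t + (\<Sum>k\<in>coords. \<bar>coord k d / \<tau> k\<bar> * 1))"
      by (rule dilate_add[OF t(3) d_mem t(1) nn])
    then have "y \<in> dilate (t + (\<Sum>k\<in>coords. \<bar>coord k d / \<tau> k\<bar> * 1))" by (simp add: d_def)
    moreover have "t + (\<Sum>k\<in>coords. \<bar>coord k d / \<tau> k\<bar> * 1) < s" using le eta_sg by linarith
    ultimately show "y \<in> open_dilate s"
      using add_nonneg_nonneg[OF t(1) nn] unfolding open_dilate_def by blast
  qed
  moreover have "open U"
    unfolding U_def using product_topology_basis'[OF finite_I, of "\<lambda>i. ball (x i) \<eta>" "\<lambda>i. i"] by simp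
  moreover have "x \<in> U" using eta by (simp add: U_def)
  ultimately show "\<exists>T. open T \<and> x \<in> T \<and> T \<subseteq> open_dilate s" by blast
qed

end

lemma open_cylinder_measurable:
  fixes G :: "('i::countable \<Rightarrow> 'a::euclidean_space) set"
  assumes "open G"
  shows "G \<inter> space (PiM I (\<lambda>_. lborel)) \<in> sets (PiM I (\<lambda>_. lborel))"
proof -
  let ?P = "PiM I (\<lambda>_. lborel :: 'a measure)"
  have "(\<lambda>x. x) \<in> ?P \<rightarrow>\<^sub>M PiM UNIV (\<lambda>_. borel)"
  proof (rule measurable_PiM_single')
    fix i :: 'i
    show "(\<lambda>x. x i) \<in> ?P \<rightarrow>\<^sub>M borel"
    proof (cases "i \<in> I")
      case True
      from measurable_component_singleton[OF this, of "\<lambda>_. lborel :: 'a measure"] show ?thesis by simp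
    next
      case False
      have "x i = undefined" if "x \<in> space ?P" for x
        using that False by (auto simp: space_PiM PiE_def extensional_def)
      then show ?thesis
        using measurable_cong[of ?P "\<lambda>x. x i" "\<lambda>x. undefined" borel] by simp
    qed
  qed auto
  moreover have "G \<in> sets (PiM UNIV (\<lambda>_. borel))"
    using assms by (simp add: sets_PiM_equal_borel)
  ultimately have "(\<lambda>x. x) -` G \<inter> space ?P \<in> sets ?P" by (rule measurable_sets)
  then show ?thesis by simp
qed

context symmetric_convex_cylinder
begin

lemma open_dilate_scaling:
  assumes meas: "\<And>s. open_dilate s \<inter> space (PiM I (\<lambda>_. lborel)) \<in> sets (PiM I (\<lambda>_. lborel))" and s: "1 \<le> s"
  shows "emeasure (PiM I (\<lambda>_. lborel)) (open_dilate s \<inter> PiE I (\<lambda>_. ball 0 r))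
    \<le> ennreal (s ^ DIM('a)) ^ card I * emeasure (PiM I (\<lambda>_. lborel)) (open_dilate 1 \<inter> PiE I (\<lambda>_. ball 0 r))"
proof -
  let ?P = "PiM I (\<lambda>_. lborel :: 'a measure)"
  define B where "B u = open_dilate u \<inter> PiE I (\<lambda>_. ball (0::'a) r)" for u
  have B: "B u \<in> sets ?P" for u
  proof -
    have box: "PiE I (\<lambda>_. ball (0::'a) r) \<in> sets ?P" using finite_I by (intro sets_PiM_I_finite) auto
    then have "B u = (open_dilate u \<inter> space ?P) \<inter> PiE I (\<lambda>_. ball (0::'a) r)"
      using sets.sets_into_space[OF box] by (auto simp: B_def)
    then show ?thesis using sets.Int[OF meas box] by simp
  qed
  have "emeasure ?P (B s) = (\<integral>\<^sup>+x. indicator (B s) x \<partial>?P)" using B by simp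
  also have "\<dots> = ennreal (\<bar>s\<bar> ^ DIM('a)) ^ card I * (\<integral>\<^sup>+x. indicator (B s) (\<lambda>i\<in>I. 0 + s *\<^sub>R x i) \<partial>?P)"
    using s B by (intro nn_integral_PiM_affine finite_I) auto
  also have "\<dots> \<le> ennreal (\<bar>s\<bar> ^ DIM('a)) ^ card I * (\<integral>\<^sup>+x. indicator (B 1) x \<partial>?P)"
  proof (intro mult_left_mono nn_integral_mono)
    fix x assume "x \<in> space ?P"
    then have x: "x \<in> PiE I (\<lambda>_. UNIV)" by (simp add: space_PiM)
    have "x \<in> B 1" if sx: "(\<lambda>i\<in>I. 0 + s *\<^sub>R x i) \<in> B s"
    proof -
      obtain t where t: "0 \<le> t" "t < s" "(\<lambda>i\<in>I. 0 + s *\<^sub>R x i) \<in> dilate t"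
        using sx by (auto simp: B_def open_dilate_def)
      have "(\<lambda>i. (1 / s) *\<^sub>R (\<lambda>i\<in>I. 0 + s *\<^sub>R x i) i) \<in> dilate (\<bar>1 / s\<bar> * t)"
        by (rule dilate_scale[OF t(3)])
      then have "x \<in> dilate (\<bar>1 / s\<bar> * t)" by (rule dilate_cylinder) (use s in simp)
      moreover have "\<bar>1 / s\<bar> * t < 1" "0 \<le> \<bar>1 / s\<bar> * t" using t s by auto
      ultimately have "x \<in> open_dilate 1" unfolding open_dilate_def by blast
      moreover have "x i \<in> ball 0 r" if i: "i \<in> I" for i
      proof -
        have "norm (s *\<^sub>R x i) < r" using sx i by (auto simp: B_def PiE_def Pi_def)
        moreover have "norm (x i) \<le> norm (s *\<^sub>R x i)" using s by (simp add: mult_le_cancel_right1)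
        ultimately show ?thesis by simp
      qed
      ultimately show ?thesis using x by (auto simp: B_def PiE_def)
    qed
    then show "indicator (B s) (\<lambda>i\<in>I. 0 + s *\<^sub>R x i) \<le> (indicator (B 1) x :: ennreal)"
      by (simp only: indicator_def) (simp split: if_splits)
  qed simp
  finally show ?thesis using B s by (simp add: B_def)
qed

text \<open>If some axis meets \<open>C\<close> only in the origin, \<open>C\<close> is contained in a null set, and \<open>t = 0\<close> makes the kernel
empty. Otherwise \<open>C\<close> lies between \<open>open_dilate 1\<close> and \<open>open_dilate s\<close> for every \<open>s > 1\<close>. Inside a
fixed box the measure of the latter exceeds that of the former at most by a power of \<open>s\<close>, which tends to
one, so the difference is a null set.\<close>

lemma open_kernel_almost_all:
  "\<exists>t\<le>1. open_dilate t \<inter> space (PiM I (\<lambda>_. lborel)) \<in> sets (PiM I (\<lambda>_. lborel))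
    \<and> (\<exists>N \<in> null_sets (PiM I (\<lambda>_. lborel)). C \<inter> space (PiM I (\<lambda>_. lborel)) - open_dilate t \<subseteq> N)"
proof (cases "\<forall>k\<in>coords. \<exists>t. t \<noteq> 0 \<and> (\<lambda>i. t *\<^sub>R unit_vector k i) \<in> C")
  case False
  let ?P = "PiM I (\<lambda>_. lborel :: 'a measure)"
  obtain k0 where k0: "k0 \<in> coords" "\<And>t. t \<noteq> 0 \<Longrightarrow> (\<lambda>i. t *\<^sub>R unit_vector k0 i) \<notin> C" using False by blast
  obtain L a where L: "L \<subseteq> coords" "k0 \<notin> L" "\<forall>x\<in>C. coord k0 x = (\<Sum>k\<in>L. a k * coord k x)"
    using degenerate_relation[OF k0] by blast
  have "open_dilate 0 = {}" by (auto simp: open_dilate_def)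
  then have "open_dilate 0 \<inter> space ?P \<in> sets ?P" by simp
  moreover have "C \<inter> space ?P - open_dilate 0 \<subseteq> {x \<in> space ?P. coord k0 x = (\<Sum>k\<in>L. a k * coord k x)}" using L(3) by blast
  ultimately show ?thesis using hyperplane_null[OF k0(1) L(1,2), of a] by (intro exI[of _ 0] conjI bexI) simp_all
next
  case True
  let ?P = "PiM I (\<lambda>_. lborel :: 'a measure)"
  have "\<forall>k\<in>coords. \<exists>t>0. (\<lambda>i. t *\<^sub>R unit_vector k i) \<in> C"
  proof
    fix k assume "k \<in> coords"
    then obtain t where t: "t \<noteq> 0" "(\<lambda>i. t *\<^sub>R unit_vector k i) \<in> C" using True by blast
    show "\<exists>t>0. (\<lambda>i. t *\<^sub>R unit_vector k i) \<in> C"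
    proof (cases "0 < t")
      case False
      then show ?thesis using t symmetric[OF t(2)] by (intro exI[of _ "- t"]) simp
    qed (use t in blast)
  qed
  then obtain \<tau> where \<tau>: "\<And>k. k \<in> coords \<Longrightarrow> 0 < \<tau> k" "\<And>k. k \<in> coords \<Longrightarrow> (\<lambda>i. \<tau> k *\<^sub>R unit_vector k i) \<in> C"
    by metis
  have meas: "open_dilate s \<inter> space ?P \<in> sets ?P" for s
    by (rule open_cylinder_measurable, rule open_open_dilate[of \<tau>]) (rule \<tau>, assumption)+
  define E where "E = open_dilate 1 \<inter> space ?P"
  define s where "s n = 1 + 1 / real (Suc n)" for n
  have s: "1 < s n" for n by (simp add: s_def)
  define D where "D = (\<Inter>n. open_dilate (s n) \<inter> space ?P)"
  have Dm: "D \<in> sets ?P" unfolding D_def using meas by (intro sets.countable_INT) auto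
  have CD: "C \<inter> space ?P \<subseteq> D"
  proof
    fix x assume x: "x \<in> C \<inter> space ?P"
    then have "x \<in> dilate 1" by (simp add: dilate_1)
    then have "x \<in> open_dilate (s n)" for n
      unfolding open_dilate_def using s[of n] by (intro CollectI exI[of _ 1]) simp
    then show "x \<in> D" using x by (simp add: D_def)
  qed
  have ED: "E \<subseteq> D"
  proof
    fix x assume x: "x \<in> E"
    then obtain t where t: "0 \<le> t" "t < 1" "x \<in> dilate t" by (auto simp: E_def open_dilate_def)
    then have "x \<in> open_dilate (s n)" for n
      unfolding open_dilate_def using s[of n] by (intro CollectI exI[of _ t]) simp
    then show "x \<in> D" using x by (simp add: D_def E_def)
  qed
  have Em: "E \<in> sets ?P" using meas by (simp add: E_def)
  have zero: "emeasure ?P ((D - E) \<inter> PiE I (\<lambda>_. ball 0 (real r))) = 0" for r :: nat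
  proof -
    let ?B = "PiE I (\<lambda>_. ball (0::'a) (real r))"
    have box: "?B \<in> sets ?P" using finite_I by (intro sets_PiM_I_finite) auto
    have Bs: "?B \<subseteq> space ?P" by (rule sets.sets_into_space[OF box])
    have fin: "emeasure ?P ?B < \<top>"
      using finite_I by (subst emeasure_PiM_lborel) (simp_all add: emeasure_ball power_less_top_ennreal)
    have EB: "emeasure ?P (E \<inter> ?B) \<le> emeasure ?P ?B" by (rule emeasure_mono[OF Int_lower2 box])
    then have "emeasure ?P (E \<inter> ?B) < \<top>" using fin by (rule le_less_trans)
    then obtain e where e: "emeasure ?P (E \<inter> ?B) = ennreal e" "0 \<le> e"
      by (cases "emeasure ?P (E \<inter> ?B)") simp_all
    have E_eq: "open_dilate 1 \<inter> ?B = E \<inter> ?B" using Bs by (auto simp: E_def)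
    have le: "emeasure ?P (D \<inter> ?B) \<le> ennreal ((s n ^ DIM('a)) ^ card I * e)" for n
    proof -
      have "D \<inter> ?B \<subseteq> open_dilate (s n) \<inter> ?B" by (auto simp: D_def)
      moreover have "open_dilate (s n) \<inter> ?B = (open_dilate (s n) \<inter> space ?P) \<inter> ?B" using Bs by auto
      ultimately have "emeasure ?P (D \<inter> ?B) \<le> emeasure ?P (open_dilate (s n) \<inter> ?B)"
        using sets.Int[OF meas box] by (intro emeasure_mono) auto
      also have "\<dots> \<le> ennreal (s n ^ DIM('a)) ^ card I * emeasure ?P (open_dilate 1 \<inter> ?B)"
        using s[of n] by (intro open_dilate_scaling meas) simp
      also have "\<dots> = ennreal ((s n ^ DIM('a)) ^ card I * e)"
        using s[of n] e by (simp add: E_eq ennreal_power ennreal_mult)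
      finally show ?thesis .
    qed
    have "(\<lambda>n. 1 / real (Suc n)) \<longlonglongrightarrow> 0"
      using LIMSEQ_inverse_real_of_nat by (simp add: inverse_eq_divide)
    then have "(\<lambda>n. (s n ^ DIM('a)) ^ card I * e) \<longlonglongrightarrow> ((1 + 0) ^ DIM('a)) ^ card I * e"
      unfolding s_def by (intro tendsto_intros)
    then have "(\<lambda>n. (s n ^ DIM('a)) ^ card I * e) \<longlonglongrightarrow> e" by simp
    then have lim: "(\<lambda>n. ennreal ((s n ^ DIM('a)) ^ card I * e)) \<longlonglongrightarrow> ennreal e"
      by (rule tendsto_ennrealI)
    have De: "emeasure ?P (D \<inter> ?B) \<le> ennreal e"
      by (intro LIMSEQ_le_const[OF lim] exI[of _ 0] allI impI le)
    have "(D - E) \<inter> ?B = (D \<inter> ?B) - (E \<inter> ?B)" by blast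
    then have "emeasure ?P ((D - E) \<inter> ?B) = emeasure ?P ((D \<inter> ?B) - (E \<inter> ?B))" by (simp only:)
    also have "\<dots> = emeasure ?P (D \<inter> ?B) - emeasure ?P (E \<inter> ?B)"
    proof (rule emeasure_Diff)
      show "emeasure ?P (E \<inter> ?B) \<noteq> \<infinity>" using e by simp
      show "D \<inter> ?B \<in> sets ?P" "E \<inter> ?B \<in> sets ?P" by (rule sets.Int[OF Dm box] sets.Int[OF Em box])+
      show "E \<inter> ?B \<subseteq> D \<inter> ?B" using ED by blast
    qed
    also have "\<dots> \<le> ennreal e - ennreal e"
      unfolding e(1) by (rule ennreal_minus_mono[OF De order_refl])
    finally show ?thesis by simp
  qed
  have "emeasure ?P (D - E) = (\<integral>\<^sup>+x. indicator (D - E) x \<partial>?P)" using Dm Em by simp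
  also have "\<dots> = (SUP r. \<integral>\<^sup>+x. indicator (D - E) x * indicator (PiE I (\<lambda>_. ball 0 (real r))) x \<partial>?P)"
    using Dm Em by (intro nn_integral_PiM_exhaust_balls finite_I) auto
  also have "\<dots> = (SUP r. emeasure ?P ((D - E) \<inter> PiE I (\<lambda>_. ball 0 (real r))))"
  proof (intro SUP_cong refl)
    fix r :: nat
    have "(D - E) \<inter> PiE I (\<lambda>_. ball 0 (real r)) \<in> sets ?P"
      using Dm Em finite_I by (intro sets.Int sets.Diff sets_PiM_I_finite) auto
    then show "(\<integral>\<^sup>+x. indicator (D - E) x * indicator (PiE I (\<lambda>_. ball 0 (real r))) x \<partial>?P)
        = emeasure ?P ((D - E) \<inter> PiE I (\<lambda>_. ball 0 (real r)))"
      by (simp flip: indicator_inter_arith)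
  qed
  also have "\<dots> = 0" by (simp add: zero)
  finally have "D - E \<in> null_sets ?P" using Dm Em by auto
  moreover have "C \<inter> space ?P - open_dilate 1 \<subseteq> D - E" using CD by (auto simp: E_def)
  ultimately show ?thesis using Em unfolding E_def by (intro exI[of _ 1] conjI bexI) simp_all
qed

lemma open_dilate_subset:
  assumes "t \<le> 1" shows "open_dilate t \<subseteq> C"
proof
  fix x assume "x \<in> open_dilate t"
  then obtain u where u: "0 \<le> u" "u < t" "x \<in> dilate u" by (auto simp: open_dilate_def)
  have "x \<in> dilate 1" by (rule dilate_mono[OF u(3,1)]) (use u(2) assms in simp)
  then show "x \<in> C" by (simp add: dilate_1)
qed

lemma open_dilate_cylinder:
  assumes "x \<in> open_dilate s" "\<And>i. i \<in> I \<Longrightarrow> y i = x i"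
  shows "y \<in> open_dilate s"
proof -
  obtain t where t: "0 \<le> t" "t < s" "x \<in> dilate t" using assms(1) by (auto simp: open_dilate_def)
  have "y \<in> dilate t" using dilate_cylinder[OF t(3) assms(2)] by simp
  with t show ?thesis unfolding open_dilate_def by blast
qed

lemma open_dilate_convex:
  assumes x: "x \<in> open_dilate s" and y: "y \<in> open_dilate s" and t: "0 \<le> t" "t \<le> 1"
  shows "(\<lambda>i. (1 - t) *\<^sub>R x i + t *\<^sub>R y i) \<in> open_dilate s"
proof -
  obtain u where u: "0 \<le> u" "u < s" "x \<in> dilate u" using x by (auto simp: open_dilate_def)
  obtain v where v: "0 \<le> v" "v < s" "y \<in> dilate v" using y by (auto simp: open_dilate_def)
  define m where "m = max u v"
  have "x \<in> dilate m" "y \<in> dilate m"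
    using dilate_mono[OF u(3,1), of m] dilate_mono[OF v(3,1), of m] by (auto simp: m_def)
  then have "(\<lambda>i. (1 - t) *\<^sub>R x i + t *\<^sub>R y i) \<in> dilate (\<bar>1 - t\<bar> * m + \<bar>t\<bar> * m)"
    using u(1) t by (intro dilate_add dilate_scale) (auto simp: m_def)
  moreover have "\<bar>1 - t\<bar> * m + \<bar>t\<bar> * m = m" using t by (simp add: algebra_simps)
  ultimately show ?thesis using u v unfolding open_dilate_def m_def by (auto intro!: exI[of _ "max u v"])
qed

lemma open_dilate_linear_image:
  assumes U: "linear U" "\<And>c. c \<in> C \<Longrightarrow> (\<lambda>i. U (c i)) \<in> C" and x: "x \<in> open_dilate s"
  shows "(\<lambda>i. U (x i)) \<in> open_dilate s"
proof -
  obtain u c where u: "0 \<le> u" "u < s" "c \<in> C" "\<forall>i\<in>I. x i = u *\<^sub>R c i"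
    using x by (auto simp: open_dilate_def dilate_def)
  then have "\<forall>i\<in>I. U (x i) = u *\<^sub>R U (c i)" using linear_scale[OF U(1)] by simp
  then have "(\<lambda>i. U (x i)) \<in> dilate u" 
    unfolding dilate_def using U(2)[OF u(3)] by (intro CollectI bexI[of _ "\<lambda>i. U (c i)"])
  then show ?thesis using u unfolding open_dilate_def by blast
qed

end

section \<open>Joint laws of independent random vectors\<close>

lemma emeasure_PiM_density:
  fixes g :: "'i \<Rightarrow> 'a::euclidean_space \<Rightarrow> ennreal"
  assumes I: "finite I" and g: "\<And>i. i \<in> I \<Longrightarrow> g i \<in> borel_measurable borel"
    and g1: "\<And>i. i \<in> I \<Longrightarrow> (\<integral>\<^sup>+x. g i x \<partial>lborel) = 1"
    and S: "S \<in> sets (PiM I (\<lambda>_. lborel))"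
  shows "emeasure (PiM I (\<lambda>i. density lborel (g i))) S
    = (\<integral>\<^sup>+x. indicator S x * (\<Prod>i\<in>I. g i (x i)) \<partial>PiM I (\<lambda>_. lborel))"
proof -
  let ?P = "PiM I (\<lambda>_. lborel :: 'a measure)"
  define D where "D i = (if i \<in> I then density lborel (g i) else lborel)" for i
  have "sigma_finite_measure (D i)" for i
  proof (cases "i \<in> I")
    case True
    have "prob_space (density lborel (g i))"
      by (rule prob_spaceI) (use g[OF True] g1[OF True] in \<open>simp add: emeasure_density\<close>)
    then show ?thesis using True by (simp add: D_def prob_space_imp_sigma_finite)
  next
    case False
    then show ?thesis using sigma_finite_lborel by (simp add: D_def)
  qed
  then interpret D: product_sigma_finite D by (intro product_sigma_finite.intro)
  interpret L: product_sigma_finite "\<lambda>_. lborel :: 'a measure" by (rule product_sigma_finite_lborel)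
  have gm: "(\<lambda>x. \<Prod>i\<in>I. g i (x i)) \<in> borel_measurable ?P"
    using g by (intro measurable_PiM_prod) auto
  have "density ?P (\<lambda>x. \<Prod>i\<in>I. g i (x i)) = PiM I D"
  proof (rule D.PiM_eqI[OF I])
    show "sets (density ?P (\<lambda>x. \<Prod>i\<in>I. g i (x i))) = sets (PiM I D)"
      unfolding sets_density by (intro sets_PiM_cong refl) (simp add: D_def)
    fix A assume "\<And>i. i \<in> I \<Longrightarrow> A i \<in> sets (D i)"
    then have A: "A i \<in> sets borel" if "i \<in> I" for i using that by (simp add: D_def)
    have box: "PiE I A \<in> sets ?P" using A I by (intro sets_PiM_I_finite) auto
    have "emeasure (density ?P (\<lambda>x. \<Prod>i\<in>I. g i (x i))) (PiE I A)
        = (\<integral>\<^sup>+x. (\<Prod>i\<in>I. g i (x i)) * indicator (PiE I A) x \<partial>?P)"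
      by (rule emeasure_density[OF gm box])
    also have "\<dots> = (\<integral>\<^sup>+x. (\<Prod>i\<in>I. g i (x i) * indicator (A i) (x i)) \<partial>?P)"
    proof (rule nn_integral_cong)
      fix x assume "x \<in> space ?P"
      then have "x \<in> PiE I (\<lambda>_. UNIV)" by (simp add: space_PiM)
      from prod_indicator_eq_PiE[OF I this, of A]
      show "(\<Prod>i\<in>I. g i (x i)) * indicator (PiE I A) x = (\<Prod>i\<in>I. g i (x i) * indicator (A i) (x i))"
        by (simp only: prod.distrib)
    qed
    also have "\<dots> = (\<Prod>i\<in>I. \<integral>\<^sup>+x. g i x * indicator (A i) x \<partial>lborel)"
    proof (rule L.product_nn_integral_prod[OF I])
      fix i assume i: "i \<in> I"
      note [measurable] = g[OF i] A[OF i]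
      show "(\<lambda>x. g i x * indicator (A i) x) \<in> borel_measurable lborel" by measurable
    qed
    also have "\<dots> = (\<Prod>i\<in>I. emeasure (D i) (A i))"
      using g A by (intro prod.cong) (auto simp: D_def emeasure_density)
    finally show "emeasure (density ?P (\<lambda>x. \<Prod>i\<in>I. g i (x i))) (PiE I A) = (\<Prod>i\<in>I. emeasure (D i) (A i))" .
  qed
  moreover have "PiM I D = PiM I (\<lambda>i. density lborel (g i))"
    by (intro PiM_cong) (simp_all add: D_def)
  ultimately have "emeasure (PiM I (\<lambda>i. density lborel (g i))) S = emeasure (density ?P (\<lambda>x. \<Prod>i\<in>I. g i (x i))) S"
    by simp
  also have "\<dots> = (\<integral>\<^sup>+x. (\<Prod>i\<in>I. g i (x i)) * indicator S x \<partial>?P)"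
    by (rule emeasure_density[OF gm S])
  finally show ?thesis by (simp add: mult.commute)
qed

lemma joint_law:
  fixes X :: "nat \<Rightarrow> 'w \<Rightarrow> real ^ 'n"
  assumes X: "indep_with_densities M I X g" and I: "finite I" "I \<noteq> {}"
    and S: "S \<in> sets (PiM I (\<lambda>_. lborel))"
  shows "{\<omega> \<in> space M. (\<lambda>i\<in>I. X i \<omega>) \<in> S} \<in> sets M"
    and "emeasure M {\<omega> \<in> space M. (\<lambda>i\<in>I. X i \<omega>) \<in> S}
      = (\<integral>\<^sup>+x. indicator S x * (\<Prod>i\<in>I. g i (x i)) \<partial>PiM I (\<lambda>_. lborel))"
proof -
  let ?B = "PiM I (\<lambda>_. borel :: (real ^ 'n) measure)"
  interpret prob_space M using X by (simp add: indep_with_densities_def)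
  have ind: "indep_vars (\<lambda>_. borel) X I" using X by (simp add: indep_with_densities_def)
  have d: "distributed M lborel (X i) (g i)" if "i \<in> I" for i
    using X that by (simp add: indep_with_densities_def)
  have rv: "X i \<in> M \<rightarrow>\<^sub>M borel" if "i \<in> I" for i
    using distributed_measurable[OF d[OF that]] by simp
  have gm: "g i \<in> borel_measurable borel" if "i \<in> I" for i
    using distributed_borel_measurable[OF d[OF that]] by simp
  have law: "distr M borel (X i) = density lborel (g i)" if "i \<in> I" for i
    using distributed_distr_eq_density[OF d[OF that]] by (simp cong: distr_cong)
  have g1: "(\<integral>\<^sup>+x. g i x \<partial>lborel) = 1" if "i \<in> I" for i
  proof -
    have "(\<integral>\<^sup>+x. g i x \<partial>lborel) = emeasure (density lborel (g i)) UNIV"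
      using gm[OF that] by (simp add: emeasure_density)
    also have "\<dots> = emeasure (distr M borel (X i)) UNIV" using law[OF that] by simp
    also have "\<dots> = 1" using rv[OF that] by (simp add: emeasure_distr emeasure_space_1)
    finally show ?thesis .
  qed
  have sB: "sets ?B = sets (PiM I (\<lambda>_. lborel))" by (intro sets_PiM_cong refl) simp
  have T: "(\<lambda>\<omega>. \<lambda>i\<in>I. X i \<omega>) \<in> M \<rightarrow>\<^sub>M ?B"
    using rv by (intro measurable_restrict)
  have S': "S \<in> sets ?B" using S sB by simp
  have ev: "{\<omega> \<in> space M. (\<lambda>i\<in>I. X i \<omega>) \<in> S} = (\<lambda>\<omega>. \<lambda>i\<in>I. X i \<omega>) -` S \<inter> space M" by auto
  show "{\<omega> \<in> space M. (\<lambda>i\<in>I. X i \<omega>) \<in> S} \<in> sets M"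
    unfolding ev by (rule measurable_sets[OF T S'])
  have "emeasure M {\<omega> \<in> space M. (\<lambda>i\<in>I. X i \<omega>) \<in> S} = emeasure (distr M ?B (\<lambda>\<omega>. \<lambda>i\<in>I. X i \<omega>)) S"
    unfolding ev by (rule emeasure_distr[OF T S', symmetric])
  also have "distr M ?B (\<lambda>\<omega>. \<lambda>i\<in>I. X i \<omega>) = PiM I (\<lambda>i. distr M borel (X i))"
    using indep_vars_iff_distr_eq_PiM'[where M' = "\<lambda>_. borel" and X = X and I = I] I rv ind by simp
  also have "\<dots> = PiM I (\<lambda>i. density lborel (g i))"
    by (intro PiM_cong refl law)
  also have "emeasure \<dots> S = (\<integral>\<^sup>+x. indicator S x * (\<Prod>i\<in>I. g i (x i)) \<partial>PiM I (\<lambda>_. lborel))"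
    by (rule emeasure_PiM_density[OF I(1) gm g1 S])
  finally show "emeasure M {\<omega> \<in> space M. (\<lambda>i\<in>I. X i \<omega>) \<in> S}
      = (\<integral>\<^sup>+x. indicator S x * (\<Prod>i\<in>I. g i (x i)) \<partial>PiM I (\<lambda>_. lborel))" .
qed

section \<open>Centres of balls with large intersection\<close>

definition ball_intersection :: "nat \<Rightarrow> (nat \<Rightarrow> real) \<Rightarrow> (nat \<Rightarrow> real ^ 'n) \<Rightarrow> (real ^ 'n) set" where
  "ball_intersection N r x = (\<Inter>i\<in>{1..N}. cball (x i) (r i))"

text \<open>As \<open>s\<close> will be nonnegative, membership includes that the intersection has nonempty interior.\<close>

definition exceeding_centres :: "((real ^ 'n) set \<Rightarrow> real) \<Rightarrow> nat \<Rightarrow> (nat \<Rightarrow> real) \<Rightarrow> real \<Rightarrow> (nat \<Rightarrow> real ^ 'n) set" where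
  "exceeding_centres \<phi> N r s = {x. s < body_value \<phi> (ball_intersection N r x)}"

text \<open>The event that the centres lie in the null set \<open>R\<close> has probability zero because the joint law has a density.
Hence the event in question differs from the measurable event given by \<open>E\<close> by a null set of the completion.\<close>

lemma prob_exceeds_eq_integral:
  fixes X :: "nat \<Rightarrow> 'w \<Rightarrow> real ^ 'n"
  assumes X: "indep_with_densities M {1..N} X g" and N: "1 \<le> N"
    and E: "E \<in> sets (PiM {1..N} (\<lambda>_. lborel))" "E \<subseteq> exceeding_centres \<phi> N r s"
    and R: "R \<in> null_sets (PiM {1..N} (\<lambda>_. lborel))"
      "exceeding_centres \<phi> N r s \<inter> space (PiM {1..N} (\<lambda>_. lborel)) - E \<subseteq> R"
  shows "prob_exceeds M \<phi> N r X s
    = enn2real (\<integral>\<^sup>+x. indicator E x * (\<Prod>i\<in>{1..N}. g i (x i)) \<partial>PiM {1..N} (\<lambda>_. lborel))"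
proof -
  let ?P = "PiM {1..N} (\<lambda>_. lborel :: (real ^ 'n) measure)"
  define T where "T \<omega> = (\<lambda>i\<in>{1..N}. X i \<omega>)" for \<omega>
  define A where "A = {\<omega> \<in> space M. T \<omega> \<in> exceeding_centres \<phi> N r s}"
  define B where "B = {\<omega> \<in> space M. T \<omega> \<in> E}"
  have I: "finite {1..N}" "{1..N} \<noteq> {}" using N by auto
  have B: "B \<in> sets M" "emeasure M B = (\<integral>\<^sup>+x. indicator E x * (\<Prod>i\<in>{1..N}. g i (x i)) \<partial>?P)"
    unfolding B_def T_def using joint_law[OF X I E(1)] by auto
  have Rs: "R \<in> sets ?P" using R(1) by auto
  have RM: "{\<omega> \<in> space M. T \<omega> \<in> R} \<in> sets M"
      "emeasure M {\<omega> \<in> space M. T \<omega> \<in> R} = (\<integral>\<^sup>+x. indicator R x * (\<Prod>i\<in>{1..N}. g i (x i)) \<partial>?P)"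
    unfolding T_def using joint_law[OF X I Rs] by auto
  have "(\<integral>\<^sup>+x. indicator R x * (\<Prod>i\<in>{1..N}. g i (x i)) \<partial>?P) = (\<integral>\<^sup>+x. 0 \<partial>?P)"
    using AE_not_in[OF R(1)] by (intro nn_integral_cong_AE) (auto elim!: eventually_mono)
  then have RN: "{\<omega> \<in> space M. T \<omega> \<in> R} \<in> null_sets M" using RM by auto
  have "A - B \<subseteq> {\<omega> \<in> space M. T \<omega> \<in> R}"
    using R(2) by (auto simp: A_def B_def T_def space_PiM)
  then have AB: "A - B \<in> null_sets (completion M)"
    by (rule null_sets_completion_subset[OF _ null_sets_completionI[OF RN]])
  have "body_value \<phi> (\<Inter>i\<in>{1..N}. cball (X i \<omega>) (r i)) = body_value \<phi> (ball_intersection N r (T \<omega>))" for \<omega>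
    by (simp add: ball_intersection_def T_def)
  then have "prob_exceeds M \<phi> N r X s = measure (completion M) A"
    by (simp add: prob_exceeds_def A_def exceeding_centres_def)
  also have "A = B \<union> (A - B)" using E(2) by (auto simp: A_def B_def)
  also have "measure (completion M) (B \<union> (A - B)) = measure (completion M) B"
    using B(1) AB by (intro measure_Un_null_set) auto
  also have "\<dots> = measure M B" using B(1) by (simp add: measure_completion)
  finally show ?thesis using B(2) by (simp add: measure_def)
qed

lemma convex_body_ball_intersection:
  assumes "1 \<le> N" "interior (ball_intersection N r x) \<noteq> {}"
  shows "convex_body (ball_intersection N r x)"
  unfolding convex_body_def
proof (intro conjI assms(2))
  show "compact (ball_intersection N r x)"
  proof -
    have "ball_intersection N r x = cball (x 1) (r 1) \<inter> (\<Inter>i\<in>{1..N}. cball (x i) (r i))"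
      using assms(1) by (auto simp: ball_intersection_def)
    moreover have "compact (cball (x 1) (r 1) \<inter> (\<Inter>i\<in>{1..N}. cball (x i) (r i)))"
      by (intro compact_Int_closed compact_cball closed_INT) auto
    ultimately show ?thesis by simp
  qed
  show "convex (ball_intersection N r x)"
    unfolding ball_intersection_def by (intro convex_INT) auto
qed

lemma convex_body_minkowski_combination:
  assumes K: "convex_body K" and L: "convex_body L" and t: "0 < t" "t < 1"
  shows "convex_body ((\<lambda>x. (1 - t) *\<^sub>R x) ` K + (\<lambda>x. t *\<^sub>R x) ` L)"
  unfolding convex_body_def
proof (intro conjI)
  have cK: "compact ((\<lambda>x. (1 - t) *\<^sub>R x) ` K)" and cL: "compact ((\<lambda>x. t *\<^sub>R x) ` L)"
    using K L by (auto simp: convex_body_def intro: compact_scaling)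
  show "compact ((\<lambda>x. (1 - t) *\<^sub>R x) ` K + (\<lambda>x. t *\<^sub>R x) ` L)"
    unfolding set_plus_image
    by (rule compact_continuous_image[OF _ compact_Times[OF cK cL]])
      (auto simp: case_prod_beta' intro!: continuous_intros)
  show "convex ((\<lambda>x. (1 - t) *\<^sub>R x) ` K + (\<lambda>x. t *\<^sub>R x) ` L)"
    using K L by (intro convex_set_plus convex_scaling) (auto simp: convex_body_def)
  obtain p e where p: "0 < e" "ball p e \<subseteq> K"
    using K by (auto simp: convex_body_def mem_interior)
  obtain q where q: "q \<in> L" using L interior_subset by (fastforce simp: convex_body_def)
  have "ball ((1 - t) *\<^sub>R p + t *\<^sub>R q) ((1 - t) * e) \<subseteq> (\<lambda>x. (1 - t) *\<^sub>R x) ` K + (\<lambda>x. t *\<^sub>R x) ` L"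
  proof
    fix z assume z: "z \<in> ball ((1 - t) *\<^sub>R p + t *\<^sub>R q) ((1 - t) * e)"
    (* Solves z = (1 - t) y + t q, so that z belongs to the combination once y is in K. *)
    define y where "y = (1 / (1 - t)) *\<^sub>R (z - t *\<^sub>R q)"
    have zy: "z = (1 - t) *\<^sub>R y + t *\<^sub>R q" using t by (simp add: y_def)
    then have "(1 - t) *\<^sub>R p + t *\<^sub>R q - z = (1 - t) *\<^sub>R (p - y)" by (simp add: algebra_simps)
    then have "(1 - t) * norm (p - y) < (1 - t) * e" using z t by (simp add: dist_norm)
    then have "y \<in> K" using p(2) t by (auto simp: dist_norm subset_iff)
    then show "z \<in> (\<lambda>x. (1 - t) *\<^sub>R x) ` K + (\<lambda>x. t *\<^sub>R x) ` L" using q zy by (auto simp: set_plus_def)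
  qed
  then have "(1 - t) *\<^sub>R p + t *\<^sub>R q \<in> interior ((\<lambda>x. (1 - t) *\<^sub>R x) ` K + (\<lambda>x. t *\<^sub>R x) ` L)"
    using p(1) t unfolding mem_interior by (intro exI[of _ "(1 - t) * e"]) simp
  then show "interior ((\<lambda>x. (1 - t) *\<^sub>R x) ` K + (\<lambda>x. t *\<^sub>R x) ` L) \<noteq> {}" by blast
qed

lemma minkowski_subset_ball_intersection:
  assumes t: "0 \<le> t" "t \<le> 1"
  shows "(\<lambda>x. (1 - t) *\<^sub>R x) ` ball_intersection N r x + (\<lambda>x. t *\<^sub>R x) ` ball_intersection N r y
    \<subseteq> ball_intersection N r (\<lambda>i. (1 - t) *\<^sub>R x i + t *\<^sub>R y i)"
proof
  fix z assume "z \<in> (\<lambda>x. (1 - t) *\<^sub>R x) ` ball_intersection N r x + (\<lambda>x. t *\<^sub>R x) ` ball_intersection N r y"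
  then obtain u v where u: "u \<in> ball_intersection N r x" and v: "v \<in> ball_intersection N r y"
      and z: "z = (1 - t) *\<^sub>R u + t *\<^sub>R v"
    by (auto simp: set_plus_def)
  have "dist ((1 - t) *\<^sub>R x i + t *\<^sub>R y i) z \<le> r i" if i: "i \<in> {1..N}" for i
  proof -
    have "norm (x i - u) \<le> r i" "norm (y i - v) \<le> r i"
      using u v i by (auto simp: ball_intersection_def dist_norm)
    have "(1 - t) *\<^sub>R x i + t *\<^sub>R y i - z = (1 - t) *\<^sub>R (x i - u) + t *\<^sub>R (y i - v)"
      by (simp add: z algebra_simps)
    then have "dist ((1 - t) *\<^sub>R x i + t *\<^sub>R y i) z \<le> (1 - t) * norm (x i - u) + t * norm (y i - v)"
      using t norm_triangle_ineq[of "(1 - t) *\<^sub>R (x i - u)" "t *\<^sub>R (y i - v)"] by (simp add: dist_norm)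
    also have "\<dots> \<le> (1 - t) * r i + t * r i"
      using t \<open>norm (x i - u) \<le> r i\<close> \<open>norm (y i - v) \<le> r i\<close> by (intro add_mono mult_left_mono) auto
    also have "\<dots> = r i" by (simp add: algebra_simps)
    finally show ?thesis .
  qed
  then show "z \<in> ball_intersection N r (\<lambda>i. (1 - t) *\<^sub>R x i + t *\<^sub>R y i)"
    by (simp add: ball_intersection_def)
qed

text \<open>The Minkowski combination of the two intersections is a convex body inside the intersection that belongs
to the combined centres; quasi-concavity bounds \<open>\<phi>\<close> from below on the former, monotonicity passes
to the latter.\<close>

lemma exceeding_centres_convex:
  assumes N: "1 \<le> N" and qc: "minkowski_quasi_concave \<phi>" and mono: "monotone_on_bodies \<phi>"
    and s: "0 \<le> s" and x: "x \<in> exceeding_centres \<phi> N r s" and y: "y \<in> exceeding_centres \<phi> N r s" and t: "0 \<le> t" "t \<le> 1"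
  shows "(\<lambda>i. (1 - t) *\<^sub>R x i + t *\<^sub>R y i) \<in> exceeding_centres \<phi> N r s"
proof (cases "t = 0 \<or> t = 1")
  case True
  then show ?thesis using x y by auto
next
  case False
  then have t': "0 < t" "t < 1" using t by auto
  define K where "K = ball_intersection N r x"
  define L where "L = ball_intersection N r y"
  define Z where "Z = ball_intersection N r (\<lambda>i. (1 - t) *\<^sub>R x i + t *\<^sub>R y i)"
  define Q where "Q = (\<lambda>x. (1 - t) *\<^sub>R x) ` K + (\<lambda>x. t *\<^sub>R x) ` L"
  have KL: "convex_body K" "s < \<phi> K" "convex_body L" "s < \<phi> L"
    using x y s convex_body_ball_intersection[OF N]
    by (auto simp: exceeding_centres_def body_value_def K_def L_def split: if_splits)
  have Q: "convex_body Q" unfolding Q_def by (rule convex_body_minkowski_combination[OF KL(1,3) t'])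
  have QZ: "Q \<subseteq> Z" unfolding Q_def K_def L_def Z_def by (rule minkowski_subset_ball_intersection[OF t])
  then have Zi: "interior Z \<noteq> {}" using Q interior_mono[OF QZ] by (auto simp: convex_body_def)
  then have Z: "convex_body Z" unfolding Z_def by (rule convex_body_ball_intersection[OF N])
  have "s < min (\<phi> K) (\<phi> L)" using KL by simp
  also have "\<dots> \<le> \<phi> Q" using qc KL(1,3) t' unfolding minkowski_quasi_concave_def Q_def by blast
  also have "\<dots> \<le> \<phi> Z" using mono Q Z QZ unfolding monotone_on_bodies_def by blast
  finally show ?thesis using Zi by (simp add: exceeding_centres_def body_value_def Z_def)
qed

lemma exceeding_centres_rotate:
  assumes N: "1 \<le> N" and rot: "rotation_invariant \<phi>" and U: "orthogonal_transformation U"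
    and s: "0 \<le> s" and x: "x \<in> exceeding_centres \<phi> N r s"
  shows "(\<lambda>i. U (x i)) \<in> exceeding_centres \<phi> N r s"
proof -
  define K where "K = ball_intersection N r x"
  have i: "interior K \<noteq> {}" and K: "s < \<phi> K"
    using x s by (auto simp: exceeding_centres_def body_value_def K_def split: if_splits)
  have cb: "convex_body K" unfolding K_def by (rule convex_body_ball_intersection[OF N i[unfolded K_def]])
  have bij: "bij U" by (rule orthogonal_transformation_bij[OF U])
  have "ball_intersection N r (\<lambda>i. U (x i)) = (\<Inter>i\<in>{1..N}. U ` cball (x i) (r i))"
    unfolding ball_intersection_def image_orthogonal_transformation_cball[OF U] ..
  also have "\<dots> = U ` K"
    unfolding K_def ball_intersection_def by (rule bij_image_INT[OF bij, symmetric])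
  finally have UK: "ball_intersection N r (\<lambda>i. U (x i)) = U ` K" .
  have "interior (U ` K) = U ` interior K"
    using orthogonal_transformation_linear[OF U] orthogonal_transformation_inj[OF U]
    by (rule interior_injective_linear_image)
  then have "interior (U ` K) \<noteq> {}" using i by simp
  moreover have "\<phi> (U ` K) = \<phi> K" using rot U cb unfolding rotation_invariant_def by blast
  ultimately show ?thesis using K by (simp add: exceeding_centres_def body_value_def UK)
qed

lemma orthogonal_reflection:
  fixes e :: "'a::euclidean_space"
  assumes "norm e = 1"
  shows "orthogonal_transformation (\<lambda>v. v - (2 * (v \<bullet> e)) *\<^sub>R e)"
  unfolding orthogonal_transformation_def
proof (intro conjI allI)
  have ee: "e \<bullet> e = 1" using assms by (simp add: norm_eq_1)
  show "linear (\<lambda>v. v - (2 * (v \<bullet> e)) *\<^sub>R e)"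
    by (rule linearI) (simp_all add: inner_add_left algebra_simps)
  show "(v - (2 * (v \<bullet> e)) *\<^sub>R e) \<bullet> (w - (2 * (w \<bullet> e)) *\<^sub>R e) = v \<bullet> w" for v w
    by (simp add: inner_diff_left inner_diff_right ee inner_commute[of e w] inner_commute[of e v])
qed

text \<open>The set of centres is replaced by a measurable subset that has the same symmetries and differs from it by
a null set.\<close>

lemma exceeding_centres_kernel:
  fixes \<phi> :: "(real ^ 'n) set \<Rightarrow> real"
  assumes N: "1 \<le> N" and qc: "minkowski_quasi_concave \<phi>" and mono: "monotone_on_bodies \<phi>"
    and rot: "rotation_invariant \<phi>" and s: "0 \<le> s"
  obtains E R where "E \<in> sets (PiM {1..N} (\<lambda>_. lborel))" "E \<subseteq> exceeding_centres \<phi> N r s"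
    "R \<in> null_sets (PiM {1..N} (\<lambda>_. lborel))"
    "exceeding_centres \<phi> N r s \<inter> space (PiM {1..N} (\<lambda>_. lborel)) - E \<subseteq> R"
    "\<And>x y t. x \<in> E \<Longrightarrow> y \<in> E \<Longrightarrow> 0 \<le> t \<Longrightarrow> t \<le> 1 \<Longrightarrow> (\<lambda>i\<in>{1..N}. (1 - t) *\<^sub>R x i + t *\<^sub>R y i) \<in> E"
    "\<And>e x. norm e = 1 \<Longrightarrow> x \<in> E \<Longrightarrow> (\<lambda>i\<in>{1..N}. x i - (2 * (x i \<bullet> e)) *\<^sub>R e) \<in> E"
proof (cases "exceeding_centres \<phi> N r s = {}")
  case True
  then show ?thesis by (intro that[of "{}" "{}"]) auto
next
  case False
  let ?P = "PiM {1..N} (\<lambda>_. lborel :: (real ^ 'n) measure)"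
  interpret symmetric_convex_cylinder "{1..N}" "exceeding_centres \<phi> N r s"
  proof
    show "finite {1..N}" by simp
    show "y \<in> exceeding_centres \<phi> N r s" if "x \<in> exceeding_centres \<phi> N r s" "\<And>i. i \<in> {1..N} \<Longrightarrow> y i = x i" for x y
    proof -
      have "ball_intersection N r y = ball_intersection N r x"
        unfolding ball_intersection_def using that(2) by (intro INF_cong) auto
      then show ?thesis using that(1) by (simp add: exceeding_centres_def)
    qed
    show "(\<lambda>i. (1 - t) *\<^sub>R x i + t *\<^sub>R y i) \<in> exceeding_centres \<phi> N r s"
      if "x \<in> exceeding_centres \<phi> N r s" "y \<in> exceeding_centres \<phi> N r s" "0 \<le> t" "t \<le> 1" for x y t
      by (rule exceeding_centres_convex[OF N qc mono s that])
    show "(\<lambda>i. - x i) \<in> exceeding_centres \<phi> N r s" if "x \<in> exceeding_centres \<phi> N r s" for x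
      using exceeding_centres_rotate[OF N rot _ s that, of uminus] orthogonal_transformation_neg[of "\<lambda>x. x"] by simp
    show "exceeding_centres \<phi> N r s \<noteq> {}" by (rule False)
  qed
  obtain t R where t: "t \<le> 1" "open_dilate t \<inter> space ?P \<in> sets ?P" "R \<in> null_sets ?P"
      "exceeding_centres \<phi> N r s \<inter> space ?P - open_dilate t \<subseteq> R"
    using open_kernel_almost_all by blast
  show ?thesis
  proof (rule that[of "open_dilate t \<inter> space ?P" R])
    show "open_dilate t \<inter> space ?P \<in> sets ?P" "R \<in> null_sets ?P" by (rule t)+
    show "open_dilate t \<inter> space ?P \<subseteq> exceeding_centres \<phi> N r s" using open_dilate_subset[OF t(1)] by blast
    show "exceeding_centres \<phi> N r s \<inter> space ?P - open_dilate t \<inter> space ?P \<subseteq> R" using t(4) by blast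
    show "(\<lambda>i\<in>{1..N}. (1 - u) *\<^sub>R x i + u *\<^sub>R y i) \<in> open_dilate t \<inter> space ?P"
      if "x \<in> open_dilate t \<inter> space ?P" "y \<in> open_dilate t \<inter> space ?P" "0 \<le> u" "u \<le> 1" for x y u
    proof
      have "(\<lambda>i. (1 - u) *\<^sub>R x i + u *\<^sub>R y i) \<in> open_dilate t"
        using that by (intro open_dilate_convex) auto
      then show "(\<lambda>i\<in>{1..N}. (1 - u) *\<^sub>R x i + u *\<^sub>R y i) \<in> open_dilate t"
        by (rule open_dilate_cylinder) simp
      show "(\<lambda>i\<in>{1..N}. (1 - u) *\<^sub>R x i + u *\<^sub>R y i) \<in> space ?P" by (simp add: space_PiM)
    qed
    show "(\<lambda>i\<in>{1..N}. x i - (2 * (x i \<bullet> e)) *\<^sub>R e) \<in> open_dilate t \<inter> space ?P"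
      if e: "norm e = 1" and x: "x \<in> open_dilate t \<inter> space ?P" for e x
    proof
      let ?U = "\<lambda>v. v - (2 * (v \<bullet> e)) *\<^sub>R e"
      have U: "orthogonal_transformation ?U" by (rule orthogonal_reflection[OF e])
      have "(\<lambda>i. ?U (x i)) \<in> open_dilate t"
      proof (rule open_dilate_linear_image[OF orthogonal_transformation_linear[OF U]])
        show "(\<lambda>i. ?U (c i)) \<in> exceeding_centres \<phi> N r s" if "c \<in> exceeding_centres \<phi> N r s" for c
          by (rule exceeding_centres_rotate[OF N rot U s that])
        show "x \<in> open_dilate t" using x by simp
      qed
      then show "(\<lambda>i\<in>{1..N}. ?U (x i)) \<in> open_dilate t"
        by (rule open_dilate_cylinder) simp
      show "(\<lambda>i\<in>{1..N}. ?U (x i)) \<in> space ?P" by (simp add: space_PiM)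
    qed
  qed
qed

section \<open>The comparison of probabilities\<close>

lemma superlevel_volume_finite:
  assumes f: "prob_density f" and s: "0 < s"
  shows "emeasure lborel {y. s < f y} < \<top>"
proof -
  have [measurable]: "f \<in> borel_measurable borel" using f by (simp add: prob_density_def)
  have "ennreal s * emeasure lborel {y. s < f y} = (\<integral>\<^sup>+y. ennreal s * indicator {y. s < f y} y \<partial>lborel)"
    by (subst nn_integral_cmult_indicator) auto
  also have "\<dots> \<le> (\<integral>\<^sup>+y. ennreal (f y) \<partial>lborel)"
    by (intro nn_integral_mono) (auto simp: indicator_def ennreal_leI)
  also have "\<dots> = 1" using f by (simp add: prob_density_def)
  finally have le: "ennreal s * emeasure lborel {y. s < f y} \<le> 1" .
  show ?thesis
  proof (rule ccontr)
    assume "\<not> ?thesis"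
    then have "emeasure lborel {y. s < f y} = \<top>" by (metis less_top)
    then show False using le s by (simp add: ennreal_mult_top top_unique)
  qed
qed

lemma rearranged_set_eq_ball:
  fixes A :: "(real ^ 'n) set"
  assumes "emeasure lborel A < \<top>"
  shows "rearranged_set A = ball 0 (vol_radius A)"
  unfolding rearranged_set_def
proof (rule the_equality)
  show "(\<exists>r. ball 0 (vol_radius A) = ball 0 r) \<and> emeasure lborel (ball (0::real ^ 'n) (vol_radius A)) = emeasure lborel A"
    using emeasure_ball_vol_radius[OF assms] by blast
  fix S :: "(real ^ 'n) set" assume S: "(\<exists>r. S = ball 0 r) \<and> emeasure lborel S = emeasure lborel A"
  then obtain r where "S = ball 0 r" by blast
  moreover have "ball (0::real ^ 'n) r = ball 0 (max 0 r)" by (cases "0 \<le> r") auto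
  ultimately have r: "S = ball 0 (max 0 r)" by simp
  have eq: "emeasure lborel (ball (0::real ^ 'n) (max 0 r)) = emeasure lborel (ball (0::real ^ 'n) (vol_radius A))"
    using S r emeasure_ball_vol_radius[OF assms] by simp
  have "max 0 r = vol_radius A"
    using radius_le_of_ball_volume_le[where 'a = "real ^ 'n", of "max 0 r" "vol_radius A"]
      radius_le_of_ball_volume_le[where 'a = "real ^ 'n", of "vol_radius A" "max 0 r"] eq vol_radius_nonneg[of A]
    by (intro antisym) simp_all
  then show "S = ball 0 (vol_radius A)" using r by simp
qed

lemma sym_decr_rearrangement_eq:
  fixes f :: "real ^ 'n \<Rightarrow> real"
  assumes "prob_density f"
  shows "sym_decr_rearrangement f x
    = (\<integral>\<^sup>+s. indicator {0<..} s * indicator (ball 0 (vol_radius {y. s < f y})) x \<partial>lborel)"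
  unfolding sym_decr_rearrangement_def
proof (rule nn_integral_cong)
  fix s :: real
  show "indicator (rearranged_set {y. s < f y}) x * indicator {0<..} s
      = (indicator {0<..} s * indicator (ball 0 (vol_radius {y. s < f y})) x :: ennreal)"
    by (cases "0 < s") (simp_all add: rearranged_set_eq_ball[OF superlevel_volume_finite[OF assms]])
qed

text \<open>Comparing two laws of the centres amounts to comparing the integrals of the densities over all
measurable convex sets that are invariant under reflections. This form serves both parts of the theorem.\<close>

lemma prob_exceeds_le_of_integrals:
  fixes \<phi> :: "(real ^ 'n) set \<Rightarrow> real" and X :: "nat \<Rightarrow> 'v \<Rightarrow> real ^ 'n" and Y :: "nat \<Rightarrow> 'w \<Rightarrow> real ^ 'n"
  assumes N: "1 \<le> N" and qc: "minkowski_quasi_concave \<phi>" and mono: "monotone_on_bodies \<phi>"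
    and rot: "rotation_invariant \<phi>"
    and X: "indep_with_densities M {1..N} X h" and Y: "indep_with_densities W {1..N} Y g" and s: "0 \<le> s"
    and le: "\<And>E. E \<in> sets (PiM {1..N} (\<lambda>_. lborel)) \<Longrightarrow>
        (\<And>x y t. x \<in> E \<Longrightarrow> y \<in> E \<Longrightarrow> 0 \<le> t \<Longrightarrow> t \<le> 1 \<Longrightarrow> (\<lambda>i\<in>{1..N}. (1 - t) *\<^sub>R x i + t *\<^sub>R y i) \<in> E) \<Longrightarrow>
        (\<And>e x. norm e = 1 \<Longrightarrow> x \<in> E \<Longrightarrow> (\<lambda>i\<in>{1..N}. x i - (2 * (x i \<bullet> e)) *\<^sub>R e) \<in> E) \<Longrightarrow>
        (\<integral>\<^sup>+x. indicator E x * (\<Prod>i\<in>{1..N}. h i (x i)) \<partial>PiM {1..N} (\<lambda>_. lborel))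
        \<le> (\<integral>\<^sup>+x. indicator E x * (\<Prod>i\<in>{1..N}. g i (x i)) \<partial>PiM {1..N} (\<lambda>_. lborel))"
  shows "prob_exceeds M \<phi> N r X s \<le> prob_exceeds W \<phi> N r Y s"
proof -
  let ?P = "PiM {1..N} (\<lambda>_. lborel :: (real ^ 'n) measure)"
  have I: "finite {1..N}" "{1..N} \<noteq> {}" using N by auto
  obtain E R where ER: "E \<in> sets ?P" "E \<subseteq> exceeding_centres \<phi> N r s" "R \<in> null_sets ?P"
      "exceeding_centres \<phi> N r s \<inter> space ?P - E \<subseteq> R"
    and conv: "\<And>x y t. x \<in> E \<Longrightarrow> y \<in> E \<Longrightarrow> 0 \<le> t \<Longrightarrow> t \<le> 1 \<Longrightarrow> (\<lambda>i\<in>{1..N}. (1 - t) *\<^sub>R x i + t *\<^sub>R y i) \<in> E"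
    and refl: "\<And>e x. norm e = 1 \<Longrightarrow> x \<in> E \<Longrightarrow> (\<lambda>i\<in>{1..N}. x i - (2 * (x i \<bullet> e)) *\<^sub>R e) \<in> E"
    by (rule exceeding_centres_kernel[OF N qc mono rot s]) (rule that)
  interpret W: prob_space W using Y by (simp add: indep_with_densities_def)
  have "(\<integral>\<^sup>+x. indicator E x * (\<Prod>i\<in>{1..N}. g i (x i)) \<partial>?P) < \<top>"
    unfolding joint_law(2)[OF Y I ER(1), symmetric] by (simp add: W.emeasure_eq_measure)
  then show ?thesis
    unfolding prob_exceeds_eq_integral[OF X N ER] prob_exceeds_eq_integral[OF Y N ER]
    by (intro enn2real_mono le[OF ER(1) conv refl])
qed

theorem theorem3p1:
  fixes N :: nat and r :: "nat \<Rightarrow> real"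
    and \<phi> :: "(real ^ 'n) set \<Rightarrow> real"
    and f :: "nat \<Rightarrow> real ^ 'n \<Rightarrow> real"
    and M :: "'a measure" and X :: "nat \<Rightarrow> 'a \<Rightarrow> real ^ 'n"
    and M' :: "'b measure" and X' :: "nat \<Rightarrow> 'b \<Rightarrow> real ^ 'n"
    and M'' :: "'c measure" and Z :: "nat \<Rightarrow> 'c \<Rightarrow> real ^ 'n"
    and a :: "nat \<Rightarrow> ennreal" and b :: "nat \<Rightarrow> real"
  assumes "N \<ge> 1"
    and "\<And>i. i \<in> {1..N} \<Longrightarrow> r i > 0"
    and "\<And>K. convex_body K \<Longrightarrow> \<phi> K \<ge> 0"
    and "minkowski_quasi_concave \<phi>"
    and "monotone_on_bodies \<phi>"
    and "rotation_invariant \<phi>"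
    and "\<And>i. i \<in> {1..N} \<Longrightarrow> prob_density (f i)"
    and "indep_with_densities M {1..N} X (\<lambda>i x. ennreal (f i x))"
  shows "(indep_with_densities M' {1..N} X' (\<lambda>i. sym_decr_rearrangement (f i)) \<longrightarrow>
           (\<forall>s\<ge>0. prob_exceeds M \<phi> N r X s \<le> prob_exceeds M' \<phi> N r X' s))
       \<and> ((\<forall>i\<in>{1..N}. bounded (range (f i)) \<and> a i = Linf_norm (f i) \<and> b i > 0 \<and>
             (\<integral>\<^sup>+ x. a i * indicator (cball (0 :: real ^ 'n) (b i)) x \<partial>lborel) = 1) \<and>
           indep_with_densities M'' {1..N} Z (\<lambda>i x. a i * indicator (cball 0 (b i)) x) \<longrightarrow>
           (\<forall>s\<ge>0. prob_exceeds M \<phi> N r X s \<le> prob_exceeds M'' \<phi> N r Z s))"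
proof (intro conjI impI allI)
  let ?P = "PiM {1..N} (\<lambda>_. lborel :: (real ^ 'n) measure)"
  note N = \<open>N \<ge> 1\<close> and f = \<open>\<And>i. i \<in> {1..N} \<Longrightarrow> prob_density (f i)\<close>
  have I: "finite {1..N}" "{1..N} \<noteq> {}" using N by auto
  have fm: "f i \<in> borel_measurable borel" "\<And>x. 0 \<le> f i x" "(\<integral>\<^sup>+x. ennreal (f i x) \<partial>lborel) = 1"
    if "i \<in> {1..N}" for i using f[OF that] by (auto simp: prob_density_def)
  note compare = prob_exceeds_le_of_integrals[OF N assms(4-6,8)]
  {
    fix s :: real
    assume Y: "indep_with_densities M' {1..N} X' (\<lambda>i. sym_decr_rearrangement (f i))" and s: "0 \<le> s"
    show "prob_exceeds M \<phi> N r X s \<le> prob_exceeds M' \<phi> N r X' s"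
    proof (rule compare[OF Y s])
      fix E assume E: "E \<in> sets ?P"
        "\<And>x y t. x \<in> E \<Longrightarrow> y \<in> E \<Longrightarrow> 0 \<le> t \<Longrightarrow> t \<le> 1 \<Longrightarrow> (\<lambda>i\<in>{1..N}. (1 - t) *\<^sub>R x i + t *\<^sub>R y i) \<in> E"
        "\<And>e x. norm e = 1 \<Longrightarrow> x \<in> E \<Longrightarrow> (\<lambda>i\<in>{1..N}. x i - (2 * (x i \<bullet> e)) *\<^sub>R e) \<in> E"
      have "(\<Prod>i\<in>{1..N}. sym_decr_rearrangement (f i) (x i))
          = (\<Prod>i\<in>{1..N}. \<integral>\<^sup>+s. indicator {0<..} s * indicator (ball 0 (vol_radius {y. s < f i y})) (x i) \<partial>lborel)" for x
        by (intro prod.cong refl sym_decr_rearrangement_eq f)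
      then show "(\<integral>\<^sup>+x. indicator E x * (\<Prod>i\<in>{1..N}. ennreal (f i (x i))) \<partial>?P)
          \<le> (\<integral>\<^sup>+x. indicator E x * (\<Prod>i\<in>{1..N}. sym_decr_rearrangement (f i) (x i)) \<partial>?P)"
        by (simp only:) (rule rearrangement_functions[OF I(1) E fm(1,2) superlevel_volume_finite[OF f]])
    qed
  next
    fix s :: real
    assume *: "(\<forall>i\<in>{1..N}. bounded (range (f i)) \<and> a i = Linf_norm (f i) \<and> b i > 0 \<and>
             (\<integral>\<^sup>+ x. a i * indicator (cball (0 :: real ^ 'n) (b i)) x \<partial>lborel) = 1) \<and>
           indep_with_densities M'' {1..N} Z (\<lambda>i x. a i * indicator (cball 0 (b i)) x)" and s: "0 \<le> s"
    define \<alpha> where "\<alpha> i = enn2real (a i)" for i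
    have b: "0 < b i" if "i \<in> {1..N}" for i using * that by blast
    have vol: "a i * emeasure lborel (ball (0 :: real ^ 'n) (b i)) = 1" if i: "i \<in> {1..N}" for i
    proof -
      have "(\<integral>\<^sup>+ x. a i * indicator (cball (0 :: real ^ 'n) (b i)) x \<partial>lborel) = 1" using * i by blast
      then have "a i * emeasure lborel (cball (0 :: real ^ 'n) (b i)) = 1"
        by (simp add: nn_integral_cmult_indicator)
      then show ?thesis using b[OF i] by (simp add: emeasure_ball emeasure_cball)
    qed
    have a: "a i = ennreal (\<alpha> i)" "0 < \<alpha> i" if i: "i \<in> {1..N}" for i
    proof -
      have pos: "emeasure lborel (ball (0 :: real ^ 'n) (b i)) \<noteq> 0" "a i \<noteq> 0" using vol[OF i] by auto
      have "a i \<noteq> \<top>"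
      proof
        assume "a i = \<top>"
        then show False using vol[OF i] pos by (simp add: ennreal_top_mult)
      qed
      then show "a i = ennreal (\<alpha> i)" by (simp add: \<alpha>_def less_top)
      with pos(2) show "0 < \<alpha> i" by (metis \<alpha>_def enn2real_nonneg ennreal_0 order_le_less)
    qed
    have ae: "AE x in lborel. f i x \<le> \<alpha> i" if i: "i \<in> {1..N}" for i
    proof -
      have "AE x in lborel. ennreal \<bar>f i x\<bar> \<le> esssup lborel (\<lambda>x. ennreal \<bar>f i x\<bar>)"
        by (rule esssup_AE)
      moreover have "esssup lborel (\<lambda>x. ennreal \<bar>f i x\<bar>) = ennreal (\<alpha> i)"
        using * i a(1)[OF i] by (simp add: Linf_norm_def)
      ultimately show ?thesis
        using a(2)[OF i] fm(2)[OF i] by (auto elim!: eventually_mono simp: ennreal_le_iff)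
    qed
    show "prob_exceeds M \<phi> N r X s \<le> prob_exceeds M'' \<phi> N r Z s"
    proof (rule compare[OF conjunct2[OF *] s])
      fix E assume E: "E \<in> sets ?P"
        "\<And>x y t. x \<in> E \<Longrightarrow> y \<in> E \<Longrightarrow> 0 \<le> t \<Longrightarrow> t \<le> 1 \<Longrightarrow> (\<lambda>i\<in>{1..N}. (1 - t) *\<^sub>R x i + t *\<^sub>R y i) \<in> E"
        "\<And>e x. norm e = 1 \<Longrightarrow> x \<in> E \<Longrightarrow> (\<lambda>i\<in>{1..N}. x i - (2 * (x i \<bullet> e)) *\<^sub>R e) \<in> E"
      have "(\<integral>\<^sup>+x. indicator E x * (\<Prod>i\<in>{1..N}. ennreal (f i (x i))) \<partial>?P)
          \<le> (\<integral>\<^sup>+x. indicator E x * (\<Prod>i\<in>{1..N}. ennreal (\<alpha> i) * indicator (ball 0 (b i)) (x i)) \<partial>?P)"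
      proof (rule rearrangement_bounded_functions[OF I(1) E fm(1,2) _ ae a(2)])
        fix i assume i: "i \<in> {1..N}"
        show "(\<integral>\<^sup>+x. ennreal (f i x) \<partial>lborel) \<le> 1" using fm(3)[OF i] by simp
        show "0 \<le> b i" using b[OF i] by simp
        show "ennreal (\<alpha> i) * emeasure lborel (ball (0 :: real ^ 'n) (b i)) = 1" using vol[OF i] a(1)[OF i] by simp
      qed
      also have "\<dots> \<le> (\<integral>\<^sup>+x. indicator E x * (\<Prod>i\<in>{1..N}. a i * indicator (cball 0 (b i)) (x i)) \<partial>?P)"
      proof (intro nn_integral_mono mult_left_mono prod_mono_ennreal)
        fix x :: "nat \<Rightarrow> real ^ 'n" and i assume i: "i \<in> {1..N}"
        show "ennreal (\<alpha> i) * indicator (ball 0 (b i)) (x i) \<le> a i * indicator (cball 0 (b i)) (x i)"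
          using a(1)[OF i] by (auto simp: indicator_def)
      qed simp
      finally show "(\<integral>\<^sup>+x. indicator E x * (\<Prod>i\<in>{1..N}. ennreal (f i (x i))) \<partial>?P)
          \<le> (\<integral>\<^sup>+x. indicator E x * (\<Prod>i\<in>{1..N}. a i * indicator (cball 0 (b i)) (x i)) \<partial>?P)" .
    qed
  }
qed

end
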